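(* Let $V$ be a finite set and let $f:2^V\to\mathbb{Z}$ be a submodular function. Let $\mathcal{F}\subseteq 2^V$ be an intersecting family or a crossing family. Suppose that we are given a membership oracle for $\mathcal{F}$. Then a minimizer of $f$ over $2^V\setminus\mathcal{F}$ can be obtained in polynomial time.
   Context: A set function $f:2^V\to\mathbb{Z}$ is submodular if $f(X)+f(Y)\ge f(X\cup Y)+f(X\cap Y)$ for all $X,Y\subseteq V$. It is accessed in the evaluation oracle model, i.e. through an oracle returning $f(X)$ for any given $X\subseteq V$. A family $\mathcal{F}\subseteq 2^V$ is an intersecting family if for all $X,Y\in\mathcal{F}$ with $X\cap Y\neq\emptyset$ we have $X\cup Y,X\cap Y\in\mathcal{F}$. It is a crossing family if for all $X,Y\in\mathcal{F}$ with $X\cap Y\neq\emptyset$ and $X\cup Y\neq V$ we have $X\cup Y,X\cap Y\in\mathcal{F}$. A membership oracle for $\mathcal{F}$ decides, for any given $X\subseteq V$, whether $X\in\mathcal{F}$. Polynomial time means polynomial in $n=|V|$, counting oracle queries (for $f$ and for $\mathcal{F}$) and elementary operations. A minimizer of $f$ over a family $\mathcal{G}\subseteq 2^V$ is a set $X\in\mathcal{G}$ with $f(X)\le f(Y)$ for all $Y\in\mathcal{G}$; the algorithm is required to output one whenever $\mathcal{G}$ is nonempty. *)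

theory Defs
  imports Complex_Main "HOL-Library.Log_Nat" "HOL-Computational_Algebra.Polynomial"
begin

definition submodular_on :: "'a set \<Rightarrow> ('a set \<Rightarrow> int) \<Rightarrow> bool" where
  "submodular_on V f \<longleftrightarrow>
     (\<forall>X Y. X \<subseteq> V \<longrightarrow> Y \<subseteq> V \<longrightarrow> f X + f Y \<ge> f (X \<union> Y) + f (X \<inter> Y))"

definition intersecting_family :: "'a set \<Rightarrow> 'a set set \<Rightarrow> bool" where
  "intersecting_family V \<F> \<longleftrightarrow> \<F> \<subseteq> Pow V \<and>
     (\<forall>X\<in>\<F>. \<forall>Y\<in>\<F>. X \<inter> Y \<noteq> {} \<longrightarrow> X \<union> Y \<in> \<F> \<and> X \<inter> Y \<in> \<F>)"

definition crossing_family :: "'a set \<Rightarrow> 'a set set \<Rightarrow> bool" where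
  "crossing_family V \<F> \<longleftrightarrow> \<F> \<subseteq> Pow V \<and>
     (\<forall>X\<in>\<F>. \<forall>Y\<in>\<F>. X \<inter> Y \<noteq> {} \<and> X \<union> Y \<noteq> V \<longrightarrow> X \<union> Y \<in> \<F> \<and> X \<inter> Y \<in> \<F>)"

definition minimizer :: "('a set \<Rightarrow> int) \<Rightarrow> 'a set set \<Rightarrow> 'a set \<Rightarrow> bool" where
  "minimizer f \<G> X \<longleftrightarrow> X \<in> \<G> \<and> (\<forall>Y\<in>\<G>. f X \<le> f Y)"

text \<open>
  Algorithms are programs of a random access machine over the rationals: a fixed, finite
  program text works for all ground sets, and its elementary operations are the four
  arithmetic operations, comparisons, reads and writes of memory cells, and control flow.
  There is no rounding operation. Each operation and each oracle query costs one time unit.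
  Arrays are indexed by rationals only to avoid a conversion; programs use the indices
  0, 1, 2, ... . Division by zero yields zero, as usual in HOL.
\<close>

datatype aexp =
    Const rat
  | Var string
  | Read string aexp
  | Plus aexp aexp
  | Minus aexp aexp
  | Times aexp aexp
  | Divide aexp aexp

datatype bexp =
    Less aexp aexp
  | Equal aexp aexp
  | Neg bexp
  | Conj bexp bexp

datatype com =
    Skip
  | Assign string aexp
  | Write string aexp aexp
  | Seq com com
  | Cond bexp com com
  | While bexp com
  | Query_Value string string
  | Query_Member string string

record state =
  var :: "string \<Rightarrow> rat"
  arr :: "string \<Rightarrow> rat \<Rightarrow> rat"

fun aval :: "aexp \<Rightarrow> state \<Rightarrow> rat" where
  "aval (Const r) s = r"
| "aval (Var x) s = var s x"
| "aval (Read a e) s = arr s a (aval e s)"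
| "aval (Plus e1 e2) s = aval e1 s + aval e2 s"
| "aval (Minus e1 e2) s = aval e1 s - aval e2 s"
| "aval (Times e1 e2) s = aval e1 s * aval e2 s"
| "aval (Divide e1 e2) s = aval e1 s / aval e2 s"

fun bval :: "bexp \<Rightarrow> state \<Rightarrow> bool" where
  "bval (Less e1 e2) s \<longleftrightarrow> aval e1 s < aval e2 s"
| "bval (Equal e1 e2) s \<longleftrightarrow> aval e1 s = aval e2 s"
| "bval (Neg b) s \<longleftrightarrow> \<not> bval b s"
| "bval (Conj b1 b2) s \<longleftrightarrow> bval b1 s \<and> bval b2 s"

fun acost :: "aexp \<Rightarrow> nat" where
  "acost (Const r) = 1"
| "acost (Var x) = 1"
| "acost (Read a e) = 1 + acost e"
| "acost (Plus e1 e2) = 1 + acost e1 + acost e2"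
| "acost (Minus e1 e2) = 1 + acost e1 + acost e2"
| "acost (Times e1 e2) = 1 + acost e1 + acost e2"
| "acost (Divide e1 e2) = 1 + acost e1 + acost e2"

fun bcost :: "bexp \<Rightarrow> nat" where
  "bcost (Less e1 e2) = 1 + acost e1 + acost e2"
| "bcost (Equal e1 e2) = 1 + acost e1 + acost e2"
| "bcost (Neg b) = 1 + bcost b"
| "bcost (Conj b1 b2) = 1 + bcost b1 + bcost b2"

definition set_var :: "string \<Rightarrow> rat \<Rightarrow> state \<Rightarrow> state" where
  "set_var x r s = s\<lparr>var := (var s)(x := r)\<rparr>"

definition set_arr :: "string \<Rightarrow> rat \<Rightarrow> rat \<Rightarrow> state \<Rightarrow> state" where
  "set_arr a i r s = s\<lparr>arr := (arr s)(a := (arr s a)(i := r))\<rparr>"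

text \<open>
  A subset of the ground set, whose elements are numbered from 0 to \<open>n - 1\<close>, is passed to an
  oracle, or output, as the array of its membership flags.
\<close>

definition flagged :: "nat \<Rightarrow> string \<Rightarrow> state \<Rightarrow> nat set" where
  "flagged n a s = {i. i < n \<and> arr s a (of_nat i) \<noteq> 0}"

text \<open>
  Number of binary digits (signs not counted) of numerator and denominator in lowest terms.
\<close>

definition rat_size :: "rat \<Rightarrow> nat" where
  "rat_size r = (case quotient_of r of (a, b) \<Rightarrow> floorlog 2 (nat \<bar>a\<bar>) + floorlog 2 (nat b))"

text \<open>
  \<open>run n val mem W c s t s'\<close>: with ground set size \<open>n\<close>, evaluation oracle \<open>val\<close> and
  membership oracle \<open>mem\<close>, program \<open>c\<close> started in \<open>s\<close> halts in \<open>s'\<close> after \<open>t\<close> time units.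
  The machine gets stuck when it would store a number of size greater than \<open>W\<close> (or an array
  entry at an address of size greater than \<open>W\<close>). Bounding \<open>W\<close> excludes the misuse of
  unit-cost multiplication for building numbers with exponentially many digits; as the
  expressions in a program are of constant size, bounding what is stored bounds
  intermediate results as well.
\<close>

inductive run :: "nat \<Rightarrow> (nat set \<Rightarrow> int) \<Rightarrow> (nat set \<Rightarrow> bool) \<Rightarrow> nat \<Rightarrow>
    com \<Rightarrow> state \<Rightarrow> nat \<Rightarrow> state \<Rightarrow> bool"
  for n :: nat and val :: "nat set \<Rightarrow> int" and mem :: "nat set \<Rightarrow> bool" and W :: nat
where
  Skip: "run n val mem W Skip s 1 s"
| Assign: "rat_size (aval e s) \<le> W \<Longrightarrow>
    run n val mem W (Assign x e) s (1 + acost e) (set_var x (aval e s) s)"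
| Write: "rat_size (aval i s) \<le> W \<Longrightarrow> rat_size (aval e s) \<le> W \<Longrightarrow>
    run n val mem W (Write a i e) s (1 + acost i + acost e) (set_arr a (aval i s) (aval e s) s)"
| Seq: "run n val mem W c1 s t1 s1 \<Longrightarrow> run n val mem W c2 s1 t2 s2 \<Longrightarrow>
    run n val mem W (Seq c1 c2) s (t1 + t2) s2"
| Cond_True: "bval b s \<Longrightarrow> run n val mem W c1 s t s' \<Longrightarrow>
    run n val mem W (Cond b c1 c2) s (1 + bcost b + t) s'"
| Cond_False: "\<not> bval b s \<Longrightarrow> run n val mem W c2 s t s' \<Longrightarrow>
    run n val mem W (Cond b c1 c2) s (1 + bcost b + t) s'"
| While_False: "\<not> bval b s \<Longrightarrow> run n val mem W (While b c) s (1 + bcost b) s"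
| While_True: "bval b s \<Longrightarrow> run n val mem W c s t1 s1 \<Longrightarrow> run n val mem W (While b c) s1 t2 s2 \<Longrightarrow>
    run n val mem W (While b c) s (1 + bcost b + t1 + t2) s2"
| Query_Value: "rat_size (of_int (val (flagged n a s))) \<le> W \<Longrightarrow>
    run n val mem W (Query_Value x a) s 1 (set_var x (of_int (val (flagged n a s))) s)"
| Query_Member: "rat_size (of_bool (mem (flagged n a s))) \<le> W \<Longrightarrow>
    run n val mem W (Query_Member x a) s 1 (set_var x (of_bool (mem (flagged n a s))) s)"

inductive_cases SkipE: "run n val mem W Skip s t s'"
inductive_cases AssignE: "run n val mem W (Assign x e) s t s'"
inductive_cases WriteE: "run n val mem W (Write a i e) s t s'"
inductive_cases SeqE: "run n val mem W (Seq c1 c2) s t s'"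
inductive_cases CondE: "run n val mem W (Cond b c1 c2) s t s'"
inductive_cases WhileE: "run n val mem W (While b c) s t s'"
inductive_cases Query_ValueE: "run n val mem W (Query_Value x a) s t s'"
inductive_cases Query_MemberE: "run n val mem W (Query_Member x a) s t s'"

lemma run_deterministic:
  "run n val mem W c s t s' \<Longrightarrow> run n val mem W c s u s'' \<Longrightarrow> t = u \<and> s' = s''"
proof (induction arbitrary: u s'' rule: run.induct)
  case Skip
  then show ?case by (elim SkipE) simp
next
  case Assign
  from Assign.prems show ?case by (elim AssignE) simp
next
  case Write
  from Write.prems show ?case by (elim WriteE) simp
next
  case (Seq c1 s t1 s1 c2 t2 s2)
  from Seq.prems show ?case
  proof (rule SeqE)
    fix u1 r u2
    assume u: "u = u1 + u2" and 1: "run n val mem W c1 s u1 r" and 2: "run n val mem W c2 r u2 s''"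
    from Seq.IH(1)[OF 1] have "t1 = u1" "s1 = r" by simp_all
    with Seq.IH(2) 2 u show ?thesis by simp
  qed
next
  case (Cond_True b s c1 t s' c2)
  from Cond_True.prems show ?case
  proof (rule CondE)
    fix u1
    assume u: "u = Suc (bcost b + u1)" and 1: "run n val mem W c1 s u1 s''"
    from Cond_True.IH[OF 1] u show ?thesis by simp
  qed (use Cond_True.hyps in simp)
next
  case (Cond_False b s c2 t s' c1)
  from Cond_False.prems show ?case
  proof (rule CondE)
    fix u1
    assume u: "u = Suc (bcost b + u1)" and 1: "run n val mem W c2 s u1 s''"
    from Cond_False.IH[OF 1] u show ?thesis by simp
  qed (use Cond_False.hyps in simp)
next
  case (While_False b s c)
  from While_False.prems show ?case
    by (rule WhileE) (use While_False.hyps in simp_all)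
next
  case (While_True b s c t1 s1 t2 s2)
  from While_True.prems show ?case
  proof (rule WhileE)
    fix u1 r u2
    assume u: "u = Suc (bcost b + u1 + u2)" and 1: "run n val mem W c s u1 r"
      and 2: "run n val mem W (While b c) r u2 s''"
    from While_True.IH(1)[OF 1] have "t1 = u1" "s1 = r" by simp_all
    with While_True.IH(2) 2 u show ?thesis by simp
  qed (use While_True.hyps in simp)
next
  case Query_Value
  from Query_Value.prems show ?case by (elim Query_ValueE) simp
next
  case Query_Member
  from Query_Member.prems show ?case by (elim Query_MemberE) simp
qed

definition input_state :: "nat \<Rightarrow> state" where
  "input_state n = \<lparr>var = (\<lambda>_. 0)(''n'' := of_nat n), arr = (\<lambda>_ _. 0)\<rparr>"

text \<open>The largest number of binary digits of a value of \<open>f\<close>.\<close>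

definition value_size :: "'a set \<Rightarrow> ('a set \<Rightarrow> int) \<Rightarrow> nat" where
  "value_size V f = Max ((\<lambda>X. floorlog 2 (nat \<bar>f X\<bar>)) ` Pow V)"

text \<open>
  The program receives the ground set through a numbering \<open>v\<close> of its elements. Its running
  time is bounded by a polynomial \<open>p\<close> in the size of the ground set alone; the size of the
  numbers it handles is bounded by a polynomial \<open>q\<close> in that size and the size of the values
  of \<open>f\<close>.
\<close>

definition minimizes_outside ::
    "com \<Rightarrow> nat poly \<Rightarrow> nat poly \<Rightarrow> 'a set \<Rightarrow> (nat \<Rightarrow> 'a) \<Rightarrow> ('a set \<Rightarrow> int) \<Rightarrow> 'a set set \<Rightarrow> bool"
where
  "minimizes_outside c p q V v f \<F> \<longleftrightarrow>
     (\<exists>t s. run (card V) (\<lambda>I. f (v ` I)) (\<lambda>I. v ` I \<in> \<F>)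
              (poly q (card V + value_size V f)) c (input_state (card V)) t s \<and>
            t \<le> poly p (card V) \<and>
            (Pow V - \<F> \<noteq> {} \<longrightarrow> minimizer f (Pow V - \<F>) (v ` flagged (card V) ''out'' s)))"

end

theory Submission
  imports Defs
begin

text \<open>
  A crossing family restricted to the sets that contain \<open>r\<close> and avoid \<open>s\<close> is a lattice, so a
  proper nonempty set outside \<open>\<F>\<close> lies in some interval \<open>{r, x} \<subseteq> X \<subseteq> V - {s, y}\<close> that is disjoint
  from \<open>\<F>\<close>. Hence the best set outside \<open>\<F>\<close> among \<open>{}\<close>, \<open>V\<close> and one minimizer of \<open>f\<close> for each such
  interval is a minimizer, and it remains to minimize \<open>f\<close> over an interval.

  As in the strongly polynomial algorithm of Iwata, Fleischer and Fujishige, one maintains a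
  preorder under which all minimizers are closed. If \<open>f\<close> is not constant on the closed
  sets, then one of a few intervals \<open>[P, Q]\<close> of closed sets has a gap \<open>\<bar>f Q - f P\<bar>\<close> that is, up to a
  polynomial factor, as large as all marginal values. A base of \<open>f\<close> on \<open>[P, Q]\<close> that is optimal up
  to a small fraction of the gap then has a coordinate so large in absolute value that the element is in
  every or in no minimizer on \<open>[P, Q]\<close>, which gives a new pair of the preorder.

  Such a base is the average of the greedy vectors met by projected subgradient descent for
  the Lovasz extension on a cube. Scaling the cube makes all numbers integers, so
  neither convex combinations nor rounding are needed.
\<close>

section \<open>Subgradient descent over greedy vectors\<close>

text \<open>Marginal values are under control only along closed sets, whereas greedy vectors need a
  submodular function on all subsets. The function is therefore extended through the closure
  operator, with a penalty for every element that closing adds. The rate \<open>3 * h\<close> of the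
  penalty, \<open>h\<close> being the largest gap, bounds the slope of \<open>f\<close> along closed
  sets because each elementary difference is a sum of three gaps. Marginal values of the extension
  are then at most \<open>6 * n * h\<close>, and \<open>N = 6 * n ^ 3 + 1\<close> is chosen so that
  the error left after \<open>N\<^sup>2\<close> steps is smaller than the share of the gap that
  falls on one of at most \<open>n\<close> coordinates. Everything is proportional to
  \<open>h\<close>, so the number of steps does not depend on the size of the values of
  \<open>f\<close>. Every round with a gap adds a pair to a relation on \<open>n\<close> elements,
  which bounds the number of rounds.

  The oracle does not reveal which intervals are disjoint from \<open>\<F>\<close>. All quadruples
  are tried, and a minimizer found for an interval counts only if it lies outside
  \<open>\<F>\<close>.\<close>

definition upper_part :: "'a::linorder set \<Rightarrow> ('a \<Rightarrow> int) \<Rightarrow> 'a \<Rightarrow> 'a set" where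
  "upper_part W p w = {v \<in> W. p w < p v \<or> (p v = p w \<and> v \<le> w)}"

text \<open>Edmonds' greedy vector for the order by decreasing \<open>p\<close>, ties broken in
  favour of the smaller element; \<open>upper_part W p w\<close> is the prefix of this order that
  ends with \<open>w\<close>.\<close>

definition greedy :: "'a::linorder set \<Rightarrow> ('a set \<Rightarrow> int) \<Rightarrow> ('a \<Rightarrow> int) \<Rightarrow> 'a \<Rightarrow> int" where
  "greedy W g p w = (if w \<in> W then g (upper_part W p w) - g (upper_part W p w - {w}) else 0)"

lemma upper_part_last:
  assumes "finite X" "X \<noteq> {}" "X \<subseteq> W"
  obtains m where "m \<in> X" "X \<subseteq> upper_part W p m"
proof -
  define a where "a = Min (p ` X)"
  define m where "m = Max {v \<in> X. p v = a}"
  have "a \<in> p ` X" unfolding a_def using assms by (intro Min_in) auto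
  hence "{v \<in> X. p v = a} \<noteq> {}" by auto
  hence "m \<in> {v \<in> X. p v = a}" unfolding m_def using assms(1) by (intro Max_in) auto
  moreover have "v \<in> upper_part W p m" if "v \<in> X" for v
  proof -
    have "a \<le> p v" unfolding a_def using that assms(1) by auto
    moreover have "v \<le> m" if "p v = a" unfolding m_def using that \<open>v \<in> X\<close> assms(1) by auto
    ultimately show ?thesis using that assms(3) \<open>m \<in> _\<close> by (auto simp: upper_part_def)
  qed
  ultimately show thesis using that[of m] by blast
qed

lemma submodular_onD:
  "submodular_on V f \<Longrightarrow> X \<subseteq> V \<Longrightarrow> Y \<subseteq> V \<Longrightarrow> f (X \<union> Y) + f (X \<inter> Y) \<le> f X + f Y"
  by (auto simp: submodular_on_def)

lemma upper_part_subset: "upper_part W p w \<subseteq> W"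
  by (auto simp: upper_part_def)

text \<open>Feasibility in the base polyhedron. If \<open>m\<close> is the last element of
  \<open>X\<close> in the greedy order, submodularity applied to \<open>X\<close> and the prefix
  before \<open>m\<close> bounds the coordinate at \<open>m\<close> by the marginal value of
  \<open>m\<close> over \<open>X - {m}\<close>.\<close>

lemma greedy_sum_le:
  assumes "finite W" "submodular_on W g" "X \<subseteq> W"
  shows "sum (greedy W g p) X \<le> g X - g {}"
  using finite_subset[OF assms(3,1)] assms(3)
proof (induction X rule: finite_psubset_induct)
  case (psubset X)
  show ?case
  proof (cases "X = {}")
    case False
    obtain m where m: "m \<in> X" "X \<subseteq> upper_part W p m"
      using upper_part_last psubset False by metis
    have "sum (greedy W g p) (X - {m}) \<le> g (X - {m}) - g {}"
      using psubset m by auto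
    moreover have "greedy W g p m \<le> g X - g (X - {m})"
    proof -
      have "X \<union> (upper_part W p m - {m}) = upper_part W p m"
        "X \<inter> (upper_part W p m - {m}) = X - {m}" using m by auto
      with submodular_onD[OF assms(2), of X "upper_part W p m - {m}"] psubset.prems m(1)
        upper_part_subset[of W p m]
      show ?thesis by (simp add: greedy_def subset_iff)
    qed
    ultimately show ?thesis using sum.remove[OF psubset.hyps m(1), of "greedy W g p"] by simp
  qed simp
qed

text \<open>A set closed under predecessors is itself a prefix, so the marginal values telescope
  along the order.\<close>

lemma greedy_sum_eq:
  assumes "finite W" "X \<subseteq> W" "\<And>w. w \<in> X \<Longrightarrow> upper_part W p w \<subseteq> X"
  shows "sum (greedy W g p) X = g X - g {}"
  using finite_subset[OF assms(2,1)] assms(2,3)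
proof (induction X rule: finite_psubset_induct)
  case (psubset X)
  show ?case
  proof (cases "X = {}")
    case False
    obtain m where m: "m \<in> X" "X \<subseteq> upper_part W p m"
      using upper_part_last psubset False by metis
    have eq: "upper_part W p m = X" using m psubset.prems by auto
    have "upper_part W p w \<subseteq> X - {m}" if "w \<in> X - {m}" for w
    proof -
      have "w \<in> upper_part W p m" using that m by auto
      hence "m \<notin> upper_part W p w" using that by (auto simp: upper_part_def)
      thus ?thesis using psubset.prems that by blast
    qed
    hence "sum (greedy W g p) (X - {m}) = g (X - {m}) - g {}"
      using psubset m by (metis Diff_subset Diff_insert_absorb insert_Diff mk_disjoint_insert
          order_trans psubsetI)
    moreover have "greedy W g p m = g X - g (X - {m})"
      using m psubset.prems by (auto simp: greedy_def eq)
    ultimately show ?thesis using sum.remove[OF psubset.hyps m(1), of "greedy W g p"] by simp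
  qed simp
qed

text \<open>Layer-cake form of the Lovasz extension: with integral weights the inner product is a
  sum over the thresholds \<open>1..H\<close> of values at level sets, and level sets are prefixes.
  Each threshold contributes at least \<mu>.\<close>

lemma greedy_weighted_ge:
  assumes "finite W" and p: "\<And>w. w \<in> W \<Longrightarrow> 0 \<le> p w \<and> p w \<le> H" and "0 \<le> H"
    and \<mu>: "\<And>X. X \<subseteq> W \<Longrightarrow> \<mu> \<le> g X - g {}"
  shows "H * \<mu> \<le> (\<Sum>w\<in>W. greedy W g p w * p w)"
proof -
  have card: "(\<Sum>\<theta>\<in>{1..H}. of_bool (\<theta> \<le> p w)) = p w" if "w \<in> W" for w
  proof -
    have "{1..H} \<inter> {\<theta>. \<theta> \<le> p w} = {1..p w}" using p[OF that] by auto
    thus ?thesis using p[OF that] by (simp add: of_bool_def sum.If_cases)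
  qed
  have "(\<Sum>w\<in>W. greedy W g p w * p w)
      = (\<Sum>w\<in>W. \<Sum>\<theta>\<in>{1..H}. greedy W g p w * of_bool (\<theta> \<le> p w))"
    by (intro sum.cong refl) (simp only: sum_distrib_left[symmetric] card)
  also have "\<dots> = (\<Sum>\<theta>\<in>{1..H}. \<Sum>w\<in>W. greedy W g p w * of_bool (\<theta> \<le> p w))"
    by (rule sum.swap)
  also have "\<dots> = (\<Sum>\<theta>\<in>{1..H}. sum (greedy W g p) {w \<in> W. \<theta> \<le> p w})"
    by (rule sum.cong[OF refl], rule sum.mono_neutral_cong_right) (use assms(1) in auto)
  also have "\<dots> = (\<Sum>\<theta>\<in>{1..H}. g {w \<in> W. \<theta> \<le> p w} - g {})"
    using assms(1) by (intro sum.cong refl greedy_sum_eq) (auto simp: upper_part_def)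
  also have "\<dots> \<ge> (\<Sum>\<theta>\<in>{1..H}. \<mu>)" by (intro sum_mono \<mu>) auto
  finally show ?thesis using assms(3) by simp
qed

text \<open>Step length 1 on a cube of side \<open>H\<close>. This is descent on the unit cube with
  step \<open>1 / H\<close>, rescaled so that all iterates are integral; the greedy vector at the
  current point is a subgradient of the Lovasz extension there.\<close>

primrec descent :: "'a::linorder set \<Rightarrow> ('a set \<Rightarrow> int) \<Rightarrow> int \<Rightarrow> nat \<Rightarrow> 'a \<Rightarrow> int" where
  "descent W g H 0 = (\<lambda>_. 0)"
| "descent W g H (Suc k) =
     (\<lambda>w. max 0 (min H (descent W g H k w - greedy W g (descent W g H k) w)))"

definition greedy_total :: "'a::linorder set \<Rightarrow> ('a set \<Rightarrow> int) \<Rightarrow> int \<Rightarrow> nat \<Rightarrow> 'a \<Rightarrow> int" where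
  "greedy_total W g H k w = (\<Sum>j<k. greedy W g (descent W g H j) w)"

lemma descent_bounds: "0 \<le> H \<Longrightarrow> 0 \<le> descent W g H k w \<and> descent W g H k w \<le> H"
  by (induction k) auto

lemma greedy_abs_le:
  assumes "\<And>X w. X \<subseteq> W \<Longrightarrow> w \<in> W - X \<Longrightarrow> \<bar>g (insert w X) - g X\<bar> \<le> M" "0 \<le> M"
  shows "\<bar>greedy W g p w\<bar> \<le> M"
proof (cases "w \<in> W")
  case True
  have "insert w (upper_part W p w - {w}) = upper_part W p w"
    using True by (auto simp: upper_part_def)
  with assms(1)[of "upper_part W p w - {w}" w] True upper_part_subset[of W p w]
  show ?thesis by (auto simp: greedy_def)
qed (use assms(2) in \<open>simp add: greedy_def\<close>)

lemma clip_closer: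
  fixes x q H :: int
  assumes "0 \<le> q" "q \<le> H"
  shows "(max 0 (min H x) - q)\<^sup>2 \<le> (x - q)\<^sup>2"
  unfolding power2_le_iff_abs_le using assms by (auto simp flip: abs_le_square_iff)

text \<open>The usual potential argument: clipping to the cube moves no coordinate away from
  \<open>q\<close>, and expanding the square of one step releases twice the inner product of the
  greedy vector with the current point minus \<open>q\<close>, at the price of
  \<open>M\<^sup>2\<close> per coordinate. Initially each coordinate is within \<open>H\<close> of
  \<open>q\<close>.\<close>

lemma descent_potential:
  fixes H M :: int
  assumes "finite W" and q: "\<And>w. w \<in> W \<Longrightarrow> 0 \<le> q w \<and> q w \<le> H" and "0 \<le> M"
    and M: "\<And>X w. X \<subseteq> W \<Longrightarrow> w \<in> W - X \<Longrightarrow> \<bar>g (insert w X) - g X\<bar> \<le> M"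
  shows "(\<Sum>w\<in>W. (descent W g H k w - q w)\<^sup>2) +
      2 * (\<Sum>j<k. \<Sum>w\<in>W. greedy W g (descent W g H j) w * (descent W g H j w - q w))
    \<le> card W * H\<^sup>2 + k * (card W * M\<^sup>2)"
proof (induction k)
  case 0
  have "(q w)\<^sup>2 \<le> H\<^sup>2" if "w \<in> W" for w using q[OF that] by (intro power_mono) auto
  from sum_mono[OF this, of W "\<lambda>w. w"] show ?case by simp
next
  case (Suc k)
  let ?p = "descent W g H k" and ?y = "greedy W g (descent W g H k)"
  have "(descent W g H (Suc k) w - q w)\<^sup>2 + 2 * (?y w * (?p w - q w)) \<le> (?p w - q w)\<^sup>2 + M\<^sup>2"
    if "w \<in> W" for w
  proof -
    have "(descent W g H (Suc k) w - q w)\<^sup>2 \<le> (?p w - ?y w - q w)\<^sup>2"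
      using q[OF that] by (simp add: clip_closer)
    moreover have "(?y w)\<^sup>2 \<le> M\<^sup>2"
      using greedy_abs_le[OF M assms(3)] assms(3) by (simp add: abs_le_square_iff[symmetric])
    moreover have "(?p w - ?y w - q w)\<^sup>2 = (?p w - q w)\<^sup>2 - 2 * (?y w * (?p w - q w)) + (?y w)\<^sup>2"
      by (simp add: power2_eq_square algebra_simps)
    ultimately show ?thesis by linarith
  qed
  hence "(\<Sum>w\<in>W. (descent W g H (Suc k) w - q w)\<^sup>2 + 2 * (?y w * (?p w - q w)))
      \<le> (\<Sum>w\<in>W. (?p w - q w)\<^sup>2 + M\<^sup>2)"
    by (rule sum_mono)
  hence "(\<Sum>w\<in>W. (descent W g H (Suc k) w - q w)\<^sup>2) + 2 * (\<Sum>w\<in>W. ?y w * (?p w - q w))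
      \<le> (\<Sum>w\<in>W. (?p w - q w)\<^sup>2) + card W * M\<^sup>2"
    by (simp only: sum.distrib sum_distrib_left) simp
  moreover have "int (Suc k) * (card W * M\<^sup>2) = k * (card W * M\<^sup>2) + card W * M\<^sup>2"
    by (simp add: algebra_simps)
  ultimately show ?case using Suc unfolding sum.lessThan_Suc distrib_left by linarith
qed

lemma greedy_total_sum_le:
  assumes "finite W" "submodular_on W g" "X \<subseteq> W"
  shows "sum (greedy_total W g H k) X \<le> int k * (g X - g {})"
proof -
  have "sum (greedy_total W g H k) X = (\<Sum>j<k. sum (greedy W g (descent W g H j)) X)"
    unfolding greedy_total_def by (rule sum.swap)
  also have "\<dots> \<le> (\<Sum>j<k. g X - g {})" using assms by (intro sum_mono greedy_sum_le)
  finally show ?thesis by simp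
qed

lemma greedy_total_sum_eq:
  assumes "finite W"
  shows "sum (greedy_total W g H k) W = int k * (g W - g {})"
proof -
  have "sum (greedy_total W g H k) W = (\<Sum>j<k. sum (greedy W g (descent W g H j)) W)"
    unfolding greedy_total_def by (rule sum.swap)
  also have "\<dots> = (\<Sum>j<k. g W - g {})"
    using assms by (intro sum.cong refl greedy_sum_eq) (auto simp: upper_part_def)
  finally show ?thesis by simp
qed

text \<open>Approximate duality between minimizing a submodular function and maximizing the negative
  part of a base: divided by \<open>N\<^sup>2\<close>, the total is a base whose negative part falls
  below \<mu> by at most \<open>card W * M / N\<close>. With side \<open>M * N\<close> and
  \<open>N\<^sup>2\<close> steps, the errors caused by the starting point and by the step length are
  equal.\<close>

lemma greedy_total_negative_part:
  fixes M N \<mu> :: int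
  assumes fin: "finite W" and sub: "submodular_on W g" and "0 < M" "0 < N"
    and M: "\<And>X w. X \<subseteq> W \<Longrightarrow> w \<in> W - X \<Longrightarrow> \<bar>g (insert w X) - g X\<bar> \<le> M"
    and \<mu>: "\<And>X. X \<subseteq> W \<Longrightarrow> \<mu> \<le> g X - g {}"
  shows "N\<^sup>2 * \<mu> - card W * N * M \<le> (\<Sum>w\<in>W. min 0 (greedy_total W g (M * N) (nat (N\<^sup>2)) w))"
proof -
  define H where "H = M * N"
  define T where "T = nat (N\<^sup>2)"
  define Y where "Y = greedy_total W g H T"
  \<comment> \<open>The vertex of the cube with the smallest inner product with \<open>Y\<close>;
    that product is \<open>H\<close> times the negative part of \<open>Y\<close>.\<close>
  define q where "q w = (if Y w < 0 then H else 0)" for w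
  let ?p = "descent W g H" and ?m = "int (card W)"
  have H: "0 < H" and T: "int T = N\<^sup>2" using assms by (simp_all add: H_def T_def)
  have "(\<Sum>w\<in>W. (?p T w - q w)\<^sup>2) + 2 * (\<Sum>j<T. \<Sum>w\<in>W. greedy W g (?p j) w * (?p j w - q w))
      \<le> ?m * H\<^sup>2 + int T * (?m * M\<^sup>2)"
    by (rule descent_potential[OF fin]) (use H assms M in \<open>auto simp: q_def\<close>)
  moreover have "0 \<le> (\<Sum>w\<in>W. (?p T w - q w)\<^sup>2)" by (intro sum_nonneg) auto
  moreover have "?m * H\<^sup>2 + int T * (?m * M\<^sup>2) = 2 * (H * (?m * N * M))"
    unfolding T H_def by (simp add: power2_eq_square algebra_simps)
  ultimately have "(\<Sum>j<T. \<Sum>w\<in>W. greedy W g (?p j) w * (?p j w - q w)) \<le> H * (?m * N * M)"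
    by linarith
  moreover have "(\<Sum>j<T. \<Sum>w\<in>W. greedy W g (?p j) w * (?p j w - q w)) =
      (\<Sum>j<T. \<Sum>w\<in>W. greedy W g (?p j) w * ?p j w) - (\<Sum>w\<in>W. Y w * q w)"
  proof -
    have "(\<Sum>w\<in>W. Y w * q w) = (\<Sum>j<T. \<Sum>w\<in>W. greedy W g (?p j) w * q w)"
      unfolding Y_def greedy_total_def sum_distrib_right by (rule sum.swap)
    thus ?thesis by (simp add: right_diff_distrib sum_subtractf)
  qed
  moreover have "(\<Sum>w\<in>W. Y w * q w) = H * (\<Sum>w\<in>W. min 0 (Y w))"
    unfolding sum_distrib_left by (intro sum.cong) (auto simp: q_def)
  moreover have "(\<Sum>j<T. H * \<mu>) \<le> (\<Sum>j<T. \<Sum>w\<in>W. greedy W g (?p j) w * ?p j w)"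
    by (intro sum_mono greedy_weighted_ge[OF fin] conjI)
      (use H descent_bounds[of H W g] \<mu> in \<open>auto simp: less_imp_le\<close>)
  moreover have "(\<Sum>j<T. H * \<mu>) = H * (N\<^sup>2 * \<mu>)" using T by simp
  ultimately have "H * (N\<^sup>2 * \<mu> - ?m * N * M) \<le> H * (\<Sum>w\<in>W. min 0 (Y w))"
    unfolding right_diff_distrib by linarith
  thus ?thesis using H unfolding Y_def H_def T_def by (simp only: mult_le_cancel_left_pos)
qed

text \<open>The coordinates sum to \<open>N\<^sup>2 * (g W - g {})\<close>, so the largest is at
  least the average and, by \<open>gap\<close>, exceeds the error \<open>card W * N * M\<close>. If
  \<open>w\<close> were in \<open>X\<close>, the sum over \<open>X - {w}\<close> would be smaller
  than the bound on the negative part permits.\<close>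

lemma greedy_total_excludes:
  fixes M N :: int
  assumes fin: "finite W" and sub: "submodular_on W g" and "0 < M" "0 < N"
    and M: "\<And>X w. X \<subseteq> W \<Longrightarrow> w \<in> W - X \<Longrightarrow> \<bar>g (insert w X) - g X\<bar> \<le> M"
    and gap: "(int (card W))\<^sup>2 * M < N * (g W - g {})"
    and w: "w \<in> W" "\<And>v. v \<in> W \<Longrightarrow> greedy_total W g (M * N) (nat (N\<^sup>2)) v \<le> greedy_total W g (M * N) (nat (N\<^sup>2)) w"
    and X: "X \<subseteq> W" "\<And>Z. Z \<subseteq> W \<Longrightarrow> g X \<le> g Z"
  shows "w \<notin> X"
proof
  assume "w \<in> X"
  let ?Y = "greedy_total W g (M * N) (nat (N\<^sup>2))" and ?m = "int (card W)"
  have "0 < card W" using w fin by (auto simp: card_gt_0_iff)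
  have "?m * (?m * N * M) < N * N * (g W - g {})"
    using mult_strict_left_mono[OF gap \<open>0 < N\<close>] by (simp add: power2_eq_square algebra_simps)
  also have "\<dots> = sum ?Y W" using greedy_total_sum_eq[OF fin, of g "M * N" "nat (N\<^sup>2)"]
    by (simp add: power2_eq_square)
  also have "\<dots> \<le> ?m * ?Y w" using sum_bounded_above[of W ?Y "?Y w"] w by simp
  finally have *: "?m * N * M < ?Y w" using \<open>0 < card W\<close> by simp
  moreover have "0 \<le> ?m * N * M" using assms by simp
  ultimately have "0 < ?Y w" by linarith
  have "N\<^sup>2 * (g X - g {}) - ?m * N * M \<le> (\<Sum>v\<in>W. min 0 (?Y v))"
    by (rule greedy_total_negative_part) (use assms in auto)
  \<comment> \<open>Dropping nonpositive terms raises the sum: \<open>sum_mono2\<close> for the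
    negated summands.\<close>
  also have "\<dots> \<le> (\<Sum>v\<in>X - {w}. min 0 (?Y v))"
    using fin X by (intro sum_mono2[of W "X - {w}" "\<lambda>v. - min 0 (?Y v)", unfolded sum_negf neg_le_iff_le]) auto
  also have "\<dots> \<le> sum ?Y (X - {w})" by (intro sum_mono) auto
  also have "\<dots> = sum ?Y X - ?Y w"
    using \<open>w \<in> X\<close> finite_subset[OF X(1) fin] by (simp add: sum_diff1)
  also have "sum ?Y X \<le> N\<^sup>2 * (g X - g {})"
    using greedy_total_sum_le[OF fin sub X(1), of "M * N" "nat (N\<^sup>2)"] by simp
  finally show False using * by linarith
qed

text \<open>The mirror image: the smallest coordinate is below minus the error. If \<open>w\<close>
  were missing from \<open>X\<close>, its coordinate together with the sum over \<open>X\<close>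
  would bound the negative part from above by too small a number.\<close>

lemma greedy_total_includes:
  fixes M N :: int
  assumes fin: "finite W" and sub: "submodular_on W g" and "0 < M" "0 < N"
    and M: "\<And>X w. X \<subseteq> W \<Longrightarrow> w \<in> W - X \<Longrightarrow> \<bar>g (insert w X) - g X\<bar> \<le> M"
    and gap: "(int (card W))\<^sup>2 * M < N * (g {} - g W)"
    and w: "w \<in> W" "\<And>v. v \<in> W \<Longrightarrow> greedy_total W g (M * N) (nat (N\<^sup>2)) w \<le> greedy_total W g (M * N) (nat (N\<^sup>2)) v"
    and X: "X \<subseteq> W" "\<And>Z. Z \<subseteq> W \<Longrightarrow> g X \<le> g Z"
  shows "w \<in> X"
proof (rule ccontr)
  assume "w \<notin> X"
  let ?Y = "greedy_total W g (M * N) (nat (N\<^sup>2))" and ?m = "int (card W)"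
  have "0 < card W" using w fin by (auto simp: card_gt_0_iff)
  have "?m * ?Y w \<le> sum ?Y W" using sum_bounded_below[of W "?Y w" ?Y] w by simp
  also have "\<dots> = N * N * (g W - g {})" using greedy_total_sum_eq[OF fin, of g "M * N" "nat (N\<^sup>2)"]
    by (simp add: power2_eq_square)
  also have "\<dots> < - (?m * (?m * N * M))"
    using mult_strict_left_mono[OF gap \<open>0 < N\<close>] by (simp add: power2_eq_square algebra_simps)
  finally have "?m * ?Y w < ?m * - (?m * N * M)" by simp
  hence *: "?Y w < - (?m * N * M)" using \<open>0 < card W\<close> by (simp only: mult_less_cancel_left_pos of_nat_0_less_iff)
  moreover have "0 \<le> ?m * N * M" using assms by simp
  ultimately have "?Y w < 0" by linarith
  have "N\<^sup>2 * (g X - g {}) - ?m * N * M \<le> (\<Sum>v\<in>W. min 0 (?Y v))"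
    by (rule greedy_total_negative_part) (use assms in auto)
  also have "\<dots> \<le> (\<Sum>v\<in>insert w X. min 0 (?Y v))"
    using fin X w by (intro sum_mono2[of W "insert w X" "\<lambda>v. - min 0 (?Y v)", unfolded sum_negf neg_le_iff_le]) auto
  also have "\<dots> = ?Y w + (\<Sum>v\<in>X. min 0 (?Y v))"
    using \<open>w \<notin> X\<close> \<open>?Y w < 0\<close> finite_subset[OF X(1) fin] by simp
  also have "(\<Sum>v\<in>X. min 0 (?Y v)) \<le> sum ?Y X" by (intro sum_mono) auto
  also have "sum ?Y X \<le> N\<^sup>2 * (g X - g {})"
    using greedy_total_sum_le[OF fin sub X(1), of "M * N" "nat (N\<^sup>2)"] by simp
  finally show False using * by linarith
qed

section \<open>Closed sets of a preorder and new arcs\<close>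

definition closure_ext :: "('a set \<Rightarrow> int) \<Rightarrow> 'a rel \<Rightarrow> int \<Rightarrow> 'a set \<Rightarrow> int" where
  "closure_ext f R c Z = f (R `` Z) + c * (int (card (R `` Z)) - int (card Z))"

locale closed_interval =
  fixes V :: "'a::linorder set" and f :: "'a set \<Rightarrow> int" and R :: "'a rel" and P Q :: "'a set" and c :: int
  assumes fin: "finite V" and sub: "submodular_on V f"
    and R: "R \<subseteq> V \<times> V" "\<And>x. x \<in> V \<Longrightarrow> (x, x) \<in> R" "trans R"
    and PQ: "P \<subseteq> Q" "Q \<subseteq> V" "R `` P \<subseteq> P" "R `` Q \<subseteq> Q"
    and c: "0 \<le> c"
    and slope: "\<And>A B. P \<subseteq> A \<Longrightarrow> A \<subseteq> B \<Longrightarrow> B \<subseteq> Q \<Longrightarrow> R `` A \<subseteq> A \<Longrightarrow> R `` B \<subseteq> B \<Longrightarrow>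
      \<bar>f B - f A\<bar> \<le> c * card (B - A)"
begin

abbreviation ext where "ext Z \<equiv> closure_ext f R c (P \<union> Z)"

lemma subset_closure: "Z \<subseteq> V \<Longrightarrow> Z \<subseteq> R `` Z"
  using R by blast

lemma closure_closed: "R `` (R `` Z) \<subseteq> R `` Z"
  using R(3) by (auto dest: transD)

lemma closure_in_interval:
  assumes "Z \<subseteq> Q - P"
  shows "P \<subseteq> R `` (P \<union> Z)" "R `` (P \<union> Z) \<subseteq> Q"
  using assms PQ subset_closure[of "P \<union> Z"] by blast+

lemma finite_in_interval: "Z \<subseteq> Q \<Longrightarrow> finite Z"
  using PQ fin by (meson finite_subset)

text \<open>The closure grows by at most \<open>card V\<close> elements, and for each of them
  \<open>f\<close> and the penalty both change by at most \<open>c\<close>; hence the factor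
  2.\<close>

lemma ext_marginal:
  assumes "X \<subseteq> Q - P" "w \<in> Q - P - X"
  shows "\<bar>ext (insert w X) - ext X\<bar> \<le> 2 * c * card V"
proof -
  let ?B = "R `` (P \<union> X)" and ?B' = "R `` (P \<union> insert w X)"
  have fin': "finite (P \<union> X)" "finite Q" "finite ?B'" "w \<notin> P \<union> X"
    using assms PQ(1) closure_in_interval(2)[of "insert w X"] by (auto intro!: finite_in_interval)
  have "?B \<subseteq> ?B'" by auto
  hence card: "int (card ?B') = card ?B + card (?B' - ?B)"
    using fin' by (metis card_Diff_subset card_mono finite_subset le_add_diff_inverse of_nat_add)
  have "\<bar>f ?B' - f ?B\<bar> \<le> c * card (?B' - ?B)"
    using assms closure_in_interval[of X] closure_in_interval[of "insert w X"] closure_closed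
    by (intro slope) auto
  moreover have "c * card (?B' - ?B) \<le> c * card V"
    using c fin PQ closure_in_interval[of "insert w X"] assms
    by (intro mult_left_mono) (auto intro!: card_mono)
  moreover have "0 \<le> c * card (?B' - ?B)" using c by simp
  moreover have "card (P \<union> insert w X) = Suc (card (P \<union> X))" using fin' by simp
  hence "ext (insert w X) - ext X = f ?B' - f ?B + c * card (?B' - ?B) - c"
    unfolding closure_ext_def card by (simp add: algebra_simps)
  moreover have "1 \<le> int (card V)" using assms PQ fin by (auto simp: Suc_le_eq card_gt_0_iff)
  hence "c * 1 \<le> c * card V" using c by (intro mult_left_mono) auto
  ultimately show ?thesis using c by auto
qed

text \<open>Closure commutes with unions, but the closure \<open>?J\<close> of the intersection may
  be smaller than the intersection \<open>?I\<close> of the closures. By \<open>slope\<close> the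
  value of \<open>f\<close> differs between the two by at most \<open>c\<close> per element of
  \<open>?I - ?J\<close>, and the penalty at \<open>?J\<close> is smaller by exactly this amount.
  The rest is submodularity of \<open>f\<close> and modularity of cardinality.\<close>

lemma ext_submodular: "submodular_on (Q - P) ext"
  unfolding submodular_on_def
proof (intro allI impI)
  fix X Y assume XY: "X \<subseteq> Q - P" "Y \<subseteq> Q - P"
  let ?A = "P \<union> X" and ?B = "P \<union> Y"
  let ?I = "R `` ?A \<inter> R `` ?B" and ?J = "R `` (?A \<inter> ?B)"
  have eq: "P \<union> (X \<union> Y) = ?A \<union> ?B" "P \<union> (X \<inter> Y) = ?A \<inter> ?B" "R `` (?A \<union> ?B) = R `` ?A \<union> R `` ?B"
    by auto
  \<comment> \<open>Identities between cardinalities are multiplied by \<open>c\<close> here, so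
    that the final linear arithmetic can treat the products as atoms.\<close>
  have distr: "c * i + c * j = c * k + c * l" if "i + j = k + l" for i j k l :: int
    using arg_cong[OF that, of "(*) c"] by (simp only: distrib_left)
  have sub_V: "R `` ?A \<subseteq> V" "R `` ?B \<subseteq> V"
    using closure_in_interval(2)[OF XY(1)] closure_in_interval(2)[OF XY(2)] PQ(2) by (auto dest: order_trans)
  have fin': "finite ?A" "finite ?B" "finite (R `` ?A)" "finite (R `` ?B)" "finite ?I"
    using XY PQ(1) sub_V fin by (auto intro: finite_in_interval simp only: finite_subset finite_Int)
  have "?J \<subseteq> ?I" by auto
  hence J: "int (card ?I) = int (card ?J) + int (card (?I - ?J))"
    using fin' by (metis card_Diff_subset card_mono finite_subset le_add_diff_inverse of_nat_add)
  have "?J = R `` (P \<union> (X \<inter> Y))" by (simp only: eq)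
  hence "P \<subseteq> ?J" using closure_in_interval(1)[of "X \<inter> Y"] XY(1) by (simp add: le_infI1)
  moreover have "?I \<subseteq> Q" using closure_in_interval(2)[OF XY(1)] by (rule le_infI1)
  moreover have "R `` ?I \<subseteq> ?I" using closure_closed[of ?A] closure_closed[of ?B] by blast
  ultimately have "\<bar>f ?I - f ?J\<bar> \<le> c * card (?I - ?J)"
    using \<open>?J \<subseteq> ?I\<close> closure_closed by (intro slope)
  moreover have "f (R `` ?A \<union> R `` ?B) + f ?I \<le> f (R `` ?A) + f (R `` ?B)"
    using sub_V by (rule submodular_onD[OF sub])
  moreover have "int (card (R `` ?A)) + int (card (R `` ?B)) =
      int (card (R `` ?A \<union> R `` ?B)) + int (card ?I)"
    using arg_cong[OF card_Un_Int[OF fin'(3,4)], of int] by (simp only: of_nat_add)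
  hence "c * card (R `` ?A) + c * card (R `` ?B) = c * card (R `` ?A \<union> R `` ?B) + c * card ?I"
    by (rule distr)
  moreover have "int (card ?A) + int (card ?B) = int (card (?A \<union> ?B)) + int (card (?A \<inter> ?B))"
    using arg_cong[OF card_Un_Int[OF fin'(1,2)], of int] by (simp only: of_nat_add)
  hence "c * card ?A + c * card ?B = c * card (?A \<union> ?B) + c * card (?A \<inter> ?B)"
    by (rule distr)
  moreover have "c * card ?I = c * card ?J + c * card (?I - ?J)" by (simp only: J of_nat_add distrib_left)
  ultimately show "ext (X \<union> Y) + ext (X \<inter> Y) \<le> ext X + ext Y"
    unfolding closure_ext_def eq right_diff_distrib by linarith
qed

lemma ext_closed: "R `` X \<subseteq> X \<Longrightarrow> P \<subseteq> X \<Longrightarrow> X \<subseteq> Q \<Longrightarrow> ext (X - P) = f X"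
proof -
  assume "R `` X \<subseteq> X" "P \<subseteq> X" "X \<subseteq> Q"
  moreover from this have "P \<union> (X - P) = X" "R `` X = X" using subset_closure[of X] PQ by auto
  ultimately show ?thesis by (simp add: closure_ext_def)
qed

text \<open>Replacing \<open>Z\<close> by its closure drops a nonnegative penalty, so no set does
  better than the best closed one, where the extension agrees with \<open>f\<close>.\<close>

lemma ext_minimizer:
  assumes X: "R `` X \<subseteq> X" "P \<subseteq> X" "X \<subseteq> Q"
    and min: "\<And>Z. R `` Z \<subseteq> Z \<Longrightarrow> P \<subseteq> Z \<Longrightarrow> Z \<subseteq> Q \<Longrightarrow> f X \<le> f Z"
    and Z: "Z \<subseteq> Q - P"
  shows "ext (X - P) \<le> ext Z"
proof -
  have "finite (R `` (P \<union> Z))" using closure_in_interval(2)[OF Z] PQ fin by (auto intro: finite_subset)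
  moreover have "P \<union> Z \<subseteq> R `` (P \<union> Z)" using Z PQ by (intro subset_closure) auto
  ultimately have "card (P \<union> Z) \<le> card (R `` (P \<union> Z))" by (intro card_mono)
  hence "0 \<le> c * (int (card (R `` (P \<union> Z))) - int (card (P \<union> Z)))" using c by simp
  moreover have "f X \<le> f (R `` (P \<union> Z))"
    using closure_in_interval[OF Z] closure_closed by (intro min) auto
  ultimately show ?thesis
    unfolding ext_closed[OF X] by (simp add: closure_ext_def)
qed

text \<open>The origin of \<open>N\<close>: with \<open>c = 3 * h\<close> the marginal values are at
  most \<open>6 * card V * h\<close>, and the squared number of coordinates raises this to a cube.
  The summand 1 makes the inequality strict.\<close>

lemma gap_bound:
  fixes h :: int
  assumes "0 < h" "c = 3 * h"
  shows "(int (card (Q - P)))\<^sup>2 * (6 * card V * h) < (6 * int (card V) ^ 3 + 1) * h"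
proof -
  have "card (Q - P) \<le> card V" using PQ fin by (intro card_mono) auto
  hence "(int (card (Q - P)))\<^sup>2 \<le> (int (card V))\<^sup>2" by (intro power_mono) auto
  hence "(int (card (Q - P)))\<^sup>2 * (6 * card V * h) \<le> (int (card V))\<^sup>2 * (6 * card V * h)"
    using assms by (intro mult_right_mono) auto
  also have "\<dots> = (6 * int (card V) ^ 3) * h" by (simp add: power2_eq_square power3_eq_cube)
  also have "\<dots> < (6 * int (card V) ^ 3 + 1) * h" using assms by (intro mult_strict_right_mono) auto
  finally show ?thesis .
qed

text \<open>Descent is applied to the extension on \<open>Q - P\<close>, whose values at the empty
  and the full set are \<open>f P\<close> and \<open>f Q\<close>.\<close>

lemma excluded_element:
  fixes h :: int
  defines "N \<equiv> 6 * int (card V) ^ 3 + 1"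
  defines "Y \<equiv> greedy_total (Q - P) ext (6 * card V * h * N) (nat (N\<^sup>2))"
  assumes h: "0 < h" "c = 3 * h" "f Q - f P = h"
    and w: "w \<in> Q - P" "\<And>v. v \<in> Q - P \<Longrightarrow> Y v \<le> Y w"
    and X: "R `` X \<subseteq> X" "P \<subseteq> X" "X \<subseteq> Q"
      "\<And>Z. R `` Z \<subseteq> Z \<Longrightarrow> P \<subseteq> Z \<Longrightarrow> Z \<subseteq> Q \<Longrightarrow> f X \<le> f Z"
  shows "w \<notin> X"
proof -
  have "w \<notin> X - P"
  proof (rule greedy_total_excludes[where W = "Q - P" and g = ext and N = N and M = "6 * card V * h"])
    show "finite (Q - P)" using PQ fin by (auto intro: finite_subset)
    have "0 < card V" using w PQ fin by (auto simp: card_gt_0_iff)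
    thus "0 < 6 * card V * h" using h(1) by simp
    show "0 < N" by (simp add: N_def add_nonneg_pos)
    show "\<bar>ext (insert w X) - ext X\<bar> \<le> 6 * card V * h" if "X \<subseteq> Q - P" "w \<in> Q - P - X" for X w
      using ext_marginal[OF that] h by (simp add: algebra_simps)
    have "ext {} = f P" "ext (Q - P) = f Q" using ext_closed[of P] ext_closed[of Q] PQ by auto
    thus "(int (card (Q - P)))\<^sup>2 * (6 * card V * h) < N * (ext (Q - P) - ext {})"
      using gap_bound[OF h(1,2)] h(3) by (simp add: N_def)
    show "greedy_total (Q - P) ext (6 * card V * h * N) (nat (N\<^sup>2)) v \<le>
        greedy_total (Q - P) ext (6 * card V * h * N) (nat (N\<^sup>2)) w" if "v \<in> Q - P" for v
      using w(2)[OF that] by (simp add: Y_def)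
  qed (use ext_submodular w X ext_minimizer in auto)
  thus ?thesis using w by auto
qed

lemma included_element:
  fixes h :: int
  defines "N \<equiv> 6 * int (card V) ^ 3 + 1"
  defines "Y \<equiv> greedy_total (Q - P) ext (6 * card V * h * N) (nat (N\<^sup>2))"
  assumes h: "0 < h" "c = 3 * h" "f P - f Q = h"
    and w: "w \<in> Q - P" "\<And>v. v \<in> Q - P \<Longrightarrow> Y w \<le> Y v"
    and X: "R `` X \<subseteq> X" "P \<subseteq> X" "X \<subseteq> Q"
      "\<And>Z. R `` Z \<subseteq> Z \<Longrightarrow> P \<subseteq> Z \<Longrightarrow> Z \<subseteq> Q \<Longrightarrow> f X \<le> f Z"
  shows "w \<in> X"
proof -
  have "w \<in> X - P"
  proof (rule greedy_total_includes[where W = "Q - P" and g = ext and N = N and M = "6 * card V * h"])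
    show "finite (Q - P)" using PQ fin by (auto intro: finite_subset)
    have "0 < card V" using w PQ fin by (auto simp: card_gt_0_iff)
    thus "0 < 6 * card V * h" using h(1) by simp
    show "0 < N" by (simp add: N_def add_nonneg_pos)
    show "\<bar>ext (insert w X) - ext X\<bar> \<le> 6 * card V * h" if "X \<subseteq> Q - P" "w \<in> Q - P - X" for X w
      using ext_marginal[OF that] h by (simp add: algebra_simps)
    have "ext {} = f P" "ext (Q - P) = f Q" using ext_closed[of P] ext_closed[of Q] PQ by auto
    thus "(int (card (Q - P)))\<^sup>2 * (6 * card V * h) < N * (ext {} - ext (Q - P))"
      using gap_bound[OF h(1,2)] h(3) by (simp add: N_def)
    show "greedy_total (Q - P) ext (6 * card V * h * N) (nat (N\<^sup>2)) w \<le>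
        greedy_total (Q - P) ext (6 * card V * h * N) (nat (N\<^sup>2)) v" if "v \<in> Q - P" for v
      using w(2)[OF that] by (simp add: Y_def)
  qed (use ext_submodular w X ext_minimizer in auto)
  thus ?thesis by auto
qed

end

text \<open>Membership of two distinguished elements \<open>r\<close> and exclusion of \<open>s\<close> are forced, so that
  ``in every minimizer'' and ``in no minimizer'' are the arcs from \<open>r\<close> and the arcs to \<open>s\<close>.\<close>

definition closed_sets :: "'a set \<Rightarrow> 'a rel \<Rightarrow> 'a \<Rightarrow> 'a \<Rightarrow> 'a set set" where
  "closed_sets V R r s = {X. X \<subseteq> V \<and> r \<in> X \<and> s \<notin> X \<and> R `` X \<subseteq> X}"

lemma closed_sets_lattice:
  assumes "X \<in> closed_sets V R r s" "Y \<in> closed_sets V R r s"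
  shows "X \<union> Y \<in> closed_sets V R r s" "X \<inter> Y \<in> closed_sets V R r s"
  using assms unfolding closed_sets_def by blast+

text \<open>In the setting of \<open>fixing\<close> and for \<open>u \<in> V\<close>, this is the
  least member of \<open>closed_sets V R r s\<close> containing \<open>u\<close> if
  \<open>(u, s) \<notin> R\<close>. Dually, \<open>avoiding\<close> is the largest member without
  \<open>u\<close> if \<open>(r, u) \<notin> R\<close>.\<close>

definition above :: "'a rel \<Rightarrow> 'a \<Rightarrow> 'a \<Rightarrow> 'a set" where
  "above R r u = R `` {r, u}"

definition avoiding :: "'a set \<Rightarrow> 'a rel \<Rightarrow> 'a \<Rightarrow> 'a \<Rightarrow> 'a set" where
  "avoiding V R s u = V - R\<inverse> `` {s, u}"

text \<open>Intervals \<open>[P, Q]\<close> of closed sets on which a large gap \<open>\<sigma> (f Q - f P)\<close> reveals a new arc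
  at \<open>z\<close>: an element in every minimizer over the interval gives an arc from \<open>z\<close> if \<open>\<sigma> = -1\<close>, an
  element in none gives an arc to \<open>z\<close> if \<open>\<sigma> = 1\<close>.\<close>

definition candidates_at :: "'a set \<Rightarrow> 'a rel \<Rightarrow> 'a \<Rightarrow> 'a \<Rightarrow> 'a \<Rightarrow> ('a set \<times> 'a set \<times> int \<times> 'a) set" where
  "candidates_at V R r s u =
     (if (u, s) \<notin> R then {(above R r u, avoiding V R s s, - 1, u)} else {}) \<union>
     (if (r, u) \<notin> R then {(above R r r, avoiding V R s u, 1, u)} else {}) \<union>
     (if (r, u) \<notin> R \<and> (u, s) \<notin> R then
        {(above R r r, above R r u \<inter> avoiding V R s u, - 1, r),
         (above R r u \<union> avoiding V R s u, avoiding V R s s, 1, s)} else {})"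

lemma minimizer_exists:
  assumes "finite G" "G \<noteq> {}"
  obtains X where "minimizer f G X"
proof -
  from arg_min_if_finite[OF assms, of f] that[of "arg_min_on f G"] show thesis
    by (auto simp: minimizer_def not_less)
qed

section \<open>Slopes, gaps and forced elements in the lattice of closed sets\<close>

locale fixing =
  fixes V :: "'a::linorder set" and f :: "'a set \<Rightarrow> int" and R :: "'a rel" and r s :: 'a
  assumes fin: "finite V" and sub: "submodular_on V f"
    and R: "R \<subseteq> V \<times> V" "\<And>x. x \<in> V \<Longrightarrow> (x, x) \<in> R" "trans R"
    and rs: "r \<in> V" "s \<in> V" "(r, s) \<notin> R"
begin

abbreviation K where "K \<equiv> closed_sets V R r s"
abbreviation up where "up u \<equiv> above R r u"
abbreviation down where "down u \<equiv> avoiding V R s u"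

lemma finite_K: "finite K"
  by (rule finite_subset[of _ "Pow V"]) (use fin in \<open>auto simp: closed_sets_def\<close>)

lemma up_in_K: "u \<in> V \<Longrightarrow> (u, s) \<notin> R \<Longrightarrow> up u \<in> K"
  using R rs by (auto simp: closed_sets_def above_def dest: transD)

lemma down_in_K: "u \<in> V \<Longrightarrow> (r, u) \<notin> R \<Longrightarrow> down u \<in> K"
  using R rs by (auto simp: closed_sets_def avoiding_def dest: transD)

lemma up_least: "X \<in> K \<Longrightarrow> u \<in> X \<Longrightarrow> up u \<subseteq> X"
  by (auto simp: closed_sets_def above_def)

lemma down_greatest: "X \<in> K \<Longrightarrow> u \<notin> X \<Longrightarrow> X \<subseteq> down u"
  by (auto simp: closed_sets_def avoiding_def)

lemma up_r: "up r = R `` {r}"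
  by (simp add: above_def)

lemma extremes: "up r \<in> K" "down s \<in> K"
  using up_in_K down_in_K rs by auto

lemma between: "X \<in> K \<Longrightarrow> up r \<subseteq> X" "X \<in> K \<Longrightarrow> X \<subseteq> down s"
  using up_least[of X r] down_greatest[of X s] by (auto simp: closed_sets_def)

text \<open>Climb from \<open>A\<close> to \<open>B\<close> by joining one \<open>up u\<close> at a
  time; each join adds at least \<open>u\<close>, so \<open>card (B - A)\<close> joins suffice. For
  a suitable \<open>u\<close>, the set \<open>A\<close> lies between
  \<open>up u \<inter> down u\<close> and \<open>down u\<close>, and by submodularity the change of
  \<open>f\<close> caused by the join is bounded by the differences at these two extremes.\<close>

lemma slope_from_marginals:
  assumes c: "0 \<le> c"
    and upper: "\<And>u. u \<in> V \<Longrightarrow> (r, u) \<notin> R \<Longrightarrow> (u, s) \<notin> R \<Longrightarrow> f (up u) - f (up u \<inter> down u) \<le> c"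
    and lower: "\<And>u. u \<in> V \<Longrightarrow> (r, u) \<notin> R \<Longrightarrow> (u, s) \<notin> R \<Longrightarrow> f (down u) - f (up u \<union> down u) \<le> c"
    and AB: "A \<in> K" "B \<in> K" "A \<subseteq> B"
  shows "\<bar>f B - f A\<bar> \<le> c * card (B - A)"
  using AB
proof (induction "card (B - A)" arbitrary: A rule: less_induct)
  case less
  show ?case
  proof (cases "A = B")
    case False
    have B: "B \<subseteq> V" "finite B" using less.prems fin by (auto simp: closed_sets_def intro: finite_subset)
    \<comment> \<open>An element with the fewest successors: whatever is reachable from
      \<open>u\<close>, but not conversely, has fewer successors and hence cannot lie in
      \<open>B - A\<close>.\<close>
    obtain u where u: "u \<in> B - A" "\<And>v. v \<in> B - A \<Longrightarrow> card (R `` {u}) \<le> card (R `` {v})"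
      using False less.prems ex_has_least_nat[of "\<lambda>u. u \<in> B - A" _ "\<lambda>u. card (R `` {u})"] by blast
    have u': "u \<in> V" "(r, u) \<notin> R" "(u, s) \<notin> R"
      using u(1) less.prems B by (auto simp: closed_sets_def)
    have "A \<subseteq> down u" using u(1) less.prems by (intro down_greatest) auto
    have "up u \<inter> down u \<subseteq> A"
    proof
      fix x assume x: "x \<in> up u \<inter> down u"
      show "x \<in> A"
      proof (cases "(u, x) \<in> R")
        case True
        have "R `` {x} \<subset> R `` {u}"
          using True x R(2)[OF u'(1)] R(3) by (auto simp: avoiding_def dest: transD)
        moreover have "finite (R `` {u})" using R(1) fin by (auto intro: finite_subset[of _ V])
        ultimately have "card (R `` {x}) < card (R `` {u})" by (rule psubset_card_mono[rotated])
        moreover have "x \<in> B" using True u(1) less.prems by (auto simp: closed_sets_def)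
        ultimately show ?thesis using u(2)[of x] by auto
      qed (use x less.prems in \<open>auto simp: above_def closed_sets_def\<close>)
    qed
    let ?A = "A \<union> up u"
    have A: "?A \<in> K" "?A \<subseteq> B"
      using closed_sets_lattice[OF less.prems(1) up_in_K[OF u'(1,3)]] up_least[OF less.prems(2)] u(1) less.prems
      by auto
    have "u \<in> up u" using R(2)[OF u'(1)] by (auto simp: above_def)
    hence psub: "B - ?A \<subset> B - A" using u(1) by auto
    hence card: "card (B - ?A) < card (B - A)" using B by (intro psubset_card_mono) auto
    have IH: "\<bar>f B - f ?A\<bar> \<le> c * card (B - ?A)" using card A less.prems by (intro less.hyps)
    have sub_V: "A \<subseteq> V" "up u \<subseteq> V" "down u \<subseteq> V" "?A \<subseteq> V"
      using less.prems up_in_K[OF u'(1,3)] down_in_K[OF u'(1,2)] by (auto simp: closed_sets_def)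
    have "A \<inter> up u = up u \<inter> down u" "?A \<inter> down u = A" "?A \<union> down u = up u \<union> down u"
      using \<open>A \<subseteq> down u\<close> \<open>up u \<inter> down u \<subseteq> A\<close> by auto
    hence "f ?A - f A \<le> c" "f A - f ?A \<le> c"
      using submodular_onD[OF sub sub_V(1,2)] submodular_onD[OF sub sub_V(4,3)] upper[OF u'] lower[OF u'] by auto
    hence "\<bar>f B - f A\<bar> \<le> c * (int (card (B - ?A)) + 1)" using IH by (auto simp: algebra_simps)
    also have "\<dots> \<le> c * card (B - A)" using card c by (intro mult_left_mono) auto
    finally show ?thesis .
  qed simp
qed

lemma submodular_K: "A \<in> K \<Longrightarrow> B \<in> K \<Longrightarrow> f (A \<union> B) + f (A \<inter> B) \<le> f A + f B"
  by (intro submodular_onD[OF sub]) (auto simp: closed_sets_def)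

abbreviation interval where "interval P Q \<equiv> {Z \<in> K. P \<subseteq> Z \<and> Z \<subseteq> Q}"

lemma interval_minimizer_exists:
  assumes "P \<in> K" "P \<subseteq> Q"
  obtains Z where "minimizer f (interval P Q) Z"
  by (rule minimizer_exists[of "interval P Q"]) (use assms finite_K in auto)

text \<open>Exchange argument: if \<open>Z\<close> minimizes over the interval, so does
  \<open>X \<inter> Z\<close>, because \<open>X \<union> Z\<close> cannot beat \<open>X\<close>; the
  condition \<open>P \<subseteq> X\<close> keeps the intersection in the interval. The next lemma is
  dual, with \<open>X \<union> Z\<close>.\<close>

lemma minimizer_contains:
  assumes X: "minimizer f K X" and PQ: "P \<in> K" "Q \<in> K" "P \<subseteq> Q" "P \<subseteq> X"
    and w: "\<And>Z. minimizer f (interval P Q) Z \<Longrightarrow> w \<in> Z"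
  shows "w \<in> X"
proof -
  obtain Z where Z: "minimizer f (interval P Q) Z" using interval_minimizer_exists PQ by blast
  hence ZK: "X \<in> K" "Z \<in> K" "P \<subseteq> Z" "Z \<subseteq> Q" using X by (auto simp: minimizer_def)
  have "f X \<le> f (X \<union> Z)" using X closed_sets_lattice[OF ZK(1,2)] by (auto simp: minimizer_def)
  hence "f (X \<inter> Z) \<le> f Z" using submodular_K[OF ZK(1,2)] by auto
  moreover have "f Z \<le> f Y" if "Y \<in> interval P Q" for Y using Z that by (simp add: minimizer_def)
  moreover have "X \<inter> Z \<in> interval P Q" using ZK PQ closed_sets_lattice[OF ZK(1,2)] by blast
  ultimately have "minimizer f (interval P Q) (X \<inter> Z)"
    unfolding minimizer_def by (meson order_trans)
  thus ?thesis using w by auto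
qed

lemma minimizer_avoids:
  assumes X: "minimizer f K X" and PQ: "P \<in> K" "Q \<in> K" "P \<subseteq> Q" "X \<subseteq> Q"
    and w: "\<And>Z. minimizer f (interval P Q) Z \<Longrightarrow> w \<notin> Z"
  shows "w \<notin> X"
proof -
  obtain Z where Z: "minimizer f (interval P Q) Z" using interval_minimizer_exists PQ by blast
  hence ZK: "X \<in> K" "Z \<in> K" "P \<subseteq> Z" "Z \<subseteq> Q" using X by (auto simp: minimizer_def)
  have "f X \<le> f (X \<inter> Z)" using X closed_sets_lattice[OF ZK(1,2)] by (auto simp: minimizer_def)
  hence "f (X \<union> Z) \<le> f Z" using submodular_K[OF ZK(1,2)] by auto
  moreover have "f Z \<le> f Y" if "Y \<in> interval P Q" for Y using Z that by (simp add: minimizer_def)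
  moreover have "X \<union> Z \<in> interval P Q" using ZK PQ closed_sets_lattice[OF ZK(1,2)] by blast
  ultimately have "minimizer f (interval P Q) (X \<union> Z)"
    unfolding minimizer_def by (meson order_trans)
  thus ?thesis using w by auto
qed

abbreviation candidates where "candidates \<equiv> \<Union>u\<in>V. candidates_at V R r s u"

lemma candidates_cases:
  assumes "(P, Q, \<sigma>, z) \<in> candidates"
  obtains "P = up z" "Q = down s" "\<sigma> = - 1" "z \<in> V" "(z, s) \<notin> R"
  | "P = up r" "Q = down z" "\<sigma> = 1" "z \<in> V" "(r, z) \<notin> R"
  | u where "P = up r" "Q = up u \<inter> down u" "\<sigma> = - 1" "z = r" "u \<in> V" "(r, u) \<notin> R" "(u, s) \<notin> R"
  | u where "P = up u \<union> down u" "Q = down s" "\<sigma> = 1" "z = s" "u \<in> V" "(r, u) \<notin> R" "(u, s) \<notin> R"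
  using assms unfolding candidates_at_def by (auto split: if_splits)

text \<open>The final disjunction is what an arc at \<open>z\<close> requires. Successors (or
  predecessors) of \<open>z\<close> are outside \<open>Q - P\<close>, so the arc will be new; and
  closed sets containing \<open>z\<close> (or missing it) lie on the proper side of the interval for
  the exchange arguments.\<close>

lemma candidate_props:
  assumes "(P, Q, \<sigma>, z) \<in> candidates"
  shows "P \<in> K" "Q \<in> K" "P \<subseteq> Q" "z \<in> V"
    and "(\<sigma> = - 1 \<and> R `` {z} \<subseteq> P \<and> (\<forall>X\<in>K. z \<in> X \<longrightarrow> P \<subseteq> X)) \<or>
         (\<sigma> = 1 \<and> Q \<inter> R\<inverse> `` {z} = {} \<and> (\<forall>X\<in>K. z \<notin> X \<longrightarrow> X \<subseteq> Q))"
proof -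
  have "P \<in> K \<and> Q \<in> K \<and> z \<in> V"
    using assms
  proof (cases rule: candidates_cases)
    case 1
    thus ?thesis using up_in_K extremes by simp
  next
    case 2
    thus ?thesis using down_in_K extremes by simp
  next
    case (3 u)
    thus ?thesis using closed_sets_lattice(2)[OF up_in_K down_in_K, of u u] extremes rs by simp
  next
    case (4 u)
    thus ?thesis using closed_sets_lattice(1)[OF up_in_K down_in_K, of u u] extremes rs by simp
  qed
  thus PQ: "P \<in> K" "Q \<in> K" "z \<in> V" by simp_all
  show "P \<subseteq> Q"
    using assms by (cases rule: candidates_cases; use between(1)[OF PQ(2)] between(2)[OF PQ(1)] in simp)
  have *: "R `` {u} \<subseteq> up u" "down u \<inter> R\<inverse> `` {u} = {}" for u by (auto simp: above_def avoiding_def)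
  show "(\<sigma> = - 1 \<and> R `` {z} \<subseteq> P \<and> (\<forall>X\<in>K. z \<in> X \<longrightarrow> P \<subseteq> X)) \<or>
         (\<sigma> = 1 \<and> Q \<inter> R\<inverse> `` {z} = {} \<and> (\<forall>X\<in>K. z \<notin> X \<longrightarrow> X \<subseteq> Q))"
    using assms
    by (cases rule: candidates_cases; use up_least[of _ z] down_greatest[of _ z] between *[of z] in simp)
qed

text \<open>The differences at \<open>u\<close> telescope into three gains each: the one ending at
  \<open>up u \<inter> down u\<close> passes through \<open>down s\<close> and \<open>up r\<close>,
  the one ending at \<open>up u \<union> down u\<close> through \<open>up r\<close> and
  \<open>down s\<close>. The candidates at \<open>r\<close> and at \<open>s\<close> bound the leg
  between \<open>up r\<close> and \<open>down s\<close> in both directions.\<close>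

lemma slope_from_gains:
  assumes h: "\<And>P Q \<sigma> z. (P, Q, \<sigma>, z) \<in> candidates \<Longrightarrow> \<sigma> * (f Q - f P) \<le> h"
    and AB: "A \<in> K" "B \<in> K" "A \<subseteq> B"
  shows "\<bar>f B - f A\<bar> \<le> 3 * h * card (B - A)"
proof -
  have 1: "f (up u) - f (down s) \<le> h" if "u \<in> V" "(u, s) \<notin> R" for u
  proof -
    have "(up u, down s, - 1, u) \<in> candidates"
      using that(1) by (rule UN_I) (simp add: candidates_at_def that)
    from h[OF this] show ?thesis by simp
  qed
  have 2: "f (down u) - f (up r) \<le> h" if "u \<in> V" "(r, u) \<notin> R" for u
  proof -
    have "(up r, down u, 1, u) \<in> candidates"
      using that(1) by (rule UN_I) (simp add: candidates_at_def that)
    from h[OF this] show ?thesis by simp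
  qed
  have 3: "f (up r) - f (up u \<inter> down u) \<le> h" if "u \<in> V" "(r, u) \<notin> R" "(u, s) \<notin> R" for u
  proof -
    have "(up r, up u \<inter> down u, - 1, r) \<in> candidates"
      using that(1) by (rule UN_I) (simp add: candidates_at_def that)
    from h[OF this] show ?thesis by simp
  qed
  have 4: "f (down s) - f (up u \<union> down u) \<le> h" if "u \<in> V" "(r, u) \<notin> R" "(u, s) \<notin> R" for u
  proof -
    have "(up u \<union> down u, down s, 1, s) \<in> candidates"
      using that(1) by (rule UN_I) (simp add: candidates_at_def that)
    from h[OF this] show ?thesis by simp
  qed
  show ?thesis
  proof (rule slope_from_marginals[OF _ _ _ AB])
    show "0 \<le> 3 * h" using 1[OF rs(1,3)] 2[OF rs(2,3)] by linarith
    fix u assume u: "u \<in> V" "(r, u) \<notin> R" "(u, s) \<notin> R"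
    note 1[OF rs(1,3)] 2[OF rs(2,3)]
    thus "f (up u) - f (up u \<inter> down u) \<le> 3 * h" "f (down u) - f (up u \<union> down u) \<le> 3 * h"
      using 1[OF u(1,3)] 2[OF u(1,2)] 3[OF u] 4[OF u] by linarith+
  qed
qed

text \<open>With \<open>h = 0\<close> the slope bound vanishes, so \<open>f\<close> is constant on
  the closed sets and the least of them will do.\<close>

lemma no_gain_minimizer:
  assumes h: "\<And>P Q \<sigma> z. (P, Q, \<sigma>, z) \<in> candidates \<Longrightarrow> \<sigma> * (f Q - f P) \<le> 0"
  shows "minimizer f K (R `` {r})"
  unfolding minimizer_def up_r[symmetric]
proof (intro conjI ballI)
  show "f (up r) \<le> f X" if "X \<in> K" for X
    using slope_from_gains[OF h extremes(1) that between(1)[OF that]] by simp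
qed (rule extremes)

text \<open>For \<open>\<sigma> = - 1\<close> the element \<open>w\<close> is in every minimizer
  over \<open>[P, Q]\<close>, hence in every global minimizer that contains \<open>z\<close>. For
  \<open>\<sigma> = 1\<close> it is in none, hence in no global minimizer that misses
  \<open>z\<close>. The arc is new because \<open>P\<close> contains all successors of
  \<open>z\<close>, or \<open>Q\<close> none of its predecessors, while
  \<open>w \<in> Q - P\<close>.\<close>

lemma discovered_arc:
  fixes h :: int
  defines "N \<equiv> 6 * int (card V) ^ 3 + 1"
  assumes h: "\<And>P Q \<sigma> z. (P, Q, \<sigma>, z) \<in> candidates \<Longrightarrow> \<sigma> * (f Q - f P) \<le> h" "0 < h"
    and cand: "(P, Q, \<sigma>, z) \<in> candidates" "\<sigma> * (f Q - f P) = h"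
  defines "Y \<equiv> greedy_total (Q - P) (\<lambda>Z. closure_ext f R (3 * h) (P \<union> Z)) (6 * card V * h * N) (nat (N\<^sup>2))"
  assumes w: "w \<in> Q - P" "\<And>v. v \<in> Q - P \<Longrightarrow> \<sigma> * Y v \<le> \<sigma> * Y w"
    and ab: "(a, b) = (if \<sigma> = 1 then (w, z) else (z, w))"
  shows "(a, b) \<notin> R" "a \<in> V" "b \<in> V" "minimizer f K X \<Longrightarrow> a \<in> X \<Longrightarrow> b \<in> X"
proof -
  note props = candidate_props[OF cand(1)]
  interpret closed_interval V f R P Q "3 * h"
  proof
    show "\<bar>f B - f A\<bar> \<le> 3 * h * card (B - A)"
      if "P \<subseteq> A" "A \<subseteq> B" "B \<subseteq> Q" "R `` A \<subseteq> A" "R `` B \<subseteq> B" for A B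
    proof (rule slope_from_gains[OF h(1)])
      have "r \<in> P" "s \<notin> Q" "Q \<subseteq> V" using props(1,2) by (simp_all add: closed_sets_def)
      thus "A \<in> K" "B \<in> K" using that by (auto simp: closed_sets_def)
      show "\<And>P Q \<sigma> z. (P, Q, \<sigma>, z) \<in> candidates \<Longrightarrow> (P, Q, \<sigma>, z) \<in> candidates" .
    qed (rule that)
  qed (use fin sub R props h(2) in \<open>auto simp: closed_sets_def\<close>)
  have intv: "R `` Z \<subseteq> Z \<and> P \<subseteq> Z \<and> Z \<subseteq> Q \<longleftrightarrow> Z \<in> interval P Q" for Z
    using props by (auto simp: closed_sets_def)
  have wV: "w \<in> V" using w(1) props by (auto simp: closed_sets_def)
  from props(5) have "(a, b) \<notin> R \<and> a \<in> V \<and> b \<in> V \<and> (minimizer f K X \<longrightarrow> a \<in> X \<longrightarrow> b \<in> X)"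
  proof (elim disjE conjE)
    assume \<sigma>: "\<sigma> = - 1" "R `` {z} \<subseteq> P" "\<forall>X\<in>K. z \<in> X \<longrightarrow> P \<subseteq> X"
    have "w \<in> Z" if "minimizer f (interval P Q) Z" for Z
    proof (rule included_element[where h = h])
      show "R `` Z \<subseteq> Z" "P \<subseteq> Z" "Z \<subseteq> Q" using that intv[of Z] by (auto simp: minimizer_def)
      show "f Z \<le> f Z'" if "R `` Z' \<subseteq> Z'" "P \<subseteq> Z'" "Z' \<subseteq> Q" for Z'
        using \<open>minimizer f _ Z\<close> that intv[of Z'] by (auto simp: minimizer_def)
    qed (use w h cand \<sigma> in \<open>auto simp: Y_def N_def\<close>)
    hence "w \<in> X" if "minimizer f K X" "z \<in> X"
      using that \<sigma>(3) props by (intro minimizer_contains[of X P Q]) (auto simp: minimizer_def)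
    thus ?thesis using \<sigma> w ab props wV by auto
  next
    assume \<sigma>: "\<sigma> = 1" "Q \<inter> R\<inverse> `` {z} = {}" "\<forall>X\<in>K. z \<notin> X \<longrightarrow> X \<subseteq> Q"
    have "w \<notin> Z" if "minimizer f (interval P Q) Z" for Z
    proof (rule excluded_element[where h = h])
      show "R `` Z \<subseteq> Z" "P \<subseteq> Z" "Z \<subseteq> Q" using that intv[of Z] by (auto simp: minimizer_def)
      show "f Z \<le> f Z'" if "R `` Z' \<subseteq> Z'" "P \<subseteq> Z'" "Z' \<subseteq> Q" for Z'
        using \<open>minimizer f _ Z\<close> that intv[of Z'] by (auto simp: minimizer_def)
    qed (use w h cand \<sigma> in \<open>auto simp: Y_def N_def\<close>)
    hence "w \<notin> X" if "minimizer f K X" "z \<notin> X"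
      using that \<sigma>(3) props by (intro minimizer_avoids[of X P Q]) (auto simp: minimizer_def)
    thus ?thesis using \<sigma> w ab props wV by auto
  qed
  thus "(a, b) \<notin> R" "a \<in> V" "b \<in> V" "minimizer f K X \<Longrightarrow> a \<in> X \<Longrightarrow> b \<in> X" by auto
qed

end

lemma closure_ext_closed: "R `` X = X \<Longrightarrow> closure_ext f R c X = f X"
  by (simp add: closure_ext_def)

lemma greedy_total_outside: "w \<notin> W \<Longrightarrow> greedy_total W g H k w = 0"
  by (simp add: greedy_total_def greedy_def)

context fixing
begin

text \<open>The program searches all of \<open>V\<close> for the extreme coordinate. If it were
  found outside \<open>Q - P\<close>, where \<open>Y\<close> is 0, then no
  \<open>\<sigma> * Y v\<close> would be positive, although over \<open>Q - P\<close> they sum to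
  \<open>k\<close> times a positive gap.\<close>

lemma extreme_in_ground:
  fixes c H :: int
  assumes cand: "(P, Q, \<sigma>, z) \<in> candidates" "0 < \<sigma> * (f Q - f P)" and "0 < k" "w \<in> V"
  defines "Y \<equiv> greedy_total (Q - P) (\<lambda>Z. closure_ext f R c (P \<union> Z)) H k"
  assumes w: "\<And>v. v \<in> V \<Longrightarrow> \<sigma> * Y v \<le> \<sigma> * Y w"
  shows "w \<in> Q - P"
proof (rule ccontr)
  assume "w \<notin> Q - P"
  hence "Y w = 0" by (simp add: Y_def greedy_total_outside)
  have PQ: "Q \<subseteq> V" "R `` P \<subseteq> P" "R `` Q \<subseteq> Q" "P \<subseteq> Q"
    using candidate_props[OF cand(1)] by (auto simp: closed_sets_def)
  have "R `` P = P" "R `` Q = Q" using PQ R(2) by blast+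
  moreover have "P \<union> (Q - P) = Q" using PQ(4) by auto
  ultimately have "sum Y (Q - P) = int k * (f Q - f P)"
    using greedy_total_sum_eq[of "Q - P" "\<lambda>Z. closure_ext f R c (P \<union> Z)" H k] PQ(1) fin
    by (simp add: Y_def closure_ext_closed finite_subset)
  hence "(\<Sum>v\<in>Q - P. \<sigma> * Y v) = int k * (\<sigma> * (f Q - f P))" by (simp add: sum_distrib_left[symmetric] mult_ac)
  moreover have "(\<Sum>v\<in>Q - P. \<sigma> * Y v) \<le> 0" using w PQ(1) \<open>Y w = 0\<close> by (intro sum_nonpos) auto
  moreover have "0 < int k * (\<sigma> * (f Q - f P))" using cand(2) assms(3) by simp
  ultimately show False by linarith
qed

end

text \<open>For a preorder on a set containing \<open>a\<close> and \<open>b\<close> this is already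
  the transitive closure after adding \<open>(a, b)\<close>: a path uses the new arc at most
  once.\<close>

definition add_arc :: "'a rel \<Rightarrow> 'a \<Rightarrow> 'a \<Rightarrow> 'a rel" where
  "add_arc R a b = R \<union> {(p, q). (p, a) \<in> R \<and> (b, q) \<in> R}"

lemma trans_add_arc: "trans R \<Longrightarrow> trans (add_arc R a b)"
  unfolding trans_def add_arc_def by blast

text \<open>The invariant that lets the closed sets stand in for \<open>\<L>\<close>: all of them
  are feasible, and no minimizer over \<open>\<L>\<close> is lost.\<close>

definition sound_relation :: "'a set \<Rightarrow> ('a set \<Rightarrow> int) \<Rightarrow> 'a set set \<Rightarrow> 'a \<Rightarrow> 'a \<Rightarrow> 'a rel \<Rightarrow> bool" where
  "sound_relation V f \<L> r s R \<longleftrightarrow> R \<subseteq> V \<times> V \<and> (\<forall>x\<in>V. (x, x) \<in> R) \<and> trans R \<and>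
     closed_sets V R r s \<subseteq> \<L> \<and> (\<forall>X. minimizer f \<L> X \<longrightarrow> R `` X \<subseteq> X)"

locale constrained =
  fixes V :: "'a::linorder set" and f :: "'a set \<Rightarrow> int" and \<L> :: "'a set set" and r s :: 'a
  assumes fin: "finite V" and sub: "submodular_on V f" and rs: "r \<in> V" "s \<in> V"
    and \<L>: "\<L> \<noteq> {}" "\<And>X. X \<in> \<L> \<Longrightarrow> X \<subseteq> V \<and> r \<in> X \<and> s \<notin> X"
begin

lemma minimizer_closed_sets:
  assumes "sound_relation V f \<L> r s R"
  shows "minimizer f (closed_sets V R r s) X \<longleftrightarrow> minimizer f \<L> X"
proof -
  have "finite \<L>" using \<L>(2) fin by (auto intro: finite_subset[of _ "Pow V"])
  then obtain Z where Z: "minimizer f \<L> Z" using \<L>(1) minimizer_exists by metis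
  have *: "Y \<in> closed_sets V R r s" if "minimizer f \<L> Y" for Y
    using assms that \<L>(2) by (auto simp: sound_relation_def closed_sets_def minimizer_def)
  have "closed_sets V R r s \<subseteq> \<L>" using assms by (simp add: sound_relation_def)
  moreover have "f Z \<le> f Y" if "Y \<in> \<L>" for Y using Z that by (simp add: minimizer_def)
  ultimately show ?thesis
  proof (intro iffI)
    assume X: "minimizer f (closed_sets V R r s) X"
    hence "f X \<le> f Z" using *[OF Z] by (simp add: minimizer_def)
    thus "minimizer f \<L> X" using X \<open>closed_sets V R r s \<subseteq> \<L>\<close> \<open>\<And>Y. Y \<in> \<L> \<Longrightarrow> f Z \<le> f Y\<close>
      by (force simp: minimizer_def)
  qed (use *[of X] \<open>closed_sets V R r s \<subseteq> \<L>\<close> in \<open>auto simp: minimizer_def\<close>)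
qed

text \<open>If \<open>(r, s)\<close> were in \<open>R\<close>, a minimizer over \<open>\<L>\<close>,
  which contains \<open>r\<close> and is closed, would contain \<open>s\<close>.\<close>

lemma fixing:
  assumes "sound_relation V f \<L> r s R"
  shows "fixing V f R r s"
proof
  have "finite \<L>" using \<L>(2) fin by (auto intro: finite_subset[of _ "Pow V"])
  then obtain Z where "minimizer f \<L> Z" using \<L>(1) minimizer_exists by metis
  thus "(r, s) \<notin> R" using assms \<L>(2) unfolding sound_relation_def minimizer_def by blast
qed (use assms fin sub rs in \<open>auto simp: sound_relation_def\<close>)

lemma sound_add_arc:
  assumes "sound_relation V f \<L> r s R" "a \<in> V" "b \<in> V"
    and "\<And>X. minimizer f \<L> X \<Longrightarrow> a \<in> X \<Longrightarrow> b \<in> X"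
  shows "sound_relation V f \<L> r s (add_arc R a b)"
proof -
  have "add_arc R a b \<subseteq> V \<times> V" "\<forall>x\<in>V. (x, x) \<in> add_arc R a b"
    using assms(1-3) by (auto simp: sound_relation_def add_arc_def)
  moreover have "closed_sets V (add_arc R a b) r s \<subseteq> closed_sets V R r s"
    by (auto simp: closed_sets_def add_arc_def)
  moreover have "add_arc R a b `` X \<subseteq> X" if "minimizer f \<L> X" for X
  proof -
    have "R `` X \<subseteq> X" using assms(1) that by (simp add: sound_relation_def)
    thus ?thesis using assms(4)[OF that] unfolding add_arc_def by blast
  qed
  ultimately show ?thesis using assms(1) trans_add_arc by (auto simp: sound_relation_def)
qed

lemma card_add_arc:
  assumes "sound_relation V f \<L> r s R" "a \<in> V" "b \<in> V" "(a, b) \<notin> R"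
  shows "card R < card (add_arc R a b)"
proof (rule psubset_card_mono)
  have "add_arc R a b \<subseteq> V \<times> V" using assms(1-3) by (auto simp: sound_relation_def add_arc_def)
  thus "finite (add_arc R a b)" using fin by (auto intro: finite_subset)
  show "R \<subset> add_arc R a b" using assms by (auto simp: sound_relation_def add_arc_def)
qed

end

section \<open>Total correctness of programs with bounded loops\<close>

text \<open>Every loop is charged \<open>L\<close> iterations. The nesting depth is fixed by the
  program text, so a polynomial \<open>L\<close> yields a polynomial bound; adding the two branches
  of a conditional, instead of taking their maximum, keeps it literally a polynomial.\<close>

fun time_bound :: "nat \<Rightarrow> com \<Rightarrow> nat" where
  "time_bound L Skip = 1"
| "time_bound L (Assign x e) = 1 + acost e"
| "time_bound L (Write a i e) = 1 + acost i + acost e"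
| "time_bound L (Seq c1 c2) = time_bound L c1 + time_bound L c2"
| "time_bound L (Cond b c1 c2) = 1 + bcost b + time_bound L c1 + time_bound L c2"
| "time_bound L (While b c) = 1 + bcost b + L * (1 + bcost b + time_bound L c)"
| "time_bound L (Query_Value x a) = 1"
| "time_bound L (Query_Member x a) = 1"

lemma time_bound_poly: "\<exists>p. \<forall>n. time_bound (poly l n) c = poly p n"
proof (induction c)
  case (Assign x e)
  have "\<forall>n. time_bound (poly l n) (Assign x e) = poly [:1 + acost e:] n" by simp
  thus ?case by blast
next
  case (Write a i e)
  have "\<forall>n. time_bound (poly l n) (Write a i e) = poly [:1 + acost i + acost e:] n" by simp
  thus ?case by blast
next
  case (Seq c1 c2)
  then obtain p1 p2 where "\<forall>n. time_bound (poly l n) c1 = poly p1 n" "\<forall>n. time_bound (poly l n) c2 = poly p2 n"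
    by blast
  hence "\<forall>n. time_bound (poly l n) (Seq c1 c2) = poly (p1 + p2) n" by simp
  thus ?case by blast
next
  case (Cond b c1 c2)
  then obtain p1 p2 where "\<forall>n. time_bound (poly l n) c1 = poly p1 n" "\<forall>n. time_bound (poly l n) c2 = poly p2 n"
    by blast
  hence "\<forall>n. time_bound (poly l n) (Cond b c1 c2) = poly ([:1 + bcost b:] + p1 + p2) n" by simp
  thus ?case by blast
next
  case (While b c)
  then obtain p where "\<forall>n. time_bound (poly l n) c = poly p n" by blast
  hence "\<forall>n. time_bound (poly l n) (While b c) = poly ([:1 + bcost b:] + l * ([:1 + bcost b:] + p)) n"
    by simp
  thus ?case by blast
qed (auto intro: exI[of _ "[:1:]"])

section \<open>Frame conditions\<close>

fun written_vars :: "com \<Rightarrow> string set" where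
  "written_vars (Assign x e) = {x}"
| "written_vars (Seq c1 c2) = written_vars c1 \<union> written_vars c2"
| "written_vars (Cond b c1 c2) = written_vars c1 \<union> written_vars c2"
| "written_vars (While b c) = written_vars c"
| "written_vars (Query_Value x a) = {x}"
| "written_vars (Query_Member x a) = {x}"
| "written_vars _ = {}"

fun written_arrs :: "com \<Rightarrow> string set" where
  "written_arrs (Write a i e) = {a}"
| "written_arrs (Seq c1 c2) = written_arrs c1 \<union> written_arrs c2"
| "written_arrs (Cond b c1 c2) = written_arrs c1 \<union> written_arrs c2"
| "written_arrs (While b c) = written_arrs c"
| "written_arrs _ = {}"

definition same_except :: "string set \<Rightarrow> string set \<Rightarrow> state \<Rightarrow> state \<Rightarrow> bool" where
  "same_except X A s s' \<longleftrightarrow> (\<forall>x. x \<notin> X \<longrightarrow> var s' x = var s x) \<and> (\<forall>a. a \<notin> A \<longrightarrow> arr s' a = arr s a)"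

lemma set_simps [simp]:
  "var (set_var x r s) = (var s)(x := r)" "arr (set_var x r s) = arr s"
  "var (set_arr a i r s) = var s" "arr (set_arr a i r s) = (arr s)(a := (arr s a)(i := r))"
  by (simp_all add: set_var_def set_arr_def)

lemma same_exceptD:
  "same_except X A s s' \<Longrightarrow> x \<notin> X \<Longrightarrow> var s' x = var s x"
  "same_except X A s s' \<Longrightarrow> a \<notin> A \<Longrightarrow> arr s' a = arr s a"
  by (auto simp: same_except_def)

lemma same_except_trans:
  "same_except X A s s' \<Longrightarrow> same_except Y B s' s'' \<Longrightarrow> same_except (X \<union> Y) (A \<union> B) s s''"
  by (auto simp: same_except_def)

lemma same_except_mono: "same_except X A s s' \<Longrightarrow> X \<subseteq> Y \<Longrightarrow> A \<subseteq> B \<Longrightarrow> same_except Y B s s'"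
  by (auto simp: same_except_def)

lemma run_same_except:
  "run n val mem W c s t s' \<Longrightarrow> same_except (written_vars c) (written_arrs c) s s'"
  by (induction rule: run.induct) (auto simp: same_except_def)

lemma flagged_same: "same_except X A s s' \<Longrightarrow> a \<notin> A \<Longrightarrow> flagged n a s' = flagged n a s"
  by (auto simp: same_except_def flagged_def)

lemma flagged_simps [simp]:
  "flagged n a (set_var x r s) = flagged n a s"
  "a \<noteq> b \<Longrightarrow> flagged n a (set_arr b i r s) = flagged n a s"
  by (simp_all add: flagged_def)

lemma flagged_subset: "flagged n a s \<subseteq> {..<n}"
  by (auto simp: flagged_def)

section \<open>Counting loops, sets as flag arrays, relations as matrices\<close>

definition For :: "string \<Rightarrow> aexp \<Rightarrow> com \<Rightarrow> com" where
  "For x e c = Seq (Assign x (Const 0)) (While (Less (Var x) e) (Seq c (Assign x (Plus (Var x) (Const 1)))))"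

lemma written_For [simp]:
  "written_vars (For x e c) = insert x (written_vars c)" "written_arrs (For x e c) = written_arrs c"
  by (auto simp: For_def)

definition Or :: "bexp \<Rightarrow> bexp \<Rightarrow> bexp" where
  "Or b1 b2 = Neg (Conj (Neg b1) (Neg b2))"

lemma bval_Or [simp]: "bval (Or b1 b2) s \<longleftrightarrow> bval b1 s \<or> bval b2 s"
  by (simp add: Or_def)

definition In :: "aexp \<Rightarrow> string \<Rightarrow> bexp" where
  "In e a = Neg (Equal (Read a e) (Const 0))"

lemma bval_In: "aval e s = of_nat k \<Longrightarrow> k < n \<Longrightarrow> bval (In e a) s \<longleftrightarrow> k \<in> flagged n a s"
  by (simp add: In_def flagged_def)

abbreviation Size :: aexp where "Size \<equiv> Var ''n''"

definition Related :: "aexp \<Rightarrow> aexp \<Rightarrow> bexp" where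
  "Related e1 e2 = Neg (Equal (Read ''R'' (Plus (Times e1 Size) e2)) (Const 0))"

definition relation :: "nat \<Rightarrow> state \<Rightarrow> nat rel" where
  "relation n s = {(a, b). a < n \<and> b < n \<and> arr s ''R'' (of_nat (a * n + b)) \<noteq> 0}"

lemma bval_Related:
  "var s ''n'' = of_nat n \<Longrightarrow> aval e1 s = of_nat a \<Longrightarrow> aval e2 s = of_nat b \<Longrightarrow> a < n \<Longrightarrow> b < n \<Longrightarrow>
   bval (Related e1 e2) s \<longleftrightarrow> (a, b) \<in> relation n s"
  by (simp add: Related_def relation_def)

lemma relation_same: "same_except X A s s' \<Longrightarrow> ''R'' \<notin> A \<Longrightarrow> relation n s' = relation n s"
  by (auto simp: same_except_def relation_def)

lemma relation_simps [simp]: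
  "relation n (set_var x r s) = relation n s"
  "a \<noteq> ''R'' \<Longrightarrow> relation n (set_arr a i r s) = relation n s"
  by (simp_all add: relation_def)

lemma row_major_inj:
  fixes a b a' b' n :: nat
  assumes "b < n" "b' < n"
  shows "a * n + b = a' * n + b' \<longleftrightarrow> a = a' \<and> b = b'"
proof
  assume eq: "a * n + b = a' * n + b'"
  have mod: "(i * n + j) mod n = j" and div: "(i * n + j) div n = i" if "j < n" for i j
    using that by auto
  show "a = a' \<and> b = b'" using mod[OF assms(1), of a] mod[OF assms(2), of a']
      div[OF assms(1), of a] div[OF assms(2), of a'] unfolding eq by (simp only:)
qed simp

text \<open>The bound in \<open>fits\<close> dominates every integer that the program stores. The
  largest are sums of at most \<open>(6 * n ^ 3 + 1)\<^sup>2\<close> greedy coordinates, each at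
  most \<open>12 * (n + 1) * F\<close>; the slack in 20, 3 and \<open>F + 1\<close> covers counters
  and indices, also when \<open>F = 0\<close>. The same square serves as the bound \<open>L\<close>
  on iterations.\<close>

locale oracle_machine =
  fixes n :: nat and val :: "nat set \<Rightarrow> int" and mem :: "nat set \<Rightarrow> bool" and W L :: nat and F :: int
  assumes val_bound: "\<And>X. X \<subseteq> {..<n} \<Longrightarrow> \<bar>val X\<bar> \<le> F"
    and fits: "\<And>z. \<bar>z\<bar> \<le> 20 * (int n + 1) * (6 * int n ^ 3 + 3)\<^sup>2 * (F + 1) \<Longrightarrow> rat_size (of_int z) \<le> W"
    and L: "L = (6 * n ^ 3 + 3)\<^sup>2"
begin

text \<open>Since a run gets stuck on oversized numbers, this one predicate covers the result, the
  running time and the size of the numbers.\<close>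

definition wp :: "com \<Rightarrow> (state \<Rightarrow> bool) \<Rightarrow> state \<Rightarrow> bool" where
  "wp c Q s \<longleftrightarrow> (\<exists>t s'. run n val mem W c s t s' \<and> t \<le> time_bound L c \<and> Q s')"

text \<open>The consequence rule with the frame built in, so that postconditions need only mention
  what a program computes.\<close>

lemma wp_use:
  "wp c P s \<Longrightarrow> (\<And>s'. P s' \<Longrightarrow> same_except (written_vars c) (written_arrs c) s s' \<Longrightarrow> Q s') \<Longrightarrow> wp c Q s"
  unfolding wp_def using run_same_except by blast

lemma wp_Skip: "Q s \<Longrightarrow> wp Skip Q s"
  unfolding wp_def using run.Skip by fastforce

lemma wp_Assign: "rat_size (aval e s) \<le> W \<Longrightarrow> Q (set_var x (aval e s) s) \<Longrightarrow> wp (Assign x e) Q s"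
  unfolding wp_def using run.Assign by fastforce

lemma wp_Write:
  "rat_size (aval i s) \<le> W \<Longrightarrow> rat_size (aval e s) \<le> W \<Longrightarrow>
   Q (set_arr a (aval i s) (aval e s) s) \<Longrightarrow> wp (Write a i e) Q s"
  unfolding wp_def using run.Write by fastforce

lemma wp_Seq: "wp c1 (wp c2 Q) s \<Longrightarrow> wp (Seq c1 c2) Q s"
  unfolding wp_def by (fastforce intro: run.Seq add_mono)

lemma wp_Cond: "(bval b s \<Longrightarrow> wp c1 Q s) \<Longrightarrow> (\<not> bval b s \<Longrightarrow> wp c2 Q s) \<Longrightarrow> wp (Cond b c1 c2) Q s"
  unfolding wp_def by (cases "bval b s") (fastforce intro: run.Cond_True run.Cond_False)+

lemma wp_Query_Value:
  "rat_size (of_int (val (flagged n a s))) \<le> W \<Longrightarrow> Q (set_var x (of_int (val (flagged n a s))) s) \<Longrightarrow>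
   wp (Query_Value x a) Q s"
  unfolding wp_def using run.Query_Value by fastforce

lemma wp_Query_Member:
  "rat_size (of_bool (mem (flagged n a s))) \<le> W \<Longrightarrow> Q (set_var x (of_bool (mem (flagged n a s))) s) \<Longrightarrow>
   wp (Query_Member x a) Q s"
  unfolding wp_def using run.Query_Member by fastforce

text \<open>The invariant is indexed by the number of completed iterations and the total
  \<open>m\<close> is known in advance, so that \<open>m \<le> L\<close> bounds the cost. The
  induction runs over the remaining iterations.\<close>

lemma wp_While:
  assumes "m \<le> L" and "I 0 s"
    and step: "\<And>k s. k < m \<Longrightarrow> I k s \<Longrightarrow> bval b s \<and> wp c (I (Suc k)) s"
    and exit: "\<And>s. I m s \<Longrightarrow> \<not> bval b s"
  shows "wp (While b c) (I m) s"
proof -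
  have "\<exists>t s'. run n val mem W (While b c) s t s' \<and> t \<le> 1 + bcost b + j * (1 + bcost b + time_bound L c) \<and> I m s'"
    if "j \<le> m" "I (m - j) s" for j s
    using that
  proof (induction j arbitrary: s)
    case 0
    thus ?case using exit run.While_False by fastforce
  next
    case (Suc j)
    hence b: "bval b s" and "wp c (I (Suc (m - Suc j))) s" using step[of "m - Suc j" s] by auto
    moreover have "Suc (m - Suc j) = m - j" using Suc.prems by simp
    ultimately obtain t1 s1 where 1: "run n val mem W c s t1 s1" "t1 \<le> time_bound L c" "I (m - j) s1"
      unfolding wp_def by auto
    with Suc.IH[of s1] Suc.prems obtain t2 s2 where
      2: "run n val mem W (While b c) s1 t2 s2" "t2 \<le> 1 + bcost b + j * (1 + bcost b + time_bound L c)" "I m s2"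
      by auto
    from run.While_True[OF b 1(1) 2(1)] 1(2) 2(2,3) show ?case
      by (intro exI conjI) auto
  qed
  from this[of m s] assms(2) obtain t s' where
    "run n val mem W (While b c) s t s'" "t \<le> 1 + bcost b + m * (1 + bcost b + time_bound L c)" "I m s'"
    by auto
  moreover from this(2) have "t \<le> time_bound L (While b c)"
    using mult_le_mono1[OF assms(1), of "1 + bcost b + time_bound L c"] by simp
  ultimately show ?thesis unfolding wp_def by blast
qed

lemma F_nonneg: "0 \<le> F"
  using val_bound[of "{}"] by simp

lemma capacity:
  fixes z :: int
  assumes "\<bar>z\<bar> \<le> 20 * (int n + 1) * (6 * int n ^ 3 + 3)\<^sup>2"
  shows "rat_size (of_int z) \<le> W"
proof (rule fits)
  have "20 * (int n + 1) * (6 * int n ^ 3 + 3)\<^sup>2 * 1 \<le> 20 * (int n + 1) * (6 * int n ^ 3 + 3)\<^sup>2 * (F + 1)"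
    using F_nonneg by (intro mult_left_mono) auto
  with assms show "\<bar>z\<bar> \<le> 20 * (int n + 1) * (6 * int n ^ 3 + 3)\<^sup>2 * (F + 1)" by linarith
qed

lemma fits_count:
  assumes "k \<le> L"
  shows "rat_size (of_nat k) \<le> W"
proof -
  have "rat_size (of_int (int k)) \<le> W"
  proof (rule capacity)
    have "int k \<le> int ((6 * n ^ 3 + 3)\<^sup>2)" using assms unfolding L by (simp only: of_nat_le_iff)
    also have "\<dots> = 1 * (6 * int n ^ 3 + 3)\<^sup>2" by simp
    also have "\<dots> \<le> 20 * (int n + 1) * (6 * int n ^ 3 + 3)\<^sup>2" by (intro mult_right_mono) auto
    finally show "\<bar>int k\<bar> \<le> 20 * (int n + 1) * (6 * int n ^ 3 + 3)\<^sup>2" by simp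
  qed
  thus ?thesis by simp
qed

lemma L_ge: "(6 * n ^ 3 + 1)\<^sup>2 \<le> L" "n * n + 1 \<le> L" "n \<le> L" "1 \<le> L"
proof -
  show "(6 * n ^ 3 + 1)\<^sup>2 \<le> L" unfolding L by (intro power_mono) auto
  have "n \<le> n ^ 3" by (cases "n = 0") (auto intro: self_le_power)
  hence "n + 1 \<le> 6 * n ^ 3 + 3" by simp
  hence "(n + 1)\<^sup>2 \<le> L" unfolding L by (intro power_mono) auto
  thus "n * n + 1 \<le> L" "n \<le> L" "1 \<le> L" by (auto simp: power2_eq_square)
qed

lemma fits_consts: "rat_size 0 \<le> W" "rat_size 1 \<le> W" "rat_size (of_bool b) \<le> W" "rat_size (- 1) \<le> W"
proof -
  show "rat_size 0 \<le> W" "rat_size 1 \<le> W" using fits_count[of 0] fits_count[of 1] L_ge(4) by auto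
  thus "rat_size (of_bool b) \<le> W" by (cases b) auto
  have "1 \<le> (20 * (int n + 1)) * (6 * int n ^ 3 + 3)\<^sup>2"
    using mult_mono[of 1 "20 * (int n + 1)" 1 "(6 * int n ^ 3 + 3)\<^sup>2"] by (simp add: add_increasing)
  thus "rat_size (- 1) \<le> W" using capacity[of "-1"] by simp
qed

lemma fits_index: "k < n \<Longrightarrow> rat_size (of_nat k) \<le> W"
  using fits_count L_ge(3) by simp

text \<open>The limit \<open>e\<close> is evaluated again at every test, hence the premise that it
  equals \<open>m\<close> in every state that the body can lead to.\<close>

lemma wp_For:
  assumes x: "x \<notin> written_vars c" and e: "\<And>s'. same_except (insert x (written_vars c)) (written_arrs c) s s' \<Longrightarrow> aval e s' = of_nat m"
    and m: "m \<le> L" and init: "I 0 (set_var x 0 s)"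
    and step: "\<And>k s'. k < m \<Longrightarrow> I k s' \<Longrightarrow> var s' x = of_nat k \<Longrightarrow>
      same_except (insert x (written_vars c)) (written_arrs c) s s' \<Longrightarrow>
      wp c (\<lambda>s''. I (Suc k) (set_var x (of_nat (Suc k)) s'')) s'"
  shows "wp (For x e c) (I m) s"
  unfolding For_def
proof (rule wp_Seq, rule wp_Assign)
  let ?same = "same_except (insert x (written_vars c)) (written_arrs c) s"
  let ?J = "\<lambda>k s'. I k s' \<and> var s' x = of_nat k \<and> ?same s'"
  show "rat_size (aval (Const 0) s) \<le> W" using fits_consts by simp
  let ?body = "Seq c (Assign x (Plus (Var x) (Const 1)))"
  have "wp (While (Less (Var x) e) ?body) (?J m) (set_var x (aval (Const 0) s) s)"
  proof (rule wp_While[OF m])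
    show "?J 0 (set_var x (aval (Const 0) s) s)" using init by (auto simp: same_except_def)
    fix k s' assume k: "k < m" and J: "?J k s'"
    have "bval (Less (Var x) e) s'" using J k e by simp
    moreover have "wp ?body (?J (Suc k)) s'"
    proof (rule wp_Seq, rule wp_use[OF step[OF k]])
      fix s'' assume s'': "I (Suc k) (set_var x (of_nat (Suc k)) s'')"
        "same_except (written_vars c) (written_arrs c) s' s''"
      have "var s'' x = of_nat k" using same_exceptD(1)[OF s''(2) x] J by simp
      hence *: "aval (Plus (Var x) (Const 1)) s'' = of_nat (Suc k)" by simp
      show "wp (Assign x (Plus (Var x) (Const 1))) (?J (Suc k)) s''"
      proof (rule wp_Assign)
        show "rat_size (aval (Plus (Var x) (Const 1)) s'') \<le> W"
          unfolding * using fits_count[of "Suc k"] k m by simp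
        show "?J (Suc k) (set_var x (aval (Plus (Var x) (Const 1)) s'') s'')"
          unfolding * using s'' J by (auto simp: same_except_def)
      qed
    qed (use J in auto)
    ultimately show "bval (Less (Var x) e) s' \<and> wp ?body (?J (Suc k)) s'" by blast
  qed (use e in auto)
  thus "wp (While (Less (Var x) e) ?body) (I m) (set_var x (aval (Const 0) s) s)"
    by (rule wp_use) blast
qed

end

section \<open>The program\<close>

definition set_flags :: "string \<Rightarrow> bexp \<Rightarrow> com" where
  "set_flags A b = For ''i'' Size (Cond b (Write A (Var ''i'') (Const 1)) (Write A (Var ''i'') (Const 0)))"

definition set_relation :: "bexp \<Rightarrow> com" where
  "set_relation b = For ''a'' Size (For ''b'' Size
     (Cond b (Write ''R'' (Plus (Times (Var ''a'') Size) (Var ''b'')) (Const 1))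
             (Write ''R'' (Plus (Times (Var ''a'') Size) (Var ''b'')) (Const 0))))"

abbreviation (input) Never :: bexp where "Never \<equiv> Less (Const 0) (Const 0)"

definition close :: com where
  "close = Seq (set_flags ''C'' Never)
     (For ''a'' Size (For ''b'' Size
       (Cond (Conj (In (Var ''a'') ''Z'') (Related (Var ''a'') (Var ''b''))) (Write ''C'' (Var ''b'') (Const 1)) Skip)))"

definition count_difference :: com where
  "count_difference = Seq (Assign ''c'' (Const 0)) (For ''i'' Size
     (Seq (Cond (In (Var ''i'') ''C'') (Assign ''c'' (Plus (Var ''c'') (Const 1))) Skip)
          (Cond (In (Var ''i'') ''Z'') (Assign ''c'' (Minus (Var ''c'') (Const 1))) Skip)))"

definition eval_ext :: "string \<Rightarrow> com" where
  "eval_ext x = Seq close (Seq count_difference (Seq (Query_Value ''v'' ''C'')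
     (Assign x (Plus (Var ''v'') (Times (Times (Const 3) (Var ''h'')) (Var ''c''))))))"

lemma written_set_flags [simp]: "written_vars (set_flags A b) = {''i''}" "written_arrs (set_flags A b) = {A}"
  by (simp_all add: set_flags_def)

lemma written_set_relation [simp]:
  "written_vars (set_relation b) = {''a'', ''b''}" "written_arrs (set_relation b) = {''R''}"
  by (simp_all add: set_relation_def)

lemma written_close [simp]: "written_vars close = {''i'', ''a'', ''b''}" "written_arrs close = {''C''}"
  by (auto simp: close_def)

lemma written_count_difference [simp]:
  "written_vars count_difference = {''i'', ''c''}" "written_arrs count_difference = {}"
  by (auto simp: count_difference_def)

lemma written_eval_ext [simp]:
  "written_vars (eval_ext x) = {''i'', ''a'', ''b'', ''c'', ''v'', x}" "written_arrs (eval_ext x) = {''C''}"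
  by (auto simp: eval_ext_def)

lemma relation_set_arr:
  assumes "a < n" "b < n"
  shows "relation n (set_arr ''R'' (of_nat (a * n + b)) r s) =
    (if r = 0 then relation n s - {(a, b)} else insert (a, b) (relation n s))"
  using assms row_major_inj[of _ n b _ a] unfolding relation_def
  by (auto simp del: of_nat_add of_nat_mult)

context oracle_machine
begin

lemma wp_set_flags:
  assumes n: "var s ''n'' = of_nat n" and S: "S \<subseteq> {..<n}"
    and b: "\<And>k s'. k < n \<Longrightarrow> same_except {''i''} {A} s s' \<Longrightarrow> var s' ''i'' = of_nat k \<Longrightarrow> bval b s' \<longleftrightarrow> k \<in> S"
  shows "wp (set_flags A b) (\<lambda>s'. flagged n A s' = S) s"
proof -
  have "wp (set_flags A b) (\<lambda>s'. \<forall>i<n. arr s' A (of_nat i) \<noteq> 0 \<longleftrightarrow> i \<in> S) s"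
    unfolding set_flags_def
  proof (rule wp_For)
    fix k and s' :: state assume k: "k < n" "\<forall>i<k. arr s' A (of_nat i) \<noteq> 0 \<longleftrightarrow> i \<in> S" "var s' ''i'' = of_nat k"
    assume "same_except (insert ''i'' (written_vars (Cond b (Write A (Var ''i'') (Const 1)) (Write A (Var ''i'') (Const 0)))))
      (written_arrs (Cond b (Write A (Var ''i'') (Const 1)) (Write A (Var ''i'') (Const 0)))) s s'"
    hence b': "bval b s' \<longleftrightarrow> k \<in> S" using k by (intro b) auto
    show "wp (Cond b (Write A (Var ''i'') (Const 1)) (Write A (Var ''i'') (Const 0)))
      (\<lambda>s''. \<forall>i<Suc k. arr (set_var ''i'' (of_nat (Suc k)) s'') A (of_nat i) \<noteq> 0 \<longleftrightarrow> i \<in> S) s'"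
      by (rule wp_Cond; rule wp_Write) (use k b' fits_consts fits_index in \<open>auto simp: less_Suc_eq\<close>)
  qed (use n L_ge(3) in \<open>auto simp: same_except_def\<close>)
  thus ?thesis by (rule wp_use) (use S in \<open>auto simp: flagged_def\<close>)
qed

text \<open>The hypothesis on \<open>b\<close> allows it to read the relation while it is being overwritten.\<close>

lemma wp_set_relation:
  assumes n: "var s ''n'' = of_nat n" and S: "S \<subseteq> {..<n} \<times> {..<n}"
    and b: "\<And>k l D s'. k < n \<Longrightarrow> l < n \<Longrightarrow> same_except {''a'', ''b''} {''R''} s s' \<Longrightarrow>
      var s' ''a'' = of_nat k \<Longrightarrow> var s' ''b'' = of_nat l \<Longrightarrow> (k, l) \<notin> D \<Longrightarrow>
      relation n s' = (S \<inter> D) \<union> (relation n s - D) \<Longrightarrow> bval b s' \<longleftrightarrow> (k, l) \<in> S"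
  shows "wp (set_relation b) (\<lambda>s'. relation n s' = S) s"
proof -
  \<comment> \<open>The pairs that have been overwritten when the loops stand at
    \<open>(k, l)\<close>, in lexicographic order.\<close>
  let ?D = "\<lambda>k l. {(p, q). p < k \<or> (p = k \<and> q < l)}"
  let ?J = "\<lambda>k l s'. relation n s' = (S \<inter> ?D k l) \<union> (relation n s - ?D k l)"
  let ?w = "Cond b (Write ''R'' (Plus (Times (Var ''a'') Size) (Var ''b'')) (Const 1))
             (Write ''R'' (Plus (Times (Var ''a'') Size) (Var ''b'')) (Const 0))"
  have range: "relation n s \<subseteq> {..<n} \<times> {..<n}" by (auto simp: relation_def)
  have "wp (set_relation b) (?J n 0) s"
    unfolding set_relation_def
  proof (rule wp_For[where m = n and I = "\<lambda>k. ?J k 0"])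
    fix k and s' :: state assume k: "k < n" "?J k 0 s'" "var s' ''a'' = of_nat k"
      and "same_except (insert ''a'' (written_vars (For ''b'' Size ?w))) (written_arrs (For ''b'' Size ?w)) s s'"
    hence same: "same_except {''a'', ''b''} {''R''} s s'" by simp
    have n': "var s' ''n'' = of_nat n" using same_exceptD(1)[OF same] n by simp
    have "wp (For ''b'' Size ?w) (?J k n) s'"
    proof (rule wp_For[where m = n and I = "?J k"])
      fix l and s'' :: state assume l: "l < n" "?J k l s''" "var s'' ''b'' = of_nat l"
        and "same_except (insert ''b'' (written_vars ?w)) (written_arrs ?w) s' s''"
      hence same': "same_except {''b''} {''R''} s' s''" by simp
      have "same_except {''a'', ''b''} {''R''} s s''"
        by (rule same_except_mono[OF same_except_trans[OF same same']]) auto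
      moreover have st: "var s'' ''a'' = of_nat k" "var s'' ''n'' = of_nat n"
        using same_exceptD(1)[OF same'] k n' by auto
      ultimately have b': "bval b s'' \<longleftrightarrow> (k, l) \<in> S"
        by (intro b[where D = "?D k l"]) (use k l in auto)
      have "Suc k * n \<le> n * n" using k(1) by (intro mult_le_mono1) simp
      hence "k * n + l < n * n" using l(1) by simp
      hence fit: "rat_size (of_nat (k * n + l)) \<le> W" using L_ge(2) by (intro fits_count) simp
      have D: "?D k (Suc l) = insert (k, l) (?D k l)" by auto
      show "wp ?w (\<lambda>s. ?J k (Suc l) (set_var ''b'' (of_nat (Suc l)) s)) s''"
        by (rule wp_Cond; rule wp_Write)
          (use fit fits_consts b' l st relation_set_arr[OF k(1) l(1), simplified] in \<open>auto simp: D\<close>)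
    qed (use n' L_ge(3) k in \<open>auto simp: same_except_def\<close>)
    thus "wp (For ''b'' Size ?w) (\<lambda>s. ?J (Suc k) 0 (set_var ''a'' (of_nat (Suc k)) s)) s'"
    proof (rule wp_use)
      fix s'' assume "?J k n s''"
      moreover have "S \<inter> ?D k n = S \<inter> ?D (Suc k) 0" "relation n s - ?D k n = relation n s - ?D (Suc k) 0"
        using S range by auto
      ultimately show "?J (Suc k) 0 (set_var ''a'' (of_nat (Suc k)) s'')" by simp
    qed
  qed (use n L_ge(3) in \<open>auto simp: same_except_def\<close>)
  thus ?thesis
  proof (rule wp_use)
    fix s' assume "?J n 0 s'"
    moreover have "S \<inter> ?D n 0 = S" "relation n s - ?D n 0 = {}" using S range by auto
    ultimately show "relation n s' = S" by (simp only: Un_empty_right)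
  qed
qed

lemma wp_close:
  assumes n: "var s ''n'' = of_nat n"
  shows "wp close (\<lambda>s'. flagged n ''C'' s' = relation n s `` flagged n ''Z'' s) s"
  unfolding close_def
proof (rule wp_Seq, rule wp_use[OF wp_set_flags[where S = "{}"]])
  let ?R = "relation n s" and ?Z = "flagged n ''Z'' s"
  let ?J = "\<lambda>k l s'. flagged n ''C'' s' = {q. \<exists>p\<in>?Z. (p, q) \<in> ?R \<and> (p < k \<or> (p = k \<and> q < l))}"
  let ?w = "Cond (Conj (In (Var ''a'') ''Z'') (Related (Var ''a'') (Var ''b''))) (Write ''C'' (Var ''b'') (Const 1)) Skip"
  fix s0 assume s0: "flagged n ''C'' s0 = {}"
    "same_except (written_vars (set_flags ''C'' Never)) (written_arrs (set_flags ''C'' Never)) s s0"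
  have same0: "same_except {''i''} {''C''} s s0" using s0(2) by simp
  have n0: "var s0 ''n'' = of_nat n" using same_exceptD(1)[OF same0] n by simp
  have "wp (For ''a'' Size (For ''b'' Size ?w)) (?J n 0) s0"
  proof (rule wp_For[where m = n and I = "\<lambda>k. ?J k 0"])
    fix k and s' :: state assume k: "k < n" "?J k 0 s'" "var s' ''a'' = of_nat k"
      and "same_except (insert ''a'' (written_vars (For ''b'' Size ?w))) (written_arrs (For ''b'' Size ?w)) s0 s'"
    hence "same_except {''a'', ''b''} {''C''} s0 s'" by simp
    from same_except_trans[OF same0 this] have same: "same_except {''i'', ''a'', ''b''} {''C''} s s'"
      by (rule same_except_mono) auto
    have n': "var s' ''n'' = of_nat n" using same_exceptD(1)[OF same] n by simp
    have "wp (For ''b'' Size ?w) (?J k n) s'"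
    proof (rule wp_For[where m = n and I = "?J k"])
      fix l and s'' :: state assume l: "l < n" "?J k l s''" "var s'' ''b'' = of_nat l"
        and "same_except (insert ''b'' (written_vars ?w)) (written_arrs ?w) s' s''"
      hence same': "same_except {''b''} {''C''} s' s''" by simp
      from same_except_trans[OF same same'] have "same_except {''i'', ''a'', ''b''} {''C''} s s''"
        by (rule same_except_mono) auto
      hence RZ: "relation n s'' = ?R" "flagged n ''Z'' s'' = ?Z" by (simp_all add: relation_same flagged_same)
      have st: "var s'' ''a'' = of_nat k" "var s'' ''n'' = of_nat n"
        using same_exceptD(1)[OF same'] k n' by auto
      have b: "bval (Conj (In (Var ''a'') ''Z'') (Related (Var ''a'') (Var ''b''))) s'' \<longleftrightarrow> k \<in> ?Z \<and> (k, l) \<in> ?R"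
        using bval_In[of "Var ''a''" s'' k n "''Z''"] bval_Related[of s'' n "Var ''a''" k "Var ''b''" l] st k l RZ
        by simp
      have set: "flagged n ''C'' (set_arr ''C'' (of_nat l) 1 s'') = insert l (flagged n ''C'' s'')"
        using l(1) by (auto simp: flagged_def)
      show "wp ?w (\<lambda>s. ?J k (Suc l) (set_var ''b'' (of_nat (Suc l)) s)) s''"
      proof (rule wp_Cond)
        assume "bval (Conj (In (Var ''a'') ''Z'') (Related (Var ''a'') (Var ''b''))) s''"
        thus "wp (Write ''C'' (Var ''b'') (Const 1)) (\<lambda>s. ?J k (Suc l) (set_var ''b'' (of_nat (Suc l)) s)) s''"
          using l fits_index fits_consts b by (intro wp_Write) (auto simp: set less_Suc_eq)
      next
        assume "\<not> bval (Conj (In (Var ''a'') ''Z'') (Related (Var ''a'') (Var ''b''))) s''"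
        thus "wp Skip (\<lambda>s. ?J k (Suc l) (set_var ''b'' (of_nat (Suc l)) s)) s''"
          using l b by (intro wp_Skip) (auto simp: less_Suc_eq)
      qed
    qed (use n' L_ge(3) k in \<open>auto simp: same_except_def\<close>)
    thus "wp (For ''b'' Size ?w) (\<lambda>s. ?J (Suc k) 0 (set_var ''a'' (of_nat (Suc k)) s)) s'"
      by (rule wp_use) (auto simp: less_Suc_eq relation_def)
  qed (use n0 s0 L_ge(3) in \<open>auto simp: same_except_def\<close>)
  thus "wp (For ''a'' Size (For ''b'' Size ?w)) (\<lambda>s'. flagged n ''C'' s' = ?R `` ?Z) s0"
    by (rule wp_use) (auto simp: relation_def)
qed (use n in auto)

lemma wp_count_difference:
  assumes n: "var s ''n'' = of_nat n"
  shows "wp count_difference (\<lambda>s'. var s' ''c'' = of_int (int (card (flagged n ''C'' s)) - int (card (flagged n ''Z'' s)))) s"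
  unfolding count_difference_def
proof (rule wp_Seq, rule wp_Assign)
  let ?cnt = "\<lambda>k A. int (card (flagged n A s \<inter> {..<k}))"
  let ?s0 = "set_var ''c'' (aval (Const 0) s) s"
  let ?w = "Seq (Cond (In (Var ''i'') ''C'') (Assign ''c'' (Plus (Var ''c'') (Const 1))) Skip)
          (Cond (In (Var ''i'') ''Z'') (Assign ''c'' (Minus (Var ''c'') (Const 1))) Skip)"
  have cnt_le: "?cnt k A \<le> n" for k A
    using card_mono[of "{..<n}" "flagged n A s \<inter> {..<k}"] flagged_subset[of n A s] by auto
  have fit: "rat_size (of_int z) \<le> W" if "\<bar>z\<bar> \<le> int n + 1" for z
  proof (rule capacity)
    have "(int n + 1) * 1 \<le> 20 * (int n + 1) * (6 * int n ^ 3 + 3)\<^sup>2"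
      by (intro mult_mono) (auto simp: power2_eq_square intro: order_trans[OF _ mult_mono[of 1 _ 1]])
    thus "\<bar>z\<bar> \<le> 20 * (int n + 1) * (6 * int n ^ 3 + 3)\<^sup>2" using that by simp
  qed
  have "wp (For ''i'' Size ?w) (\<lambda>s'. var s' ''c'' = of_int (?cnt n ''C'' - ?cnt n ''Z'')) ?s0"
  proof (rule wp_For[where I = "\<lambda>k s'. var s' ''c'' = of_int (?cnt k ''C'' - ?cnt k ''Z'')"])
    fix k and s' :: state assume k: "k < n" "var s' ''c'' = of_int (?cnt k ''C'' - ?cnt k ''Z'')" "var s' ''i'' = of_nat k"
      and "same_except (insert ''i'' (written_vars ?w)) (written_arrs ?w) ?s0 s'"
    hence same: "same_except {''i'', ''c''} {} ?s0 s'" by simp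
    have fl: "flagged n A s' = flagged n A s" for A using flagged_same[OF same] by simp
    have suc: "?cnt (Suc k) A = ?cnt k A + of_bool (k \<in> flagged n A s)" for A
    proof -
      have "flagged n A s \<inter> {..<Suc k} = (if k \<in> flagged n A s then insert k (flagged n A s \<inter> {..<k}) else flagged n A s \<inter> {..<k})"
        by (auto simp: less_Suc_eq)
      thus ?thesis by simp
    qed
    have In: "bval (In (Var ''i'') A) s'' \<longleftrightarrow> k \<in> flagged n A s" if "var s'' ''i'' = of_nat k" "arr s'' = arr s'" for A s''
    proof -
      have "flagged n A s'' = flagged n A s'" using that(2) by (simp add: flagged_def)
      thus ?thesis using bval_In[where e = "Var ''i''" and s = s'' and k = k and n = n and a = A] that(1) k(1) fl[of A] by simp
    qed
    have le: "\<bar>?cnt k ''C'' - ?cnt k ''Z'' + 1\<bar> \<le> int n + 1" "\<bar>?cnt k ''C'' - ?cnt k ''Z'' - 1\<bar> \<le> int n + 1"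
      "\<bar>?cnt k ''C'' - ?cnt k ''Z''\<bar> \<le> int n + 1"
      using cnt_le[where k = k and A = "''C''"] cnt_le[where k = k and A = "''Z''"] by auto
    note f = fit[OF le(1)] fit[OF le(2)] fit[OF le(3)]
    let ?Q = "\<lambda>s''. var (set_var ''i'' (of_nat (Suc k)) s'') ''c'' = of_int (?cnt (Suc k) ''C'' - ?cnt (Suc k) ''Z'')"
    let ?c2 = "Cond (In (Var ''i'') ''Z'') (Assign ''c'' (Minus (Var ''c'') (Const 1))) Skip"
    show "wp ?w ?Q s'"
    proof (rule wp_Seq, rule wp_Cond)
      assume C: "bval (In (Var ''i'') ''C'') s'"
      show "wp (Assign ''c'' (Plus (Var ''c'') (Const 1))) (wp ?c2 ?Q) s'"
      proof (rule wp_Assign, use k f in simp, rule wp_Cond)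
        let ?s'' = "set_var ''c'' (aval (Plus (Var ''c'') (Const 1)) s') s'"
        show "wp (Assign ''c'' (Minus (Var ''c'') (Const 1))) ?Q ?s''" if "bval (In (Var ''i'') ''Z'') ?s''"
          using C that In[where A = "''C''" and s'' = s'] In[where A = "''Z''" and s'' = ?s''] k f by (intro wp_Assign) (auto simp: suc simp del: of_nat_Suc)
        show "wp Skip ?Q ?s''" if "\<not> bval (In (Var ''i'') ''Z'') ?s''"
          using C that In[where A = "''C''" and s'' = s'] In[where A = "''Z''" and s'' = ?s''] k by (intro wp_Skip) (auto simp: suc)
      qed
    next
      assume C: "\<not> bval (In (Var ''i'') ''C'') s'"
      show "wp Skip (wp ?c2 ?Q) s'"
      proof (rule wp_Skip, rule wp_Cond)
        show "wp (Assign ''c'' (Minus (Var ''c'') (Const 1))) ?Q s'" if "bval (In (Var ''i'') ''Z'') s'"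
          using C that In[where A = "''C''" and s'' = s'] In[where A = "''Z''" and s'' = s'] k f by (intro wp_Assign) (auto simp: suc)
        show "wp Skip ?Q s'" if "\<not> bval (In (Var ''i'') ''Z'') s'"
          using C that In[where A = "''C''" and s'' = s'] In[where A = "''Z''" and s'' = s'] k by (intro wp_Skip) (auto simp: suc)
      qed
    qed
  qed (use n L_ge(3) in \<open>auto simp: same_except_def\<close>)
  moreover have "flagged n A s \<inter> {..<n} = flagged n A s" for A using flagged_subset by blast
  ultimately show "wp (For ''i'' Size ?w)
    (\<lambda>s'. var s' ''c'' = of_int (int (card (flagged n ''C'' s)) - int (card (flagged n ''Z'' s)))) ?s0" by simp
qed (use fits_consts in simp)

end

section \<open>Computing greedy vectors and the total of the descent\<close>

definition greedy_step :: com where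
  "greedy_step = For ''w'' Size (Cond (Conj (Neg (In (Var ''w'') ''P'')) (In (Var ''w'') ''Q''))
     (Seq (set_flags ''Z'' (Or (In (Var ''i'') ''P'') (Conj (In (Var ''i'') ''Q'')
            (Or (Less (Read ''p'' (Var ''w'')) (Read ''p'' (Var ''i'')))
                (Conj (Equal (Read ''p'' (Var ''i'')) (Read ''p'' (Var ''w''))) (Neg (Less (Var ''w'') (Var ''i''))))))))
     (Seq (eval_ext ''x'')
     (Seq (Write ''Z'' (Var ''w'') (Const 0))
     (Seq (eval_ext ''y'')
          (Write ''Y'' (Var ''w'') (Minus (Var ''x'') (Var ''y'')))))))
     (Write ''Y'' (Var ''w'') (Const 0)))"

definition descent_update :: com where
  "descent_update = For ''w'' Size
     (Seq (Write ''S'' (Var ''w'') (Plus (Read ''S'' (Var ''w'')) (Read ''Y'' (Var ''w''))))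
     (Seq (Assign ''x'' (Minus (Read ''p'' (Var ''w'')) (Read ''Y'' (Var ''w''))))
     (Seq (Cond (Less (Var ''x'') (Const 0)) (Assign ''x'' (Const 0)) Skip)
     (Seq (Cond (Less (Var ''B'') (Var ''x'')) (Assign ''x'' (Var ''B'')) Skip)
          (Write ''p'' (Var ''w'') (Var ''x''))))))"

text \<open>The side stored in \<open>''B''\<close> is \<open>M * N\<close> for the bound
  \<open>M = 6 * n * h\<close> on the marginal values of the extension.\<close>

definition run_descent :: com where
  "run_descent = Seq (set_flags ''p'' Never) (Seq (set_flags ''S'' Never)
     (Seq (Assign ''B'' (Times (Times (Times (Const 6) Size) (Var ''h'')) (Var ''N'')))
          (For ''k'' (Times (Var ''N'') (Var ''N'')) (Seq greedy_step descent_update))))"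

text \<open>The sign \<sigma> is kept in \<open>''g''\<close>, so one search finds the largest or
  the smallest coordinate as required.\<close>

definition find_extreme :: com where
  "find_extreme = Seq (Assign ''m'' (Const 0)) (For ''w'' Size
     (Cond (Less (Times (Var ''g'') (Read ''S'' (Var ''m''))) (Times (Var ''g'') (Read ''S'' (Var ''w''))))
        (Assign ''m'' (Var ''w'')) Skip))"

lemma written_greedy_step [simp]:
  "written_vars greedy_step = {''w'', ''i'', ''a'', ''b'', ''c'', ''v'', ''x'', ''y''}"
  "written_arrs greedy_step = {''Z'', ''C'', ''Y''}"
  by (auto simp: greedy_step_def)

lemma written_descent_update [simp]:
  "written_vars descent_update = {''w'', ''x''}" "written_arrs descent_update = {''S'', ''p''}"
  by (auto simp: descent_update_def)

lemma written_run_descent [simp]: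
  "written_vars run_descent = {''i'', ''B'', ''k'', ''w'', ''a'', ''b'', ''c'', ''v'', ''x'', ''y''}"
  "written_arrs run_descent = {''p'', ''S'', ''Z'', ''C'', ''Y''}"
  by (auto simp: run_descent_def)

lemma written_find_extreme [simp]:
  "written_vars find_extreme = {''m'', ''w''}" "written_arrs find_extreme = {}"
  by (auto simp: find_extreme_def)

definition int_array :: "nat \<Rightarrow> string \<Rightarrow> state \<Rightarrow> (nat \<Rightarrow> int) \<Rightarrow> bool" where
  "int_array n a s f \<longleftrightarrow> (\<forall>k<n. arr s a (of_nat k) = of_int (f k))"

lemma int_array_same: "same_except X A s s' \<Longrightarrow> a \<notin> A \<Longrightarrow> int_array n a s' f \<longleftrightarrow> int_array n a s f"
  by (simp add: int_array_def same_except_def)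

lemma int_array_zero: "flagged n a s = {} \<longleftrightarrow> int_array n a s (\<lambda>_. 0)"
  by (auto simp: int_array_def flagged_def)

context oracle_machine
begin

text \<open>Numbers in the descent are measured in units of \<open>12 * (n + 1) * F\<close>, the
  bound on one greedy coordinate; \<open>j\<close> is the number of units.\<close>

lemma fits_multiple:
  fixes z j :: int
  assumes "\<bar>z\<bar> \<le> 12 * ((int n + 1) * F) * j" "0 \<le> j" "j \<le> (6 * int n ^ 3 + 3)\<^sup>2"
  shows "rat_size (of_int z) \<le> W"
proof (rule fits)
  have "12 * ((int n + 1) * F) * j \<le> 20 * ((int n + 1) * (F + 1)) * (6 * int n ^ 3 + 3)\<^sup>2"
    using assms F_nonneg by (intro mult_mono) auto
  also have "\<dots> = 20 * (int n + 1) * (6 * int n ^ 3 + 3)\<^sup>2 * (F + 1)" by (simp only: mult_ac)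
  finally show "\<bar>z\<bar> \<le> 20 * (int n + 1) * (6 * int n ^ 3 + 3)\<^sup>2 * (F + 1)" using assms by linarith
qed

lemma one_le_square: "1 \<le> (6 * int n ^ 3 + 3)\<^sup>2"
  using power_mono[of 1 "6 * int n ^ 3 + 3" 2] by simp

lemma F_le: "F \<le> (int n + 1) * F"
  using F_nonneg by (simp add: algebra_simps)

lemma fits_small: "\<bar>z\<bar> \<le> 12 * ((int n + 1) * F) \<Longrightarrow> rat_size (of_int z) \<le> W"
  by (rule fits_multiple[of z 1]) (use one_le_square in auto)

lemma fits_val: "X \<subseteq> {..<n} \<Longrightarrow> rat_size (of_int (val X)) \<le> W"
  using val_bound[of X] F_le F_nonneg by (intro fits_small) auto

text \<open>As a difference of two oracle values, \<open>h\<close> is at most \<open>2 * F\<close>;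
  the penalty is then at most \<open>6 * n * F\<close>, and \<open>f\<close> itself adds
  \<open>F\<close>.\<close>

lemma closure_ext_bound:
  assumes "R \<subseteq> {..<n} \<times> {..<n}" "Z \<subseteq> {..<n}" "0 \<le> h" "h \<le> 2 * F"
  shows "\<bar>closure_ext val R (3 * h) Z\<bar> \<le> 6 * ((int n + 1) * F)"
proof -
  have "R `` Z \<subseteq> {..<n}" using assms(1) by auto
  hence 1: "card (R `` Z) \<le> n" "card Z \<le> n" "\<bar>val (R `` Z)\<bar> \<le> F"
    using card_mono[of "{..<n}" "R `` Z"] card_mono[of "{..<n}" Z] assms(2) val_bound by auto
  let ?d = "int (card (R `` Z)) - int (card Z)"
  have "\<bar>3 * h * ?d\<bar> = 3 * h * \<bar>?d\<bar>" using assms(3) by (simp add: abs_mult)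
  also have "\<dots> \<le> (6 * F) * int n" using 1 assms(3,4) F_nonneg by (intro mult_mono[of "3 * h" "6 * F"]) auto
  finally show ?thesis using 1(3) F_nonneg unfolding closure_ext_def by (simp add: algebra_simps)
qed

lemma relation_subset: "relation n s \<subseteq> {..<n} \<times> {..<n}"
  by (auto simp: relation_def)

lemma wp_eval_ext:
  assumes n: "var s ''n'' = of_nat n" and h: "var s ''h'' = of_int h" "0 \<le> h" "h \<le> 2 * F"
  shows "wp (eval_ext x) (\<lambda>s'. var s' x = of_int (closure_ext val (relation n s) (3 * h) (flagged n ''Z'' s))) s"
  unfolding eval_ext_def
proof (rule wp_Seq, rule wp_use[OF wp_close[OF n]])
  let ?R = "relation n s" and ?Z = "flagged n ''Z'' s"
  let ?e = "Plus (Var ''v'') (Times (Times (Const 3) (Var ''h'')) (Var ''c''))"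
  let ?Post = "\<lambda>s'. var s' x = of_int (closure_ext val (relation n s) (3 * h) (flagged n ''Z'' s))"
  fix s1 assume s1: "flagged n ''C'' s1 = ?R `` ?Z" "same_except (written_vars close) (written_arrs close) s s1"
  have Z1: "flagged n ''Z'' s1 = ?Z" and nh1: "var s1 ''n'' = of_nat n" "var s1 ''h'' = of_int h"
    using flagged_same[OF s1(2)] same_exceptD(1)[OF s1(2)] n h by simp_all
  show "wp (Seq count_difference (Seq (Query_Value ''v'' ''C'') (Assign x ?e))) ?Post s1"
  proof (rule wp_Seq, rule wp_use[OF wp_count_difference[OF nh1(1)]])
    fix s2 assume s2: "var s2 ''c'' = of_int (int (card (flagged n ''C'' s1)) - int (card (flagged n ''Z'' s1)))"
      "same_except (written_vars count_difference) (written_arrs count_difference) s1 s2"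
    have C2: "flagged n ''C'' s2 = ?R `` ?Z" and h2: "var s2 ''h'' = of_int h"
      using flagged_same[OF s2(2)] same_exceptD(1)[OF s2(2)] s1 nh1 by simp_all
    have "?R `` ?Z \<subseteq> {..<n}" using relation_subset by auto
    show "wp (Seq (Query_Value ''v'' ''C'') (Assign x ?e)) ?Post s2"
    proof (rule wp_Seq, rule wp_Query_Value)
      show "rat_size (of_int (val (flagged n ''C'' s2))) \<le> W" using fits_val flagged_subset by blast
      let ?s3 = "set_var ''v'' (of_int (val (flagged n ''C'' s2))) s2"
      have e: "aval ?e ?s3 = of_int (closure_ext val ?R (3 * h) ?Z)"
        using h2 s2(1) by (simp add: C2 s1(1) Z1 closure_ext_def)
      have "rat_size (of_int (closure_ext val ?R (3 * h) ?Z)) \<le> W"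
        using closure_ext_bound[OF relation_subset flagged_subset h(2,3), of s "''Z''" s] F_le F_nonneg
        by (intro fits_small) linarith
      thus "wp (Assign x ?e) ?Post ?s3" by (intro wp_Assign) (simp_all only: e, simp)
    qed
  qed
qed

abbreviation interval_ext :: "state \<Rightarrow> int \<Rightarrow> nat set \<Rightarrow> int" where
  "interval_ext s h X \<equiv> closure_ext val (relation n s) (3 * h) (flagged n ''P'' s \<union> X)"

abbreviation ground :: "state \<Rightarrow> nat set" where
  "ground s \<equiv> flagged n ''Q'' s - flagged n ''P'' s"

lemma greedy_bound:
  assumes "0 \<le> h" "h \<le> 2 * F"
  shows "\<bar>greedy (ground s) (interval_ext s h) p w\<bar> \<le> 12 * ((int n + 1) * F)"
proof (rule greedy_abs_le)
  fix X w assume "X \<subseteq> ground s" "w \<in> ground s - X"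
  hence "flagged n ''P'' s \<union> X \<subseteq> {..<n}" "flagged n ''P'' s \<union> insert w X \<subseteq> {..<n}"
    using flagged_subset by blast+
  thus "\<bar>interval_ext s h (insert w X) - interval_ext s h X\<bar> \<le> 12 * ((int n + 1) * F)"
    using closure_ext_bound[OF relation_subset _ assms] by (smt (verit))
qed (use F_nonneg in simp)

lemma wp_greedy_step:
  assumes n: "var s ''n'' = of_nat n" and h: "var s ''h'' = of_int h" "0 \<le> h" "h \<le> 2 * F"
    and p: "int_array n ''p'' s p"
  shows "wp greedy_step (\<lambda>s'. int_array n ''Y'' s' (greedy (ground s) (interval_ext s h) p)) s"
  unfolding greedy_step_def int_array_def
proof (rule wp_For[where m = n and I = "\<lambda>k s'. \<forall>i<k. arr s' ''Y'' (of_nat i) = of_int (greedy (ground s) (interval_ext s h) p i)"])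
  let ?y = "greedy (ground s) (interval_ext s h) p" and ?P = "flagged n ''P'' s"
  let ?wv = "{''w'', ''i'', ''a'', ''b'', ''c'', ''v'', ''x'', ''y''}" and ?wa = "{''Z'', ''C'', ''Y''}"
  fix k and s' :: state
  assume k: "k < n" "\<forall>i<k. arr s' ''Y'' (of_nat i) = of_int (?y i)" "var s' ''w'' = of_nat k"
  let ?c2 = "Write ''Y'' (Var ''w'') (Minus (Var ''x'') (Var ''y''))"
  let ?b = "Or (In (Var ''i'') ''P'') (Conj (In (Var ''i'') ''Q'')
            (Or (Less (Read ''p'' (Var ''w'')) (Read ''p'' (Var ''i'')))
                (Conj (Equal (Read ''p'' (Var ''i'')) (Read ''p'' (Var ''w''))) (Neg (Less (Var ''w'') (Var ''i''))))))"
  let ?c1 = "Seq (set_flags ''Z'' ?b) (Seq (eval_ext ''x'') (Seq (Write ''Z'' (Var ''w'') (Const 0)) (Seq (eval_ext ''y'') ?c2)))"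
  let ?c = "Cond (Conj (Neg (In (Var ''w'') ''P'')) (In (Var ''w'') ''Q'')) ?c1 (Write ''Y'' (Var ''w'') (Const 0))"
  let ?Post = "\<lambda>s'. \<forall>i<Suc k. arr (set_var ''w'' (of_nat (Suc k)) s') ''Y'' (of_nat i) = of_int (?y i)"
  assume "same_except (insert ''w'' (written_vars ?c)) (written_arrs ?c) s s'"
  hence same: "same_except ?wv ?wa s s'" by (rule same_except_mono) auto
  have st: "var s' ''n'' = of_nat n" "var s' ''h'' = of_int h" "flagged n ''P'' s' = ?P"
    "flagged n ''Q'' s' = flagged n ''Q'' s" "relation n s' = relation n s" "int_array n ''p'' s' p"
    using same_exceptD(1)[OF same] flagged_same[OF same] relation_same[OF same] int_array_same[OF same] n h p
    by simp_all
  have b: "bval (Conj (Neg (In (Var ''w'') ''P'')) (In (Var ''w'') ''Q'')) s' \<longleftrightarrow> k \<in> ground s"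
    using k(1,3) st bval_In[where e = "Var ''w''" and s = s' and k = k and n = n] by auto
  show "wp ?c ?Post s'"
  proof (rule wp_Cond)
    assume "\<not> bval (Conj (Neg (In (Var ''w'') ''P'')) (In (Var ''w'') ''Q'')) s'"
    hence "k \<notin> ground s" using b by blast
    hence "?y k = 0" unfolding greedy_def by (rule if_not_P)
    thus "wp (Write ''Y'' (Var ''w'') (Const 0)) ?Post s'"
      using k fits_index fits_consts by (intro wp_Write) (auto simp: less_Suc_eq)
  next
    assume "bval (Conj (Neg (In (Var ''w'') ''P'')) (In (Var ''w'') ''Q'')) s'"
    hence kW: "k \<in> ground s" using b by simp
    let ?U = "upper_part (ground s) p k"
    have flags: "wp (set_flags ''Z'' ?b) (\<lambda>s1. flagged n ''Z'' s1 = ?P \<union> ?U) s'"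
    proof (rule wp_set_flags[OF st(1)])
      show "?P \<union> ?U \<subseteq> {..<n}" using flagged_subset by (fastforce simp: upper_part_def)
      fix j and s1 :: state assume j: "j < n" "same_except {''i''} {''Z''} s' s1" "var s1 ''i'' = of_nat j"
      have "int_array n ''p'' s1 p" "var s1 ''w'' = of_nat k" "flagged n ''P'' s1 = ?P"
        "flagged n ''Q'' s1 = flagged n ''Q'' s"
        using int_array_same[OF j(2)] same_exceptD(1)[OF j(2)] flagged_same[OF j(2)] st k by simp_all
      thus "bval ?b s1 \<longleftrightarrow> j \<in> ?P \<union> ?U"
        using j(1,3) k(1) bval_In[where e = "Var ''i''" and s = s1 and k = j and n = n]
        by (auto simp: int_array_def upper_part_def)
    qed
    show "wp ?c1 ?Post s'"
    proof (rule wp_Seq, rule wp_use[OF flags])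
      fix s1 assume s1: "flagged n ''Z'' s1 = ?P \<union> ?U"
        "same_except (written_vars (set_flags ''Z'' ?b)) (written_arrs (set_flags ''Z'' ?b)) s' s1"
      have st1: "var s1 ''n'' = of_nat n" "var s1 ''h'' = of_int h" "relation n s1 = relation n s"
        "var s1 ''w'' = of_nat k" "arr s1 ''Y'' = arr s' ''Y''"
        using same_exceptD[OF s1(2)] relation_same[OF s1(2)] st k by simp_all
      show "wp (Seq (eval_ext ''x'') (Seq (Write ''Z'' (Var ''w'') (Const 0)) (Seq (eval_ext ''y'') ?c2))) ?Post s1"
      proof (rule wp_Seq, rule wp_use[OF wp_eval_ext[OF st1(1,2) h(2,3)]])
        fix s2 assume s2: "var s2 ''x'' = of_int (closure_ext val (relation n s1) (3 * h) (flagged n ''Z'' s1))"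
          "same_except (written_vars (eval_ext ''x'')) (written_arrs (eval_ext ''x'')) s1 s2"
        have st2: "var s2 ''n'' = of_nat n" "var s2 ''h'' = of_int h" "relation n s2 = relation n s"
          "var s2 ''w'' = of_nat k" "arr s2 ''Y'' = arr s' ''Y''" "flagged n ''Z'' s2 = ?P \<union> ?U"
          "var s2 ''x'' = of_int (interval_ext s h ?U)"
          using same_exceptD[OF s2(2)] relation_same[OF s2(2)] flagged_same[OF s2(2)] st1 s1(1) s2(1) by simp_all
        show "wp (Seq (Write ''Z'' (Var ''w'') (Const 0)) (Seq (eval_ext ''y'') ?c2)) ?Post s2"
        proof (rule wp_Seq, rule wp_Write)
          let ?s3 = "set_arr ''Z'' (aval (Var ''w'') s2) (aval (Const 0) s2) s2"
          have "flagged n ''Z'' ?s3 = flagged n ''Z'' s2 - {k}" using st2(4) by (auto simp: flagged_def)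
          \<comment> \<open>The element \<open>k\<close> is not in \<open>P\<close>, so clearing its
            flag removes it from the prefix and leaves \<open>P\<close> intact.\<close>
          hence Z3: "flagged n ''Z'' ?s3 = ?P \<union> (?U - {k})" using st2(6) kW by auto
          have st3: "var ?s3 ''n'' = of_nat n" "var ?s3 ''h'' = of_int h" using st2 by simp_all
          show "wp (Seq (eval_ext ''y'') ?c2) ?Post ?s3"
          proof (rule wp_Seq, rule wp_use[OF wp_eval_ext[OF st3 h(2,3)]])
            fix s4 assume s4: "var s4 ''y'' = of_int (closure_ext val (relation n ?s3) (3 * h) (flagged n ''Z'' ?s3))"
              "same_except (written_vars (eval_ext ''y'')) (written_arrs (eval_ext ''y'')) ?s3 s4"
            have "var s4 ''y'' = of_int (interval_ext s h (?U - {k}))" "var s4 ''x'' = of_int (interval_ext s h ?U)"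
              using same_exceptD(1)[OF s4(2)] s4(1) st2(3,7) Z3 by simp_all
            hence y: "aval (Minus (Var ''x'') (Var ''y'')) s4 = of_int (?y k)" using kW by (simp add: greedy_def)
            have "var s4 ''w'' = of_nat k" "arr s4 ''Y'' = arr s' ''Y''"
              using same_exceptD[OF s4(2)] st2(4,5) by simp_all
            thus "wp ?c2 ?Post s4"
              using k fits_index y fits_small[OF greedy_bound[OF h(2,3)], of s p k]
              by (intro wp_Write) (auto simp: less_Suc_eq)
          qed
        qed (use st2 fits_index[OF k(1)] fits_consts in auto)
      qed
    qed
  qed
qed (use n L_ge(3) in \<open>auto simp: same_except_def\<close>)

lemma wp_descent_update:
  assumes n: "var s ''n'' = of_nat n" and B: "var s ''B'' = of_int B" "0 \<le> B"
    and arrays: "int_array n ''Y'' s y" "int_array n ''S'' s t" "int_array n ''p'' s p"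
    and fit: "\<And>k. k < n \<Longrightarrow> rat_size (of_int (t k + y k)) \<le> W"
      "\<And>k. k < n \<Longrightarrow> rat_size (of_int (p k - y k)) \<le> W" "rat_size (of_int B) \<le> W"
  shows "wp descent_update (\<lambda>s'. int_array n ''S'' s' (\<lambda>k. t k + y k) \<and>
    int_array n ''p'' s' (\<lambda>k. max 0 (min B (p k - y k)))) s"
proof -
  let ?t = "\<lambda>k i. if i < k then t i + y i else t i"
  let ?p = "\<lambda>k i. if i < k then max 0 (min B (p i - y i)) else p i"
  have "wp descent_update (\<lambda>s'. int_array n ''S'' s' (?t n) \<and> int_array n ''p'' s' (?p n)) s"
    unfolding descent_update_def
  proof (rule wp_For[where m = n and I = "\<lambda>k s'. int_array n ''S'' s' (?t k) \<and> int_array n ''p'' s' (?p k)"])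
    fix k and s' :: state
    assume k: "k < n" "int_array n ''S'' s' (?t k) \<and> int_array n ''p'' s' (?p k)" "var s' ''w'' = of_nat k"
    let ?c5 = "Write ''p'' (Var ''w'') (Var ''x'')"
    let ?c4 = "Seq (Cond (Less (Var ''B'') (Var ''x'')) (Assign ''x'' (Var ''B'')) Skip) ?c5"
    let ?c3 = "Seq (Cond (Less (Var ''x'') (Const 0)) (Assign ''x'' (Const 0)) Skip) ?c4"
    let ?c2 = "Seq (Assign ''x'' (Minus (Read ''p'' (Var ''w'')) (Read ''Y'' (Var ''w'')))) ?c3"
    let ?c1 = "Seq (Write ''S'' (Var ''w'') (Plus (Read ''S'' (Var ''w'')) (Read ''Y'' (Var ''w'')))) ?c2"
    assume "same_except (insert ''w'' (written_vars ?c1)) (written_arrs ?c1) s s'"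
    hence same: "same_except {''w'', ''x''} {''S'', ''p''} s s'" by (rule same_except_mono) auto
    have st: "var s' ''B'' = of_int B" "int_array n ''Y'' s' y"
      using same_exceptD(1)[OF same] int_array_same[OF same] B arrays by simp_all
    have vals: "arr s' ''S'' (of_nat k) = of_int (t k)" "arr s' ''p'' (of_nat k) = of_int (p k)"
      "arr s' ''Y'' (of_nat k) = of_int (y k)"
      using k st by (auto simp: int_array_def)
    have less: "(of_int B :: rat) < of_int (p k) - of_int (y k) \<longleftrightarrow> B < p k - y k"
      "(of_int (p k) :: rat) < of_int (y k) \<longleftrightarrow> p k < y k"
      by (metis of_int_diff of_int_less_iff) simp
    note fit' = fits_index[OF k(1)] fits_consts fit(1,2)[OF k(1)] fit(3)
    show "wp ?c1 (\<lambda>s. int_array n ''S'' (set_var ''w'' (of_nat (Suc k)) s) (?t (Suc k)) \<and>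
        int_array n ''p'' (set_var ''w'' (of_nat (Suc k)) s) (?p (Suc k))) s'"
      apply (rule wp_Seq, rule wp_Write)
      subgoal using k(3) fit' by simp
      subgoal using vals fit' k(3) by simp
      apply (rule wp_Seq, rule wp_Assign)
      subgoal using vals fit' k(3) by simp
      apply (rule wp_Seq, rule wp_Cond)
      subgoal
        apply (rule wp_Assign)
        subgoal using fit' by simp
        apply (rule wp_Seq, rule wp_Cond)
        subgoal using B st by simp
        subgoal
          apply (rule wp_Skip, rule wp_Write)
          using k st B fit' vals less by (auto simp: int_array_def less_Suc_eq)
        done
      subgoal
        apply (rule wp_Skip, rule wp_Seq, rule wp_Cond)
        subgoal
          apply (rule wp_Assign)
          subgoal using st fit' by simp
          apply (rule wp_Write)
          using k st B fit' vals less by (auto simp: int_array_def less_Suc_eq)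
        subgoal
          apply (rule wp_Skip, rule wp_Write)
          using k st B fit' vals less by (auto simp: int_array_def less_Suc_eq)
        done
      done
  qed (use n arrays L_ge(3) in \<open>auto simp: same_except_def int_array_def\<close>)
  thus ?thesis by (rule wp_use) (auto simp: int_array_def)
qed

lemma wp_run_descent:
  assumes n: "var s ''n'' = of_nat n" and N: "var s ''N'' = of_nat (6 * n ^ 3 + 1)"
    and h: "var s ''h'' = of_int h" "0 \<le> h" "h \<le> 2 * F"
  shows "wp run_descent (\<lambda>s'. int_array n ''S'' s' (greedy_total (ground s) (interval_ext s h)
    (6 * int n * h * (6 * int n ^ 3 + 1)) ((6 * n ^ 3 + 1)\<^sup>2))) s"
  unfolding run_descent_def
proof (rule wp_Seq, rule wp_use[OF wp_set_flags[OF n, where S = "{}"]])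
  let ?N = "6 * int n ^ 3 + 1" and ?X = "(int n + 1) * F"
  let ?B = "6 * int n * h * ?N"
  let ?p = "descent (ground s) (interval_ext s h) ?B" and ?t = "greedy_total (ground s) (interval_ext s h) ?B"
  let ?wv = "{''i'', ''B'', ''k'', ''w'', ''a'', ''b'', ''c'', ''v'', ''x'', ''y''}"
  let ?wa = "{''p'', ''S'', ''Z'', ''C'', ''Y''}"
  let ?loop = "For ''k'' (Times (Var ''N'') (Var ''N'')) (Seq greedy_step descent_update)"
  let ?c2 = "Seq (Assign ''B'' (Times (Times (Times (Const 6) Size) (Var ''h'')) (Var ''N''))) ?loop"
  let ?Post = "\<lambda>s'. int_array n ''S'' s' (?t ((6 * n ^ 3 + 1)\<^sup>2))"
  have X: "0 \<le> ?X" using F_nonneg by simp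
  have N1: "1 \<le> ?N" by simp
  have y: "\<bar>greedy (ground s) (interval_ext s h) q i\<bar> \<le> 12 * ?X" for q i
    by (rule greedy_bound) (use h in auto)
  have B0: "0 \<le> ?B" using h by simp
  \<comment> \<open>In units of \<open>12 * ?X\<close>, the side \<open>?B\<close> is at most
    \<open>?N\<close>, a coordinate before clipping at most \<open>?N + 1\<close>, and a total of
    \<open>Suc k\<close> greedy coordinates at most \<open>Suc k\<close>.\<close>
  have "6 * int n * h \<le> 6 * int n * (2 * F)" using h by (intro mult_left_mono) auto
  also have "\<dots> \<le> 12 * ?X" using F_nonneg by (simp add: algebra_simps)
  finally have B: "?B \<le> 12 * ?X * ?N" using N1 by (intro mult_right_mono) auto
  have N_sq: "?N + 1 \<le> (6 * int n ^ 3 + 3)\<^sup>2" "?N\<^sup>2 \<le> (6 * int n ^ 3 + 3)\<^sup>2"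
    by (simp_all add: power2_eq_square algebra_simps)
  have fitB: "rat_size (of_int ?B) \<le> W"
    by (rule fits_multiple[of _ ?N]) (use B B0 N1 N_sq in auto)
  have fit_p: "rat_size (of_int (?p k i - greedy (ground s) (interval_ext s h) q i)) \<le> W" for k i q
  proof (rule fits_multiple[of _ "?N + 1"])
    have "12 * ?X * (?N + 1) = 12 * ?X * ?N + 12 * ?X" by (simp only: distrib_left mult_1_right)
    thus "\<bar>?p k i - greedy (ground s) (interval_ext s h) q i\<bar> \<le> 12 * ?X * (?N + 1)"
      using y[of q i] descent_bounds[OF B0, of "ground s" "interval_ext s h" k i] B by linarith
  qed (use N1 N_sq in auto)
  have fit_t: "rat_size (of_int (?t k i + greedy (ground s) (interval_ext s h) (?p k) i)) \<le> W"
    if "k < (6 * n ^ 3 + 1)\<^sup>2" for k i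
  proof (rule fits_multiple[of _ "int (Suc k)"])
    have "\<bar>?t (Suc k) i\<bar> \<le> (\<Sum>j<Suc k. \<bar>greedy (ground s) (interval_ext s h) (?p j) i\<bar>)"
      unfolding greedy_total_def by (rule sum_abs)
    also have "\<dots> \<le> (\<Sum>j<Suc k. 12 * ?X)" by (intro sum_mono y)
    finally show "\<bar>?t k i + greedy (ground s) (interval_ext s h) (?p k) i\<bar> \<le> 12 * ?X * int (Suc k)"
      by (simp add: greedy_total_def mult.commute)
    have "int (Suc k) \<le> int ((6 * n ^ 3 + 1)\<^sup>2)" using that by (subst of_nat_le_iff) simp
    also have "\<dots> = ?N\<^sup>2" by simp
    finally show "int (Suc k) \<le> (6 * int n ^ 3 + 3)\<^sup>2" using N_sq by linarith
  qed simp
  fix s1 assume s1: "flagged n ''p'' s1 = {}"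
    "same_except (written_vars (set_flags ''p'' Never)) (written_arrs (set_flags ''p'' Never)) s s1"
  have n1: "var s1 ''n'' = of_nat n" using same_exceptD(1)[OF s1(2)] n by simp
  show "wp (Seq (set_flags ''S'' Never) ?c2) ?Post s1"
  proof (rule wp_Seq, rule wp_use[OF wp_set_flags[OF n1, where S = "{}"]])
    fix s2 assume s2: "flagged n ''S'' s2 = {}"
      "same_except (written_vars (set_flags ''S'' Never)) (written_arrs (set_flags ''S'' Never)) s1 s2"
    let ?s3 = "set_var ''B'' (of_int ?B) s2"
    have same2: "same_except {''i'', ''B''} {''p'', ''S''} s ?s3"
      using s1(2) s2(2) by (auto simp: same_except_def)
    have st3: "var ?s3 ''n'' = of_nat n" "var ?s3 ''N'' = of_nat (6 * n ^ 3 + 1)" "var ?s3 ''h'' = of_int h"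
      using same_exceptD(1)[OF same2, of "''n''"] same_exceptD(1)[OF same2, of "''N''"]
        same_exceptD(1)[OF same2, of "''h''"] n N h by simp_all
    have eB: "aval (Times (Times (Times (Const 6) Size) (Var ''h'')) (Var ''N'')) s2 = of_int ?B"
      using st3 by simp
    have zero: "int_array n ''p'' ?s3 (\<lambda>_. 0)" "int_array n ''S'' ?s3 (\<lambda>_. 0)"
      using s1 s2 flagged_same[OF s2(2), of "''p''"] unfolding int_array_zero[symmetric] by simp_all
    have "wp ?loop (\<lambda>s'. int_array n ''S'' s' (?t ((6 * n ^ 3 + 1)\<^sup>2)) \<and> int_array n ''p'' s' (?p ((6 * n ^ 3 + 1)\<^sup>2))) ?s3"
    proof (rule wp_For[where m = "(6 * n ^ 3 + 1)\<^sup>2" and I = "\<lambda>k s'. int_array n ''S'' s' (?t k) \<and> int_array n ''p'' s' (?p k)"])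
      fix k and s' :: state
      assume k: "k < (6 * n ^ 3 + 1)\<^sup>2" "int_array n ''S'' s' (?t k) \<and> int_array n ''p'' s' (?p k)"
        and "same_except (insert ''k'' (written_vars (Seq greedy_step descent_update)))
          (written_arrs (Seq greedy_step descent_update)) ?s3 s'"
      hence "same_except (?wv - {''B''}) ?wa ?s3 s'" by (elim same_except_mono) auto
      moreover from this have B': "var s' ''B'' = of_int ?B" by (simp add: same_except_def)
      ultimately have same: "same_except ?wv ?wa s s'"
        using same2 by (auto simp: same_except_def)
      have st: "var s' ''n'' = of_nat n" "var s' ''h'' = of_int h" "flagged n ''P'' s' = flagged n ''P'' s"
        "flagged n ''Q'' s' = flagged n ''Q'' s" "relation n s' = relation n s"
        using same_exceptD(1)[OF same] flagged_same[OF same] relation_same[OF same] n h by simp_all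
      show "wp (Seq greedy_step descent_update)
        (\<lambda>s'. int_array n ''S'' (set_var ''k'' (of_nat (Suc k)) s') (?t (Suc k)) \<and>
              int_array n ''p'' (set_var ''k'' (of_nat (Suc k)) s') (?p (Suc k))) s'"
      proof (rule wp_Seq, rule wp_use[OF wp_greedy_step[OF st(1,2) h(2,3) conjunct2[OF k(2)]]])
        fix s4 assume s4: "int_array n ''Y'' s4 (greedy (ground s') (interval_ext s' h) (?p k))"
          "same_except (written_vars greedy_step) (written_arrs greedy_step) s' s4"
        have "int_array n ''Y'' s4 (greedy (ground s) (interval_ext s h) (?p k))" using s4(1) st by simp
        moreover have "var s4 ''n'' = of_nat n" "var s4 ''B'' = of_int ?B"
          "int_array n ''S'' s4 (?t k)" "int_array n ''p'' s4 (?p k)"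
          using same_exceptD(1)[OF s4(2)] int_array_same[OF s4(2)] st(1) B' k(2) by simp_all
        ultimately have "wp descent_update (\<lambda>s'.
            int_array n ''S'' s' (\<lambda>i. ?t k i + greedy (ground s) (interval_ext s h) (?p k) i) \<and>
            int_array n ''p'' s' (\<lambda>i. max 0 (min ?B (?p k i - greedy (ground s) (interval_ext s h) (?p k) i)))) s4"
          using fitB B0 fit_p fit_t[OF k(1)] by (intro wp_descent_update)
        thus "wp descent_update (\<lambda>s'. int_array n ''S'' (set_var ''k'' (of_nat (Suc k)) s') (?t (Suc k)) \<and>
              int_array n ''p'' (set_var ''k'' (of_nat (Suc k)) s') (?p (Suc k))) s4"
          by (rule wp_use) (auto simp: int_array_def greedy_total_def)
      qed
    next
      show "int_array n ''S'' (set_var ''k'' 0 ?s3) (?t 0) \<and> int_array n ''p'' (set_var ''k'' 0 ?s3) (?p 0)"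
        using zero by (simp add: int_array_def greedy_total_def)
      show "aval (Times (Var ''N'') (Var ''N'')) s' = of_nat ((6 * n ^ 3 + 1)\<^sup>2)"
        if "same_except (insert ''k'' (written_vars (Seq greedy_step descent_update)))
          (written_arrs (Seq greedy_step descent_update)) ?s3 s'" for s'
      proof -
        have "var s' ''N'' = of_nat (6 * n ^ 3 + 1)" using same_exceptD(1)[OF that, of "''N''"] st3(2) by simp
        thus ?thesis by (simp only: aval.simps power2_eq_square of_nat_mult)
      qed
    qed (use L_ge(1) in auto)
    hence "wp ?loop ?Post ?s3" by (rule wp_use) simp
    thus "wp ?c2 ?Post s2" using fitB by (intro wp_Seq wp_Assign) (simp_all only: eB)
  qed auto
qed auto

lemma wp_find_extreme:
  assumes n: "var s ''n'' = of_nat n" "0 < n" and g: "var s ''g'' = of_int \<sigma>" and S: "int_array n ''S'' s y"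
  shows "wp find_extreme (\<lambda>s'. \<exists>w<n. var s' ''m'' = of_nat w \<and> (\<forall>v<n. \<sigma> * y v \<le> \<sigma> * y w)) s"
  unfolding find_extreme_def
proof (rule wp_Seq, rule wp_Assign)
  let ?c = "Cond (Less (Times (Var ''g'') (Read ''S'' (Var ''m''))) (Times (Var ''g'') (Read ''S'' (Var ''w''))))
        (Assign ''m'' (Var ''w'')) Skip"
  let ?s0 = "set_var ''m'' (aval (Const 0) s) s"
  let ?I = "\<lambda>k s'. \<exists>w<n. var s' ''m'' = of_nat w \<and> (\<forall>v<k. \<sigma> * y v \<le> \<sigma> * y w)"
  show "wp (For ''w'' Size ?c) (?I n) ?s0"
  proof (rule wp_For[where m = n and I = ?I])
    fix k and s' :: state
    assume k: "k < n" "?I k s'" "var s' ''w'' = of_nat k"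
      and "same_except (insert ''w'' (written_vars ?c)) (written_arrs ?c) ?s0 s'"
    hence same: "same_except {''w'', ''m''} {} s s'" by (auto simp: same_except_def)
    obtain w where w: "w < n" "var s' ''m'' = of_nat w" "\<forall>v<k. \<sigma> * y v \<le> \<sigma> * y w" using k(2) by blast
    have S': "arr s' ''S'' (of_nat i) = of_int (y i)" if "i < n" for i
      using same_exceptD(2)[OF same] S that by (simp add: int_array_def)
    have "var s' ''g'' = of_int \<sigma>" using same_exceptD(1)[OF same] g by simp
    hence b: "bval (Less (Times (Var ''g'') (Read ''S'' (Var ''m''))) (Times (Var ''g'') (Read ''S'' (Var ''w'')))) s'
        \<longleftrightarrow> \<sigma> * y w < \<sigma> * y k"
      using S'[OF w(1)] S'[OF k(1)] w(2) k(3) by (simp flip: of_int_mult)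
    show "wp ?c (\<lambda>s'. ?I (Suc k) (set_var ''w'' (of_nat (Suc k)) s')) s'"
    proof (rule wp_Cond)
      assume "bval (Less (Times (Var ''g'') (Read ''S'' (Var ''m''))) (Times (Var ''g'') (Read ''S'' (Var ''w'')))) s'"
      hence "\<forall>v<Suc k. \<sigma> * y v \<le> \<sigma> * y k" using b w(3) by (auto simp: less_Suc_eq)
      thus "wp (Assign ''m'' (Var ''w'')) (\<lambda>s'. ?I (Suc k) (set_var ''w'' (of_nat (Suc k)) s')) s'"
        using k fits_index by (intro wp_Assign) auto
    next
      assume "\<not> bval (Less (Times (Var ''g'') (Read ''S'' (Var ''m''))) (Times (Var ''g'') (Read ''S'' (Var ''w'')))) s'"
      hence "\<forall>v<Suc k. \<sigma> * y v \<le> \<sigma> * y w" using b w(3) by (auto simp: less_Suc_eq)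
      thus "wp Skip (\<lambda>s'. ?I (Suc k) (set_var ''w'' (of_nat (Suc k)) s')) s'"
        using w by (intro wp_Skip) auto
    qed
  next
    show "aval Size s' = of_nat n"
      if "same_except (insert ''w'' (written_vars ?c)) (written_arrs ?c) ?s0 s'" for s'
      using same_exceptD(1)[OF that, of "''n''"] n by simp
  qed (use n L_ge(3) in auto)
qed (use fits_consts in simp)

end

section \<open>Selecting the interval with the largest gap and inserting an arc\<close>

definition consider_interval :: "bexp \<Rightarrow> bexp \<Rightarrow> rat \<Rightarrow> aexp \<Rightarrow> com" where
  "consider_interval bP bQ \<sigma> z =
     Seq (set_flags ''D'' bP) (Seq (set_flags ''E'' bQ)
     (Seq (Query_Value ''x'' ''D'') (Seq (Query_Value ''y'' ''E'')
     (Seq (Assign ''x'' (Times (Const \<sigma>) (Minus (Var ''y'') (Var ''x''))))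
     (Cond (Less (Var ''h'') (Var ''x''))
        (Seq (Assign ''h'' (Var ''x'')) (Seq (Assign ''g'' (Const \<sigma>)) (Seq (Assign ''z'' z)
        (Seq (set_flags ''P'' (In (Var ''i'') ''D'')) (set_flags ''Q'' (In (Var ''i'') ''E''))))))
        Skip)))))"

abbreviation (input) Above :: "string \<Rightarrow> bexp" where
  "Above u \<equiv> Or (Related (Var ''r'') (Var ''i'')) (Related (Var u) (Var ''i''))"

abbreviation (input) Avoiding :: "string \<Rightarrow> bexp" where
  "Avoiding u \<equiv> Neg (Or (Related (Var ''i'') (Var ''s'')) (Related (Var ''i'') (Var u)))"

definition consider_element :: com where
  "consider_element =
     Seq (Cond (Neg (Related (Var ''u'') (Var ''s'')))
            (consider_interval (Above ''u'') (Avoiding ''s'') (- 1) (Var ''u'')) Skip)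
    (Seq (Cond (Neg (Related (Var ''r'') (Var ''u'')))
            (consider_interval (Above ''r'') (Avoiding ''u'') 1 (Var ''u'')) Skip)
         (Cond (Conj (Neg (Related (Var ''r'') (Var ''u''))) (Neg (Related (Var ''u'') (Var ''s''))))
            (Seq (consider_interval (Above ''r'') (Conj (Above ''u'') (Avoiding ''u'')) (- 1) (Var ''r''))
                 (consider_interval (Or (Above ''u'') (Avoiding ''u'')) (Avoiding ''s'') 1 (Var ''s'')))
            Skip))"

definition choose_interval :: com where
  "choose_interval = Seq (Assign ''h'' (Const 0)) (For ''u'' Size consider_element)"

definition insert_arc :: com where
  "insert_arc = set_relation (Or (Related (Var ''a'') (Var ''b''))
     (Conj (Related (Var ''a'') (Var ''e'')) (Related (Var ''f'') (Var ''b''))))"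

definition improve :: com where
  "improve = Seq choose_interval (Cond (Less (Const 0) (Var ''h''))
     (Seq run_descent (Seq find_extreme
     (Seq (Cond (Less (Const 0) (Var ''g''))
            (Seq (Assign ''e'' (Var ''m'')) (Assign ''f'' (Var ''z'')))
            (Seq (Assign ''e'' (Var ''z'')) (Assign ''f'' (Var ''m''))))
          insert_arc))) Skip)"

lemma written_consider_interval [simp]:
  "written_vars (consider_interval bP bQ \<sigma> z) = {''i'', ''x'', ''y'', ''h'', ''g'', ''z''}"
  "written_arrs (consider_interval bP bQ \<sigma> z) = {''D'', ''E'', ''P'', ''Q''}"
  by (auto simp: consider_interval_def)

lemma written_consider_element [simp]:
  "written_vars consider_element = {''i'', ''x'', ''y'', ''h'', ''g'', ''z''}"
  "written_arrs consider_element = {''D'', ''E'', ''P'', ''Q''}"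
  by (auto simp: consider_element_def)

lemma written_choose_interval [simp]:
  "written_vars choose_interval = {''i'', ''x'', ''y'', ''h'', ''g'', ''z'', ''u''}"
  "written_arrs choose_interval = {''D'', ''E'', ''P'', ''Q''}"
  by (auto simp: choose_interval_def)

lemma written_insert_arc [simp]:
  "written_vars insert_arc = {''a'', ''b''}" "written_arrs insert_arc = {''R''}"
  by (simp_all add: insert_arc_def)

lemma written_improve [simp]:
  "written_vars improve = {''i'', ''x'', ''y'', ''h'', ''g'', ''z'', ''u'', ''B'', ''k'', ''w'', ''a'', ''b'', ''c'', ''v'', ''m'', ''e'', ''f''}"
  "written_arrs improve = {''D'', ''E'', ''P'', ''Q'', ''p'', ''S'', ''Z'', ''C'', ''Y'', ''R''}"
  by (auto simp: improve_def)

context oracle_machine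
begin

text \<open>The candidates in \<open>C\<close> have been compared and the best one is stored. For
  \<open>h = 0\<close> no witness is kept: a candidate is recorded only if it beats the initial
  value 0, and without a positive gain the search is over anyway.\<close>

definition leading :: "(nat set \<times> nat set \<times> int \<times> nat) set \<Rightarrow> state \<Rightarrow> bool" where
  "leading C s \<longleftrightarrow> (\<exists>h. var s ''h'' = of_int h \<and> 0 \<le> h \<and> h \<le> 2 * F \<and>
     (\<forall>P Q \<sigma> z. (P, Q, \<sigma>, z) \<in> C \<longrightarrow> \<sigma> * (val Q - val P) \<le> h) \<and>
     (h = 0 \<or> (\<exists>\<sigma> z. var s ''g'' = of_int \<sigma> \<and> var s ''z'' = of_nat z \<and>
        (flagged n ''P'' s, flagged n ''Q'' s, \<sigma>, z) \<in> C \<and>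
        \<sigma> * (val (flagged n ''Q'' s) - val (flagged n ''P'' s)) = h)))"

lemma leading_same:
  "same_except X A s s' \<Longrightarrow> X \<inter> {''h'', ''g'', ''z''} = {} \<Longrightarrow> A \<inter> {''P'', ''Q''} = {} \<Longrightarrow> leading C s' \<longleftrightarrow> leading C s"
  using same_exceptD(1)[of X A s s'] flagged_same[of X A s s'] unfolding leading_def by auto

lemma wp_consider_interval:
  assumes n: "var s ''n'' = of_nat n" and lead: "leading C s"
    and P: "P \<subseteq> {..<n}" "\<And>k s'. k < n \<Longrightarrow> same_except {''i''} {''D''} s s' \<Longrightarrow> var s' ''i'' = of_nat k \<Longrightarrow>
      bval bP s' \<longleftrightarrow> k \<in> P"
    and Q: "Q \<subseteq> {..<n}" "\<And>k s'. k < n \<Longrightarrow> same_except {''i''} {''D'', ''E''} s s' \<Longrightarrow> var s' ''i'' = of_nat k \<Longrightarrow>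
      bval bQ s' \<longleftrightarrow> k \<in> Q"
    and z: "\<And>s'. same_except {''i'', ''x'', ''y'', ''h'', ''g''} {''D'', ''E''} s s' \<Longrightarrow> aval e s' = of_nat z" "z < n"
    and \<sigma>: "\<sigma> = 1 \<or> \<sigma> = - 1"
  shows "wp (consider_interval bP bQ (of_int \<sigma>) e) (leading (insert (P, Q, \<sigma>, z) C)) s"
  unfolding consider_interval_def
proof (rule wp_Seq, rule wp_use[OF wp_set_flags[OF n P]])
  let ?post = "leading (insert (P, Q, \<sigma>, z) C)"
  let ?c4 = "Seq (set_flags ''P'' (In (Var ''i'') ''D'')) (set_flags ''Q'' (In (Var ''i'') ''E''))"
  let ?c3 = "Seq (Assign ''h'' (Var ''x'')) (Seq (Assign ''g'' (Const (of_int \<sigma>))) (Seq (Assign ''z'' e) ?c4))"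
  let ?e = "Times (Const (of_int \<sigma>)) (Minus (Var ''y'') (Var ''x''))"
  let ?c2 = "Seq (Assign ''x'' ?e) (Cond (Less (Var ''h'') (Var ''x'')) ?c3 Skip)"
  let ?c1 = "Seq (Query_Value ''x'' ''D'') (Seq (Query_Value ''y'' ''E'') ?c2)"
  let ?gain = "\<sigma> * (val Q - val P)"
  obtain h where h: "var s ''h'' = of_int h" "0 \<le> h" "h \<le> 2 * F"
    "\<And>P Q \<sigma> z. (P, Q, \<sigma>, z) \<in> C \<Longrightarrow> \<sigma> * (val Q - val P) \<le> h"
    "h = 0 \<or> (\<exists>\<sigma> z. var s ''g'' = of_int \<sigma> \<and> var s ''z'' = of_nat z \<and>
        (flagged n ''P'' s, flagged n ''Q'' s, \<sigma>, z) \<in> C \<and>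
        \<sigma> * (val (flagged n ''Q'' s) - val (flagged n ''P'' s)) = h)"
    using lead unfolding leading_def by blast
  have gain: "\<bar>?gain\<bar> \<le> 2 * F" using val_bound[OF P(1)] val_bound[OF Q(1)] \<sigma> by auto
  hence fit: "rat_size (of_int ?gain) \<le> W" using F_le F_nonneg by (intro fits_small) linarith
  fix s1 assume s1: "flagged n ''D'' s1 = P" "same_except (written_vars (set_flags ''D'' bP)) (written_arrs (set_flags ''D'' bP)) s s1"
  have n1: "var s1 ''n'' = of_nat n" using same_exceptD(1)[OF s1(2)] n by simp
  show "wp (Seq (set_flags ''E'' bQ) ?c1) ?post s1"
  proof (rule wp_Seq, rule wp_use[OF wp_set_flags[OF n1 Q(1)]])
    fix k and s' :: state assume k: "k < n" "same_except {''i''} {''E''} s1 s'" "var s' ''i'' = of_nat k"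
    have "same_except {''i''} {''D'', ''E''} s s'" using s1(2) k(2) by (auto simp: same_except_def)
    thus "bval bQ s' \<longleftrightarrow> k \<in> Q" using Q(2) k by blast
  next
    fix s2 assume s2: "flagged n ''E'' s2 = Q" "same_except (written_vars (set_flags ''E'' bQ)) (written_arrs (set_flags ''E'' bQ)) s1 s2"
    have same2: "same_except {''i''} {''D'', ''E''} s s2" using s1(2) s2(2) by (auto simp: same_except_def)
    have D2: "flagged n ''D'' s2 = P" using flagged_same[OF s2(2)] s1(1) by simp
    show "wp ?c1 ?post s2"
    proof (rule wp_Seq, rule wp_Query_Value, simp only: D2, rule fits_val[OF P(1)], rule wp_Seq, rule wp_Query_Value)
      let ?s3 = "set_var ''x'' (of_int (val (flagged n ''D'' s2))) s2"
      show "rat_size (of_int (val (flagged n ''E'' ?s3))) \<le> W" using fits_val[OF flagged_subset] .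
      let ?s4 = "set_var ''y'' (of_int (val (flagged n ''E'' ?s3))) ?s3"
      have e: "aval ?e ?s4 = of_int ?gain" by (simp add: D2 s2(1))
      let ?s5 = "set_var ''x'' (of_int ?gain) ?s4"
      have same5: "same_except {''i'', ''x'', ''y''} {''D'', ''E''} s ?s5" using same2 by (auto simp: same_except_def)
      have st5: "flagged n ''D'' ?s5 = P" "flagged n ''E'' ?s5 = Q" "var ?s5 ''h'' = of_int h"
        using D2 s2(1) same_exceptD(1)[OF same5, of "''h''"] h(1) by simp_all
      show "wp ?c2 ?post ?s4"
      proof (rule wp_Seq, rule wp_Assign; (simp only: e)?)
        show "rat_size (of_int ?gain) \<le> W" by (rule fit)
        show "wp (Cond (Less (Var ''h'') (Var ''x'')) ?c3 Skip) ?post ?s5"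
        proof (rule wp_Cond)
          assume "\<not> bval (Less (Var ''h'') (Var ''x'')) ?s5"
          hence "?gain \<le> h" using st5(3) by (simp del: of_int_mult of_int_diff)
          moreover have "leading C ?s5" using leading_same[OF same5] lead by simp
          ultimately show "wp Skip ?post ?s5"
            using st5(3) by (intro wp_Skip) (auto simp: leading_def)
        next
          assume "bval (Less (Var ''h'') (Var ''x'')) ?s5"
          hence less: "h < ?gain" using st5(3) by (simp del: of_int_mult of_int_diff)
          let ?s6 = "set_var ''h'' (of_int ?gain) ?s5"
          let ?s7 = "set_var ''g'' (of_int \<sigma>) ?s6"
          let ?s8 = "set_var ''z'' (of_nat z) ?s7"
          have "same_except {''i'', ''x'', ''y'', ''h'', ''g''} {''D'', ''E''} s ?s7"
            using same5 by (auto simp: same_except_def)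
          hence z7: "aval e ?s7 = of_nat z" by (rule z)
          have st8: "var ?s8 ''n'' = of_nat n" "flagged n ''D'' ?s8 = P" "flagged n ''E'' ?s8 = Q"
            "var ?s8 ''h'' = of_int ?gain" "var ?s8 ''g'' = of_int \<sigma>" "var ?s8 ''z'' = of_nat z"
            using st5 same_exceptD(1)[OF same5, of "''n''"] n by simp_all
          have "wp ?c4 ?post ?s8"
          proof (rule wp_Seq, rule wp_use[OF wp_set_flags[OF st8(1) P(1)]])
            fix k and s' :: state assume k: "k < n" "same_except {''i''} {''P''} ?s8 s'" "var s' ''i'' = of_nat k"
            have "flagged n ''D'' s' = P" using flagged_same[OF k(2)] st8(2) by simp
            thus "bval (In (Var ''i'') ''D'') s' \<longleftrightarrow> k \<in> P"
              using bval_In[where e = "Var ''i''" and s = s' and k = k and n = n and a = "''D''"] k by simp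
          next
            fix s9 assume "flagged n ''P'' s9 = P"
              "same_except (written_vars (set_flags ''P'' (In (Var ''i'') ''D''))) (written_arrs (set_flags ''P'' (In (Var ''i'') ''D''))) ?s8 s9"
            hence s9: "flagged n ''P'' s9 = P" "same_except {''i''} {''P''} ?s8 s9" by simp_all
            have n9: "var s9 ''n'' = of_nat n" using same_exceptD(1)[OF s9(2), of "''n''"] st8(1) by simp
            show "wp (set_flags ''Q'' (In (Var ''i'') ''E'')) ?post s9"
            proof (rule wp_use[OF wp_set_flags[OF n9 Q(1)]])
              fix k and s' :: state assume k: "k < n" "same_except {''i''} {''Q''} s9 s'" "var s' ''i'' = of_nat k"
              have "flagged n ''E'' s' = Q" using flagged_same[OF k(2)] flagged_same[OF s9(2)] st8(3) by simp
              thus "bval (In (Var ''i'') ''E'') s' \<longleftrightarrow> k \<in> Q"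
                using bval_In[where e = "Var ''i''" and s = s' and k = k and n = n and a = "''E''"] k by simp
            next
              fix s10 assume "flagged n ''Q'' s10 = Q"
                "same_except (written_vars (set_flags ''Q'' (In (Var ''i'') ''E''))) (written_arrs (set_flags ''Q'' (In (Var ''i'') ''E''))) s9 s10"
              hence s10: "flagged n ''Q'' s10 = Q" "same_except {''i''} {''Q''} s9 s10" by simp_all
              have P10: "flagged n ''P'' s10 = P" using flagged_same[OF s10(2)] s9(1) by simp
              have "var s10 v = var ?s8 v" if "v \<noteq> ''i''" for v
                using same_exceptD(1)[OF s10(2)] same_exceptD(1)[OF s9(2)] that by simp
              from this[of "''h''"] this[of "''g''"] this[of "''z''"]
              have "var s10 ''h'' = of_int ?gain" "var s10 ''g'' = of_int \<sigma>" "var s10 ''z'' = of_nat z"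
                by simp_all
              thus "?post s10" unfolding leading_def
                using P10 s10(1) less h(2,4) gain by (intro exI[of _ ?gain]) (force simp del: of_int_mult of_int_diff)
            qed
          qed
          hence "wp (Seq (Assign ''z'' e) ?c4) ?post ?s7"
            by (intro wp_Seq[of "Assign _ _"] wp_Assign) (use fits_index[OF z(2)] in \<open>simp_all only: z7\<close>)
          moreover have "rat_size (of_int \<sigma>) \<le> W" using \<sigma> fits_consts by auto
          ultimately show "wp ?c3 ?post ?s5"
            by (intro wp_Seq[of "Assign ''h'' _"] wp_Seq[of "Assign ''g'' _"] wp_Assign) (use fit in simp_all)
        qed
      qed
    qed
  qed
qed (use P(2) in auto)

definition in_context :: "nat rel \<Rightarrow> nat \<Rightarrow> nat \<Rightarrow> nat \<Rightarrow> state \<Rightarrow> bool" where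
  "in_context R r t u s \<longleftrightarrow> var s ''n'' = of_nat n \<and> var s ''r'' = of_nat r \<and> var s ''s'' = of_nat t \<and>
     var s ''u'' = of_nat u \<and> relation n s = R \<and> r < n \<and> t < n \<and> u < n"

lemma in_context_same:
  "same_except X A s s' \<Longrightarrow> X \<inter> {''n'', ''r'', ''s'', ''u''} = {} \<Longrightarrow> ''R'' \<notin> A \<Longrightarrow>
   in_context R r t u s \<Longrightarrow> in_context R r t u s'"
  using same_exceptD(1)[of X A s s'] relation_same[of X A s s' n] unfolding in_context_def by auto

lemma bval_Above:
  assumes "in_context R r t u s" "var s ''i'' = of_nat k" "k < n"
  shows "bval (Above ''r'') s \<longleftrightarrow> k \<in> above R r r" "bval (Above ''u'') s \<longleftrightarrow> k \<in> above R r u"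
  using assms unfolding in_context_def above_def
  by (auto simp: bval_Related[where n = n and a = r and b = k] bval_Related[where n = n and a = u and b = k])

lemma bval_Avoiding:
  assumes "in_context R r t u s" "var s ''i'' = of_nat k" "k < n"
  shows "bval (Avoiding ''s'') s \<longleftrightarrow> k \<in> avoiding {..<n} R t t" "bval (Avoiding ''u'') s \<longleftrightarrow> k \<in> avoiding {..<n} R t u"
  using assms unfolding in_context_def avoiding_def
  by (auto simp: bval_Related[where n = n and a = k and b = t] bval_Related[where n = n and a = k and b = u])

lemma above_avoiding_subset:
  assumes "R \<subseteq> {..<n} \<times> {..<n}"
  shows "above R r u \<subseteq> {..<n}" "avoiding {..<n} R t u \<subseteq> {..<n}"
  using assms by (auto simp: above_def avoiding_def)

lemma wp_consider_in_context:
  assumes s: "in_context R r t u s" "leading C s"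
    and P: "P \<subseteq> {..<n}" "\<And>k s'. in_context R r t u s' \<Longrightarrow> var s' ''i'' = of_nat k \<Longrightarrow> k < n \<Longrightarrow> bval bP s' \<longleftrightarrow> k \<in> P"
    and Q: "Q \<subseteq> {..<n}" "\<And>k s'. in_context R r t u s' \<Longrightarrow> var s' ''i'' = of_nat k \<Longrightarrow> k < n \<Longrightarrow> bval bQ s' \<longleftrightarrow> k \<in> Q"
    and z: "\<And>s'. in_context R r t u s' \<Longrightarrow> aval e s' = of_nat z \<and> z < n"
    and \<sigma>: "\<sigma> = 1 \<or> \<sigma> = - 1" "c = of_int \<sigma>"
  shows "wp (consider_interval bP bQ c e) (leading (insert (P, Q, \<sigma>, z) C)) s"
  unfolding \<sigma>(2)
proof (rule wp_consider_interval[OF _ s(2) P(1) _ Q(1) _ _ _ \<sigma>(1)])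
  show "var s ''n'' = of_nat n" using s(1) by (simp add: in_context_def)
  show "bval bP s' \<longleftrightarrow> k \<in> P" if "k < n" "same_except {''i''} {''D''} s s'" "var s' ''i'' = of_nat k" for k s'
    using in_context_same[OF that(2) _ _ s(1)] P(2) that by simp
  show "bval bQ s' \<longleftrightarrow> k \<in> Q" if "k < n" "same_except {''i''} {''D'', ''E''} s s'" "var s' ''i'' = of_nat k" for k s'
    using in_context_same[OF that(2) _ _ s(1)] Q(2) that by simp
  show "aval e s' = of_nat z" if "same_except {''i'', ''x'', ''y'', ''h'', ''g''} {''D'', ''E''} s s'" for s'
    using in_context_same[OF that _ _ s(1)] z by simp
  show "z < n" using z s(1) by blast
qed

lemma wp_consider_element:
  assumes s: "in_context R r t u s" "leading C s"
  shows "wp consider_element (leading (candidates_at {..<n} R r t u \<union> C)) s"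
  unfolding consider_element_def
proof (rule wp_Seq)
  let ?up = "above R r" and ?down = "avoiding {..<n} R t"
  have rel: "bval (Related (Var ''u'') (Var ''s'')) s' \<longleftrightarrow> (u, t) \<in> R"
    "bval (Related (Var ''r'') (Var ''u'')) s' \<longleftrightarrow> (r, u) \<in> R" if "in_context R r t u s'" for s'
    using that bval_Related[where n = n and a = u and b = t and s = s']
      bval_Related[where n = n and a = r and b = u and s = s'] unfolding in_context_def by auto
  have sub: "?up v \<subseteq> {..<n}" "?down v \<subseteq> {..<n}" "?up v \<inter> ?down v \<subseteq> {..<n}" "?up v \<union> ?down v \<subseteq> {..<n}" for v
    using s(1) relation_subset above_avoiding_subset unfolding in_context_def by (metis le_supI le_infI1)+
  have z: "aval (Var ''u'') s' = of_nat u \<and> u < n" "aval (Var ''r'') s' = of_nat r \<and> r < n"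
    "aval (Var ''s'') s' = of_nat t \<and> t < n" if "in_context R r t u s'" for s'
    using that by (auto simp: in_context_def)
  \<comment> \<open>The candidates compared after each of the four calls, following the cases of
    \<open>candidates_at\<close>.\<close>
  let ?C1 = "(if (u, t) \<notin> R then {(?up u, ?down t, - 1, u)} else {}) \<union> C"
  let ?C2 = "(if (r, u) \<notin> R then {(?up r, ?down u, 1, u)} else {}) \<union> ?C1"
  let ?C3 = "insert (?up r, ?up u \<inter> ?down u, - 1, r) ?C2"
  let ?C4 = "insert (?up u \<union> ?down u, ?down t, 1, t) ?C3"
  let ?C = "candidates_at {..<n} R r t u \<union> C"
  let ?c1 = "consider_interval (Above ''u'') (Avoiding ''s'') (- 1) (Var ''u'')"
  let ?c2 = "consider_interval (Above ''r'') (Avoiding ''u'') 1 (Var ''u'')"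
  let ?c3 = "consider_interval (Above ''r'') (Conj (Above ''u'') (Avoiding ''u'')) (- 1) (Var ''r'')"
  let ?c4 = "consider_interval (Or (Above ''u'') (Avoiding ''u'')) (Avoiding ''s'') 1 (Var ''s'')"
  let ?cond2 = "Cond (Neg (Related (Var ''r'') (Var ''u''))) ?c2 Skip"
  let ?cond3 = "Cond (Conj (Neg (Related (Var ''r'') (Var ''u''))) (Neg (Related (Var ''u'') (Var ''s'')))) (Seq ?c3 ?c4) Skip"
  let ?ok = "in_context R r t u"
  have keep: "wp c (\<lambda>s'. ?ok s' \<and> leading D s') s'"
    if "wp c (leading D) s'" "?ok s'" "written_vars c \<inter> {''n'', ''r'', ''s'', ''u''} = {}" "''R'' \<notin> written_arrs c" for c D s'
    using that(1) by (rule wp_use) (use in_context_same that in blast)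
  have "wp (Cond (Neg (Related (Var ''u'') (Var ''s''))) ?c1 Skip) (leading ?C1) s"
  proof (rule wp_Cond)
    assume "bval (Neg (Related (Var ''u'') (Var ''s''))) s"
    hence eq: "?C1 = insert (?up u, ?down t, - 1, u) C" using rel[OF s(1)] by simp
    show "wp ?c1 (leading ?C1) s" unfolding eq
      by (rule wp_consider_in_context[OF s sub(1) _ sub(2) _ z(1)]) (simp_all add: bval_Above bval_Avoiding del: bval_Or bval.simps)
  qed (use s rel in \<open>auto intro!: wp_Skip\<close>)
  hence 1: "wp (Cond (Neg (Related (Var ''u'') (Var ''s''))) ?c1 Skip) (\<lambda>s'. ?ok s' \<and> leading ?C1 s') s"
    by (rule keep) (use s in auto)
  have 2: "wp ?cond2 (\<lambda>s'. ?ok s' \<and> leading ?C2 s') s1" if "?ok s1 \<and> leading ?C1 s1" for s1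
  proof (rule keep, rule wp_Cond)
    assume "bval (Neg (Related (Var ''r'') (Var ''u''))) s1"
    hence eq: "?C2 = insert (?up r, ?down u, 1, u) ?C1" using rel that by simp
    show "wp ?c2 (leading ?C2) s1" unfolding eq
      by (rule wp_consider_in_context[OF conjunct1[OF that] conjunct2[OF that] sub(1) _ sub(2) _ z(1)])
        (simp_all add: bval_Above bval_Avoiding del: bval_Or bval.simps)
  qed (use that rel in \<open>auto intro!: wp_Skip\<close>)
  have 3: "wp ?cond3 (leading ?C) s2" if "?ok s2 \<and> leading ?C2 s2" for s2
  proof (rule wp_Cond)
    assume "bval (Conj (Neg (Related (Var ''r'') (Var ''u''))) (Neg (Related (Var ''u'') (Var ''s'')))) s2"
    hence "?C = ?C4" using rel that by (auto simp: candidates_at_def)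
    have "wp ?c3 (leading ?C3) s2"
      by (rule wp_consider_in_context[OF conjunct1[OF that] conjunct2[OF that] sub(1) _ sub(3) _ z(2)])
        (simp_all only: bval.simps(4)[of "Above ''u''"] bval_Above bval_Avoiding Int_iff, simp_all)
    hence "wp ?c3 (\<lambda>s'. ?ok s' \<and> leading ?C3 s') s2" by (rule keep) (use that in auto)
    moreover have "wp ?c4 (leading ?C) s3" if "?ok s3 \<and> leading ?C3 s3" for s3
      unfolding \<open>?C = ?C4\<close>
      by (rule wp_consider_in_context[OF conjunct1[OF that] conjunct2[OF that] sub(4) _ sub(2) _ z(3)])
        (simp_all only: bval_Or[of "Above ''u''"] bval_Above bval_Avoiding Un_iff, simp_all)
    ultimately show "wp (Seq ?c3 ?c4) (leading ?C) s2" by (intro wp_Seq) (erule wp_use)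
  next
    assume "\<not> bval (Conj (Neg (Related (Var ''r'') (Var ''u''))) (Neg (Related (Var ''u'') (Var ''s'')))) s2"
    hence "?C = ?C2" using rel that by (auto simp: candidates_at_def)
    thus "wp Skip (leading ?C) s2" using that by (intro wp_Skip) simp
  qed
  show "wp (Cond (Neg (Related (Var ''u'') (Var ''s''))) ?c1 Skip) (wp (Seq ?cond2 ?cond3) (leading ?C)) s"
    using 1
  proof (rule wp_use, intro wp_Seq)
    fix s1 assume "?ok s1 \<and> leading ?C1 s1"
    from 2[OF this] show "wp ?cond2 (wp ?cond3 (leading ?C)) s1" by (rule wp_use) (rule 3)
  qed
qed

lemma wp_choose_interval:
  assumes n: "var s ''n'' = of_nat n" and rt: "var s ''r'' = of_nat r" "var s ''s'' = of_nat t" "r < n" "t < n"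
  shows "wp choose_interval (leading (\<Union>u\<in>{..<n}. candidates_at {..<n} (relation n s) r t u)) s"
  unfolding choose_interval_def
proof (rule wp_Seq, rule wp_Assign)
  let ?R = "relation n s" and ?s0 = "set_var ''h'' (aval (Const 0) s) s"
  show "wp (For ''u'' Size consider_element) (leading (\<Union>u\<in>{..<n}. candidates_at {..<n} ?R r t u)) ?s0"
  proof (rule wp_For[where m = n and I = "\<lambda>k. leading (\<Union>u\<in>{..<k}. candidates_at {..<n} ?R r t u)"])
    fix k and s' :: state
    assume k: "k < n" "leading (\<Union>u\<in>{..<k}. candidates_at {..<n} ?R r t u) s'" "var s' ''u'' = of_nat k"
      and same: "same_except (insert ''u'' (written_vars consider_element)) (written_arrs consider_element) ?s0 s'"
    have "in_context ?R r t k s'"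
      using same_exceptD(1)[OF same] relation_same[OF same] assms k(1,3) by (simp add: in_context_def)
    from wp_consider_element[OF this k(2)]
    show "wp consider_element (\<lambda>s'. leading (\<Union>u\<in>{..<Suc k}. candidates_at {..<n} ?R r t u)
        (set_var ''u'' (of_nat (Suc k)) s')) s'"
      by (rule wp_use) (simp add: lessThan_Suc leading_def)
  next
    show "aval Size s' = of_nat n" if "same_except (insert ''u'' (written_vars consider_element)) (written_arrs consider_element) ?s0 s'" for s'
      using same_exceptD(1)[OF that, of "''n''"] n by simp
  qed (use L_ge(3) F_nonneg in \<open>auto simp: leading_def\<close>)
qed (use fits_consts in simp)

text \<open>The matrix is read while it is being overwritten. This is harmless: the new arc creates
  no further pairs into \<open>a\<close> or out of \<open>b\<close>, so the entries consulted there
  have the same value before and after, and the entry \<open>(k, l)\<close> itself is still the old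
  one.\<close>

lemma wp_insert_arc:
  assumes n: "var s ''n'' = of_nat n" and arc: "var s ''e'' = of_nat a" "var s ''f'' = of_nat b" "a < n" "b < n"
  shows "wp insert_arc (\<lambda>s'. relation n s' = add_arc (relation n s) a b) s"
  unfolding insert_arc_def
proof (rule wp_set_relation[OF n])
  let ?R = "relation n s"
  show "add_arc ?R a b \<subseteq> {..<n} \<times> {..<n}" using relation_subset by (auto simp: add_arc_def)
  fix k l D and s' :: state
  assume kl: "k < n" "l < n" "same_except {''a'', ''b''} {''R''} s s'" "var s' ''a'' = of_nat k" "var s' ''b'' = of_nat l"
    "(k, l) \<notin> D" "relation n s' = (add_arc ?R a b \<inter> D) \<union> (?R - D)"
  have "var s' ''n'' = of_nat n" "var s' ''e'' = of_nat a" "var s' ''f'' = of_nat b"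
    using same_exceptD(1)[OF kl(3)] n arc by simp_all
  thus "bval (Or (Related (Var ''a'') (Var ''b'')) (Conj (Related (Var ''a'') (Var ''e'')) (Related (Var ''f'') (Var ''b'')))) s'
      \<longleftrightarrow> (k, l) \<in> add_arc ?R a b"
    using kl arc(3,4) bval_Related[where n = n and s = s' and a = k and b = l]
      bval_Related[where n = n and s = s' and a = k and b = a] bval_Related[where n = n and s = s' and a = b and b = l]
    by (auto simp: add_arc_def)
qed

end

section \<open>Minimizing over one interval, then over all of them\<close>

definition solve :: com where
  "solve = Seq (set_relation (Equal (Var ''a'') (Var ''b'')))
     (Seq (Assign ''e'' (Var ''r'')) (Seq (Assign ''f'' (Var ''r2'')) (Seq insert_arc
     (Seq (Assign ''e'' (Var ''s2'')) (Seq (Assign ''f'' (Var ''s'')) (Seq insert_arc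
     (Seq (For ''t'' (Plus (Times Size Size) (Const 1)) improve)
          (set_flags ''O'' (Related (Var ''r'') (Var ''i''))))))))))"

definition offer :: com where
  "offer = Seq (Query_Member ''q'' ''O'') (Seq (Query_Value ''v'' ''O'')
     (Cond (Conj (Equal (Var ''q'') (Const 0)) (Or (Equal (Var ''found'') (Const 0)) (Less (Var ''v'') (Var ''best''))))
        (Seq (Assign ''found'' (Const 1)) (Seq (Assign ''best'' (Var ''v''))
             (set_flags ''out'' (In (Var ''i'') ''O''))))
        Skip))"

definition try_constraint :: com where
  "try_constraint = Cond (Conj (Neg (Equal (Var ''r'') (Var ''s''))) (Conj (Neg (Equal (Var ''r'') (Var ''s2'')))
       (Conj (Neg (Equal (Var ''r2'') (Var ''s''))) (Neg (Equal (Var ''r2'') (Var ''s2''))))))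
     (Seq solve offer) Skip"

definition minimize_outside :: com where
  "minimize_outside = Seq (Assign ''N'' (Plus (Times (Const 6) (Times Size (Times Size Size))) (Const 1)))
     (Seq (Seq (set_flags ''O'' Never) offer)
     (Seq (Seq (set_flags ''O'' (Less (Const 0) (Const 1))) offer)
     (For ''r'' Size (For ''r2'' Size (For ''s'' Size (For ''s2'' Size try_constraint))))))"

lemma written_solve [simp]:
  "written_vars solve = {''i'', ''x'', ''y'', ''h'', ''g'', ''z'', ''u'', ''B'', ''k'', ''w'', ''a'', ''b'', ''c'', ''v'', ''m'', ''e'', ''f'', ''t''}"
  "written_arrs solve = {''D'', ''E'', ''P'', ''Q'', ''p'', ''S'', ''Z'', ''C'', ''Y'', ''R'', ''O''}"
  by (auto simp: solve_def)

lemma written_offer [simp]: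
  "written_vars offer = {''q'', ''v'', ''found'', ''best'', ''i''}" "written_arrs offer = {''out''}"
  by (auto simp: offer_def)

lemma written_try_constraint [simp]:
  "written_vars try_constraint = written_vars solve \<union> written_vars offer"
  "written_arrs try_constraint = written_arrs solve \<union> written_arrs offer"
  by (simp_all add: try_constraint_def)

definition separating :: "nat \<Rightarrow> nat \<Rightarrow> nat \<Rightarrow> nat \<Rightarrow> nat \<Rightarrow> nat set set" where
  "separating n r x t y = {X. X \<subseteq> {..<n} \<and> r \<in> X \<and> x \<in> X \<and> t \<notin> X \<and> y \<notin> X}"

text \<open>The two arcs express the remaining constraints through closedness: a closed set with
  \<open>r\<close> contains \<open>x\<close>, and one without \<open>t\<close> misses
  \<open>y\<close>.\<close>

lemma sound_initial_relation:
  assumes "r < n" "x < n" "t < n" "y < n" "{r, x} \<inter> {t, y} = {}"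
  shows "sound_relation {..<n} f (separating n r x t y) r t (add_arc (add_arc (Id_on {..<n}) r x) y t)"
  (is "sound_relation _ _ _ _ _ ?R")
proof -
  have "trans ?R" by (intro trans_add_arc) (auto simp: trans_def)
  moreover have "(r, x) \<in> ?R" "(y, t) \<in> ?R" "?R \<subseteq> {..<n} \<times> {..<n}" "\<forall>x\<in>{..<n}. (x, x) \<in> ?R"
    using assms by (auto simp: add_arc_def)
  moreover from this have "closed_sets {..<n} ?R r t \<subseteq> separating n r x t y"
    unfolding closed_sets_def separating_def by blast
  moreover have "?R `` X \<subseteq> X" if "X \<in> separating n r x t y" for X
    using that assms(5) by (auto simp: add_arc_def separating_def)
  ultimately show ?thesis by (auto simp: sound_relation_def minimizer_def)
qed

locale submodular_machine = oracle_machine +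
  assumes submodular: "submodular_on {..<n} val"
begin

abbreviation interval_candidates where
  "interval_candidates R r t \<equiv> \<Union>u\<in>{..<n}. candidates_at {..<n} R r t u"

definition no_gain :: "nat rel \<Rightarrow> nat \<Rightarrow> nat \<Rightarrow> bool" where
  "no_gain R r t \<longleftrightarrow> (\<forall>P Q \<sigma> z. (P, Q, \<sigma>, z) \<in> interval_candidates R r t \<longrightarrow> \<sigma> * (val Q - val P) \<le> 0)"

text \<open>Without a gain the relation is left as it is. Surplus rounds are therefore harmless, and
  the number of rounds can be fixed in advance.\<close>

lemma wp_improve:
  assumes con: "constrained {..<n} val \<L> r t" and snd: "sound_relation {..<n} val \<L> r t (relation n s)"
    and st: "var s ''n'' = of_nat n" "var s ''N'' = of_nat (6 * n ^ 3 + 1)" "var s ''r'' = of_nat r" "var s ''s'' = of_nat t"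
  shows "wp improve (\<lambda>s'. sound_relation {..<n} val \<L> r t (relation n s') \<and>
    (if no_gain (relation n s) r t then relation n s' = relation n s else card (relation n s) < card (relation n s'))) s"
    (is "wp improve ?Post s")
  unfolding improve_def
proof (rule wp_Seq, rule wp_use[OF wp_choose_interval[OF st(1,3,4)]])
  let ?R = "relation n s"
  interpret constrained "{..<n}" val \<L> r t by (rule con)
  interpret fixing "{..<n}" val ?R r t by (rule fixing[OF snd])
  show "r < n" "t < n" using rs by auto
  let ?arc = "Cond (Less (Const 0) (Var ''g'')) (Seq (Assign ''e'' (Var ''m'')) (Assign ''f'' (Var ''z'')))
            (Seq (Assign ''e'' (Var ''z'')) (Assign ''f'' (Var ''m'')))"
  let ?c = "Seq run_descent (Seq find_extreme (Seq ?arc insert_arc))"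
  fix s1 assume lead: "leading candidates s1"
    and "same_except (written_vars choose_interval) (written_arrs choose_interval) s s1"
  hence same1: "same_except {''i'', ''x'', ''y'', ''h'', ''g'', ''z'', ''u''} {''D'', ''E'', ''P'', ''Q''} s s1" by simp
  have st1: "var s1 ''n'' = of_nat n" "var s1 ''N'' = of_nat (6 * n ^ 3 + 1)" "relation n s1 = ?R"
    using same_exceptD(1)[OF same1, of "''n''"] same_exceptD(1)[OF same1, of "''N''"] relation_same[OF same1] st by simp_all
  obtain h where h: "var s1 ''h'' = of_int h" "0 \<le> h" "h \<le> 2 * F"
    "\<And>P Q \<sigma> z. (P, Q, \<sigma>, z) \<in> candidates \<Longrightarrow> \<sigma> * (val Q - val P) \<le> h"
    "h = 0 \<or> (\<exists>\<sigma> z. var s1 ''g'' = of_int \<sigma> \<and> var s1 ''z'' = of_nat z \<and>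
        (flagged n ''P'' s1, flagged n ''Q'' s1, \<sigma>, z) \<in> candidates \<and>
        \<sigma> * (val (flagged n ''Q'' s1) - val (flagged n ''P'' s1)) = h)"
    using lead unfolding leading_def by blast
  show "wp (Cond (Less (Const 0) (Var ''h'')) ?c Skip) ?Post s1"
  proof (rule wp_Cond)
    assume "\<not> bval (Less (Const 0) (Var ''h'')) s1"
    hence "h = 0" using h(1,2) by simp
    hence "no_gain ?R r t" using h(4) by (simp add: no_gain_def)
    thus "wp Skip ?Post s1" using st1(3) snd by (intro wp_Skip) simp
  next
    assume "bval (Less (Const 0) (Var ''h'')) s1"
    hence "0 < h" using h(1) by simp
    let ?P = "flagged n ''P'' s1" and ?Q = "flagged n ''Q'' s1"
    obtain \<sigma> z where z: "var s1 ''g'' = of_int \<sigma>" "var s1 ''z'' = of_nat z" "(?P, ?Q, \<sigma>, z) \<in> candidates"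
      "\<sigma> * (val ?Q - val ?P) = h"
      using h(5) \<open>0 < h\<close> by auto
    have gain: "\<not> no_gain ?R r t" unfolding no_gain_def using z(3,4) \<open>0 < h\<close> by (metis not_le)
    have \<sigma>: "\<sigma> = 1 \<or> \<sigma> = - 1" and zn: "z < n" using candidate_props(4,5)[OF z(3)] by auto
    let ?Y = "greedy_total (?Q - ?P) (\<lambda>Z. closure_ext val ?R (3 * h) (?P \<union> Z)) (6 * int n * h * (6 * int n ^ 3 + 1)) ((6 * n ^ 3 + 1)\<^sup>2)"
    have "wp run_descent (\<lambda>s'. int_array n ''S'' s' ?Y) s1"
      using wp_run_descent[OF st1(1,2) h(1,2,3)] by (simp only: st1(3))
    thus "wp ?c ?Post s1"
    proof (rule wp_Seq[OF wp_use])
      fix s2 assume S: "int_array n ''S'' s2 ?Y" and "same_except (written_vars run_descent) (written_arrs run_descent) s1 s2"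
      hence same2: "same_except {''i'', ''B'', ''k'', ''w'', ''a'', ''b'', ''c'', ''v'', ''x'', ''y''} {''p'', ''S'', ''Z'', ''C'', ''Y''} s1 s2"
        by simp
      have st2: "var s2 ''n'' = of_nat n" "var s2 ''g'' = of_int \<sigma>" "var s2 ''z'' = of_nat z" "relation n s2 = ?R"
        using same_exceptD(1)[OF same2] relation_same[OF same2] st1 z by simp_all
      have "0 < n" using rs(1) by auto
      show "wp (Seq find_extreme (Seq ?arc insert_arc)) ?Post s2"
      proof (rule wp_Seq, rule wp_use[OF wp_find_extreme[OF st2(1) \<open>0 < n\<close> st2(2) S]], elim exE conjE)
        fix s3 w assume w: "w < n" "var s3 ''m'' = of_nat w" "\<forall>v<n. \<sigma> * ?Y v \<le> \<sigma> * ?Y w"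
          and "same_except (written_vars find_extreme) (written_arrs find_extreme) s2 s3"
        hence same3: "same_except {''m'', ''w''} {} s2 s3" by simp
        have st3: "var s3 ''n'' = of_nat n" "var s3 ''g'' = of_int \<sigma>" "var s3 ''z'' = of_nat z" "relation n s3 = ?R"
          using same_exceptD(1)[OF same3] relation_same[OF same3] st2 by simp_all
        have wQ: "w \<in> ?Q - ?P"
          by (rule extreme_in_ground[OF z(3), where k = "(6 * n ^ 3 + 1)\<^sup>2"]) (use z(4) \<open>0 < h\<close> w in auto)
        obtain a b where ab: "(a, b) = (if \<sigma> = 1 then (w, z) else (z, w))" by (metis surj_pair)
        have N: "nat ((6 * int n ^ 3 + 1)\<^sup>2) = (6 * n ^ 3 + 1)\<^sup>2"
        proof -
          have "(6 * int n ^ 3 + 1)\<^sup>2 = int ((6 * n ^ 3 + 1)\<^sup>2)" by simp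
          thus ?thesis by (simp only: nat_int)
        qed
        let ?Y' = "greedy_total (?Q - ?P) (\<lambda>Z. closure_ext val ?R (3 * h) (?P \<union> Z))
          (int (6 * card {..<n}) * h * (6 * int (card {..<n}) ^ 3 + 1)) (nat ((6 * int (card {..<n}) ^ 3 + 1)\<^sup>2))"
        have "\<sigma> * ?Y' v \<le> \<sigma> * ?Y' w"
          if "v \<in> ?Q - ?P" for v
          using w(3) that flagged_subset[of n "''Q''" s1] by (auto simp: N)
        note arc = discovered_arc[OF h(4) \<open>0 < h\<close> z(3,4) wQ this ab]
        have arc': "(a, b) \<notin> ?R" "a < n" "b < n" "\<And>X. minimizer val \<L> X \<Longrightarrow> a \<in> X \<Longrightarrow> b \<in> X"
          using arc minimizer_closed_sets[OF snd] by auto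
        have goal: "wp insert_arc ?Post s4"
          if "var s4 ''n'' = of_nat n" "var s4 ''e'' = of_nat a" "var s4 ''f'' = of_nat b" "relation n s4 = ?R" for s4
        proof (rule wp_use[OF wp_insert_arc[OF that(1-3) arc'(2,3)]])
          fix s' assume "relation n s' = add_arc (relation n s4) a b"
          hence "relation n s' = add_arc ?R a b" using that(4) by simp
          thus "?Post s'"
            using sound_add_arc[OF snd _ _ arc'(4)] card_add_arc[OF snd _ _ arc'(1)] arc'(2,3) gain by simp
        qed
        show "wp (Seq ?arc insert_arc) ?Post s3"
        proof (rule wp_Seq, rule wp_Cond)
          assume "bval (Less (Const 0) (Var ''g'')) s3"
          hence "\<sigma> = 1" using st3(2) \<sigma> by auto
          thus "wp (Seq (Assign ''e'' (Var ''m'')) (Assign ''f'' (Var ''z''))) (wp insert_arc ?Post) s3"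
            using ab st3 w fits_index zn by (intro wp_Seq wp_Assign goal) auto
        next
          assume "\<not> bval (Less (Const 0) (Var ''g'')) s3"
          hence "\<sigma> = - 1" using st3(2) \<sigma> by auto
          thus "wp (Seq (Assign ''e'' (Var ''z'')) (Assign ''f'' (Var ''m''))) (wp insert_arc ?Post) s3"
            using ab st3 w fits_index zn by (intro wp_Seq wp_Assign goal) auto
        qed
      qed
    qed
  qed
qed

lemma wp_solve:
  assumes rxty: "r < n" "x < n" "t < n" "y < n" "{r, x} \<inter> {t, y} = {}"
    and st: "var s ''n'' = of_nat n" "var s ''N'' = of_nat (6 * n ^ 3 + 1)" "var s ''r'' = of_nat r" "var s ''r2'' = of_nat x"
      "var s ''s'' = of_nat t" "var s ''s2'' = of_nat y"
  shows "wp solve (\<lambda>s'. minimizer val (separating n r x t y) (flagged n ''O'' s')) s"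
proof -
  let ?\<L> = "separating n r x t y"
  let ?sound = "sound_relation {..<n} val ?\<L> r t"
  let ?Post = "\<lambda>s'. minimizer val ?\<L> (flagged n ''O'' s')"
  have "{r, x} \<in> ?\<L>" using rxty by (auto simp: separating_def)
  hence con: "constrained {..<n} val ?\<L> r t"
    by unfold_locales (use rxty submodular in \<open>auto simp: separating_def\<close>)
  let ?vars = "\<lambda>s'. var s' ''n'' = of_nat n \<and> var s' ''N'' = of_nat (6 * n ^ 3 + 1) \<and> var s' ''r'' = of_nat r \<and>
    var s' ''r2'' = of_nat x \<and> var s' ''s'' = of_nat t \<and> var s' ''s2'' = of_nat y"
  have keep: "?vars s''" if "?vars s'" "same_except X A s' s''" "X \<inter> {''n'', ''N'', ''r'', ''r2'', ''s'', ''s2''} = {}" for s' s'' X A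
    using that same_exceptD(1)[OF that(2)] by auto
  let ?finish = "set_flags ''O'' (Related (Var ''r'') (Var ''i''))"
  let ?loop = "For ''t'' (Plus (Times Size Size) (Const 1)) improve"
  have finish: "wp ?finish ?Post s'" if s': "?vars s'" "?sound (relation n s')" "no_gain (relation n s') r t" for s'
  proof -
    interpret constrained "{..<n}" val ?\<L> r t by (rule con)
    interpret fixing "{..<n}" val "relation n s'" r t by (rule fixing[OF s'(2)])
    have "minimizer val K (relation n s' `` {r})"
      by (rule no_gain_minimizer) (use s'(3)[unfolded no_gain_def] in blast)
    hence min: "minimizer val ?\<L> (relation n s' `` {r})" using minimizer_closed_sets[OF s'(2)] by simp
    have "wp ?finish (\<lambda>s''. flagged n ''O'' s'' = relation n s' `` {r}) s'"
    proof (rule wp_set_flags)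
      show "relation n s' `` {r} \<subseteq> {..<n}" by (auto simp: relation_def)
      fix k and s'' :: state assume k: "k < n" "same_except {''i''} {''O''} s' s''" "var s'' ''i'' = of_nat k"
      have "?vars s''" by (rule keep[OF s'(1) k(2)]) simp
      thus "bval (Related (Var ''r'') (Var ''i'')) s'' \<longleftrightarrow> k \<in> relation n s' `` {r}"
        using bval_Related[where n = n and s = s'' and a = r and b = k] relation_same[OF k(2)] k rxty(1) by simp
    qed (use s' in simp)
    thus ?thesis by (rule wp_use) (use min in simp)
  qed
  have loop: "wp (Seq ?loop ?finish) ?Post s'" if s': "?vars s'" "?sound (relation n s')" for s'
  proof (rule wp_Seq)
    \<comment> \<open>As long as there is a gain each round adds a pair, so after \<open>k\<close>
      such rounds there are at least \<open>k\<close> pairs. There is no room for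
      \<open>n * n + 1\<close> of them, hence the last index forces \<open>no_gain\<close>.\<close>
    let ?I = "\<lambda>k s''. ?sound (relation n s'') \<and> (no_gain (relation n s'') r t \<or> k \<le> card (relation n s''))"
    have "wp ?loop (?I (n * n + 1)) s'"
    proof (rule wp_For[where m = "n * n + 1" and I = ?I])
      fix k and s'' :: state
      assume k: "k < n * n + 1" "?I k s''" and same: "same_except (insert ''t'' (written_vars improve)) (written_arrs improve) s' s''"
      have v: "?vars s''" by (rule keep[OF s'(1) same]) simp
      have "wp improve (\<lambda>s'. ?sound (relation n s') \<and> (if no_gain (relation n s'') r t then relation n s' = relation n s''
          else card (relation n s'') < card (relation n s'))) s''"
        by (rule wp_improve[OF con]) (use k v in auto)
      thus "wp improve (\<lambda>s'. ?I (Suc k) (set_var ''t'' (of_nat (Suc k)) s')) s''"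
        by (rule wp_use) (use k(2) in \<open>auto split: if_splits\<close>)
    next
      show "aval (Plus (Times Size Size) (Const 1)) s'' = of_nat (n * n + 1)"
        if "same_except (insert ''t'' (written_vars improve)) (written_arrs improve) s' s''" for s''
        using keep[OF s'(1) that] by simp
    qed (use s' L_ge(2) in auto)
    thus "wp ?loop (wp ?finish ?Post) s'"
    proof (rule wp_use)
      fix s'' assume I: "?I (n * n + 1) s''" and same: "same_except (written_vars ?loop) (written_arrs ?loop) s' s''"
      have "card (relation n s'') \<le> card ({..<n} \<times> {..<n})" by (intro card_mono relation_subset) simp
      hence "no_gain (relation n s'') r t" using I by (simp add: card_cartesian_product)
      moreover have "?vars s''" by (rule keep[OF s'(1) same]) simp
      ultimately show "wp ?finish ?Post s''" using I by (intro finish) auto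
    qed
  qed
  let ?tail = "Seq ?loop ?finish"
  let ?second = "Seq (Assign ''e'' (Var ''s2'')) (Seq (Assign ''f'' (Var ''s'')) (Seq insert_arc ?tail))"
  have second: "wp ?second ?Post s'" if s': "?vars s'" "relation n s' = add_arc (Id_on {..<n}) r x" for s'
  proof -
    let ?s = "set_var ''f'' (of_nat t) (set_var ''e'' (of_nat y) s')"
    have "wp insert_arc (\<lambda>s''. relation n s'' = add_arc (relation n ?s) y t) ?s"
      by (rule wp_insert_arc) (use s' rxty in auto)
    hence "wp (Seq insert_arc ?tail) ?Post ?s"
    proof (rule wp_Seq[OF wp_use])
      fix s'' assume R: "relation n s'' = add_arc (relation n ?s) y t" and same: "same_except (written_vars insert_arc) (written_arrs insert_arc) ?s s''"
      have "?vars s''" by (rule keep[OF _ same]) (use s' in auto)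
      moreover have "?sound (relation n s'')" using sound_initial_relation[OF rxty] R s'(2) by simp
      ultimately show "wp ?tail ?Post s''" by (rule loop)
    qed
    thus ?thesis using s' fits_index rxty by (intro wp_Seq[of "Assign _ _"] wp_Assign) simp_all
  qed
  let ?first = "Seq (Assign ''e'' (Var ''r'')) (Seq (Assign ''f'' (Var ''r2'')) (Seq insert_arc ?second))"
  have first: "wp ?first ?Post s'" if s': "?vars s'" "relation n s' = Id_on {..<n}" for s'
  proof -
    let ?s = "set_var ''f'' (of_nat x) (set_var ''e'' (of_nat r) s')"
    have "wp insert_arc (\<lambda>s''. relation n s'' = add_arc (relation n ?s) r x) ?s"
      by (rule wp_insert_arc) (use s' rxty in auto)
    hence "wp (Seq insert_arc ?second) ?Post ?s"
    proof (rule wp_Seq[OF wp_use])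
      fix s'' assume R: "relation n s'' = add_arc (relation n ?s) r x" and same: "same_except (written_vars insert_arc) (written_arrs insert_arc) ?s s''"
      have "?vars s''" by (rule keep[OF _ same]) (use s' in auto)
      thus "wp ?second ?Post s''" using R s'(2) by (intro second) auto
    qed
    thus ?thesis using s' fits_index rxty by (intro wp_Seq[of "Assign _ _"] wp_Assign) simp_all
  qed
  have "wp (set_relation (Equal (Var ''a'') (Var ''b''))) (\<lambda>s'. relation n s' = Id_on {..<n}) s"
    by (rule wp_set_relation) (use st in auto)
  thus ?thesis unfolding solve_def
  proof (rule wp_Seq[OF wp_use])
    fix s' assume "relation n s' = Id_on {..<n}"
      and same: "same_except (written_vars (set_relation (Equal (Var ''a'') (Var ''b'')))) (written_arrs (set_relation (Equal (Var ''a'') (Var ''b'')))) s s'"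
    moreover have "?vars s'" by (rule keep[OF _ same]) (use st in auto)
    ultimately show "wp ?first ?Post s'" by (intro first)
  qed
qed

end

context submodular_machine
begin

text \<open>\<open>T\<close> is a ghost: the family of all sets offered so far, which exists only in
  the proof while the program keeps just the best.\<close>

definition recorded :: "nat set set \<Rightarrow> state \<Rightarrow> bool" where
  "recorded T s \<longleftrightarrow> (var s ''found'' = 0 \<and> (\<forall>X\<in>T. mem X)) \<or>
     (var s ''found'' \<noteq> 0 \<and> var s ''best'' = of_int (val (flagged n ''out'' s)) \<and>
      minimizer val {X \<in> T. \<not> mem X} (flagged n ''out'' s))"

lemma recorded_same:
  "same_except X A s s' \<Longrightarrow> X \<inter> {''found'', ''best''} = {} \<Longrightarrow> ''out'' \<notin> A \<Longrightarrow> recorded T s \<Longrightarrow> recorded T s'"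
  using same_exceptD(1)[of X A s s'] flagged_same[of X A s s'] unfolding recorded_def by auto

lemma wp_offer:
  assumes n: "var s ''n'' = of_nat n" and rec: "recorded T s"
  shows "wp offer (recorded (insert (flagged n ''O'' s) T)) s"
  unfolding offer_def
proof (rule wp_Seq, rule wp_Query_Member, rule fits_consts, rule wp_Seq, rule wp_Query_Value)
  let ?X = "flagged n ''O'' s"
  let ?s1 = "set_var ''q'' (of_bool (mem ?X)) s"
  let ?s2 = "set_var ''v'' (of_int (val (flagged n ''O'' ?s1))) ?s1"
  let ?copy = "set_flags ''out'' (In (Var ''i'') ''O'')"
  let ?b = "Conj (Equal (Var ''q'') (Const 0)) (Or (Equal (Var ''found'') (Const 0)) (Less (Var ''v'') (Var ''best'')))"
  show fit: "rat_size (of_int (val (flagged n ''O'' ?s1))) \<le> W"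
    by (rule fits_val[OF flagged_subset])
  have b: "bval ?b ?s2 \<longleftrightarrow> \<not> mem ?X \<and> (var s ''found'' = 0 \<or> of_int (val ?X) < var s ''best'')"
    by simp
  show "wp (Cond ?b (Seq (Assign ''found'' (Const 1)) (Seq (Assign ''best'' (Var ''v'')) ?copy)) Skip)
    (recorded (insert ?X T)) ?s2"
  proof (rule wp_Cond)
    assume "\<not> bval ?b ?s2"
    hence "mem ?X \<or> (var s ''found'' \<noteq> 0 \<and> \<not> of_int (val ?X) < var s ''best'')" using b by blast
    hence "recorded (insert ?X T) s"
    proof
      assume "mem ?X"
      hence "{Y \<in> insert ?X T. \<not> mem Y} = {Y \<in> T. \<not> mem Y}" by auto
      thus ?thesis using rec \<open>mem ?X\<close> by (simp add: recorded_def)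
    next
      assume *: "var s ''found'' \<noteq> 0 \<and> \<not> of_int (val ?X) < var s ''best''"
      hence "val (flagged n ''out'' s) \<le> val ?X" using rec by (simp add: recorded_def)
      thus ?thesis using rec * by (auto simp: recorded_def minimizer_def)
    qed
    thus "wp Skip (recorded (insert ?X T)) ?s2" by (intro wp_Skip) (simp add: recorded_def)
  next
    assume "bval ?b ?s2"
    hence X: "\<not> mem ?X" "var s ''found'' = 0 \<or> of_int (val ?X) < var s ''best''" using b by auto
    hence min: "minimizer val {Y \<in> insert ?X T. \<not> mem Y} ?X" using rec by (auto simp: recorded_def minimizer_def)
    let ?s3 = "set_var ''best'' (of_int (val ?X)) (set_var ''found'' 1 ?s2)"
    have "wp ?copy (\<lambda>s'. flagged n ''out'' s' = ?X) ?s3"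
    proof (rule wp_set_flags)
      fix k and s' :: state assume k: "k < n" "same_except {''i''} {''out''} ?s3 s'" "var s' ''i'' = of_nat k"
      have "flagged n ''O'' s' = ?X" using flagged_same[OF k(2), of "''O''" n] by simp
      thus "bval (In (Var ''i'') ''O'') s' \<longleftrightarrow> k \<in> ?X"
        using bval_In[where e = "Var ''i''" and s = s' and k = k and n = n and a = "''O''"] k by simp
    qed (use n flagged_subset in auto)
    hence "wp ?copy (recorded (insert ?X T)) ?s3"
    proof (rule wp_use)
      fix s' assume out: "flagged n ''out'' s' = ?X" and same: "same_except (written_vars ?copy) (written_arrs ?copy) ?s3 s'"
      have "var s' ''found'' = 1" "var s' ''best'' = of_int (val ?X)"
        using same_exceptD(1)[OF same, of "''found''"] same_exceptD(1)[OF same, of "''best''"] by simp_all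
      thus "recorded (insert ?X T) s'" using min out by (simp add: recorded_def)
    qed
    thus "wp (Seq (Assign ''found'' (Const 1)) (Seq (Assign ''best'' (Var ''v'')) ?copy)) (recorded (insert ?X T)) ?s2"
      using fits_consts fit by (intro wp_Seq[of "Assign _ _"] wp_Assign) simp_all
  qed
qed

text \<open>An interval counts as treated once one of its minimizers has been offered, even if that
  set lies in the family and is rejected. The empty set and the ground set belong to no
  \<open>separating\<close> family and are offered separately.\<close>

definition progress :: "(nat \<times> nat \<times> nat \<times> nat) set \<Rightarrow> state \<Rightarrow> bool" where
  "progress D s \<longleftrightarrow> (\<exists>T. recorded T s \<and> {} \<in> T \<and> {..<n} \<in> T \<and> T \<subseteq> Pow {..<n} \<and>
     (\<forall>(r, x, t, y)\<in>D. {r, x} \<inter> {t, y} = {} \<longrightarrow> (\<exists>X\<in>T. minimizer val (separating n r x t y) X)))"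

lemma progress_set_var [simp]:
  "x \<noteq> ''found'' \<Longrightarrow> x \<noteq> ''best'' \<Longrightarrow> progress D (set_var x v s) \<longleftrightarrow> progress D s"
  by (simp add: progress_def recorded_def)

lemma wp_try_constraint:
  assumes rxty: "r < n" "x < n" "t < n" "y < n"
    and st: "var s ''n'' = of_nat n" "var s ''N'' = of_nat (6 * n ^ 3 + 1)" "var s ''r'' = of_nat r" "var s ''r2'' = of_nat x"
      "var s ''s'' = of_nat t" "var s ''s2'' = of_nat y"
    and prog: "progress D s"
  shows "wp try_constraint (progress (D \<union> {(r, x, t, y)})) s"
  unfolding try_constraint_def
proof (rule wp_Cond)
  let ?b = "Conj (Neg (Equal (Var ''r'') (Var ''s''))) (Conj (Neg (Equal (Var ''r'') (Var ''s2'')))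
       (Conj (Neg (Equal (Var ''r2'') (Var ''s''))) (Neg (Equal (Var ''r2'') (Var ''s2'')))))"
  have b: "bval ?b s \<longleftrightarrow> {r, x} \<inter> {t, y} = {}" using st by auto
  {
    assume "\<not> bval ?b s"
    thus "wp Skip (progress (D \<union> {(r, x, t, y)})) s" using b prog by (intro wp_Skip) (auto simp: progress_def)
  next
    assume "bval ?b s"
    hence disj: "{r, x} \<inter> {t, y} = {}" using b by simp
    obtain T where T: "recorded T s" "{} \<in> T" "{..<n} \<in> T" "T \<subseteq> Pow {..<n}"
      "\<forall>(r, x, t, y)\<in>D. {r, x} \<inter> {t, y} = {} \<longrightarrow> (\<exists>X\<in>T. minimizer val (separating n r x t y) X)"
      using prog unfolding progress_def by blast
    show "wp (Seq solve offer) (progress (D \<union> {(r, x, t, y)})) s"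
    proof (rule wp_Seq, rule wp_use[OF wp_solve[OF rxty disj st]])
      fix s' assume min: "minimizer val (separating n r x t y) (flagged n ''O'' s')"
        and same: "same_except (written_vars solve) (written_arrs solve) s s'"
      have "var s' ''n'' = of_nat n" using same_exceptD(1)[OF same, of "''n''"] st by simp
      moreover have "recorded T s'" by (rule recorded_same[OF same]) (use T in auto)
      ultimately have "wp offer (recorded (insert (flagged n ''O'' s') T)) s'" by (rule wp_offer)
      thus "wp offer (progress (D \<union> {(r, x, t, y)})) s'"
      proof (rule wp_use)
        fix s'' assume "recorded (insert (flagged n ''O'' s') T) s''"
        thus "progress (D \<union> {(r, x, t, y)}) s''" unfolding progress_def
          using T min flagged_subset[of n "''O''" s']
          by (intro exI[of _ "insert (flagged n ''O'' s') T"]) auto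
      qed
    qed
  }
qed

text \<open>The step is stated for an arbitrary \<open>D\<close>, so the rule nests: an inner loop
  adds its quadruples to whatever the outer loops have treated.\<close>

lemma wp_For_progress:
  assumes x: "x \<notin> insert ''n'' (insert ''found'' (insert ''best'' (written_vars c)))" "''n'' \<notin> written_vars c"
    and n: "var s ''n'' = of_nat n" and prog: "progress D s"
    and step: "\<And>k D s'. k < n \<Longrightarrow> same_except (insert x (written_vars c)) (written_arrs c) s s' \<Longrightarrow>
      var s' x = of_nat k \<Longrightarrow> progress D s' \<Longrightarrow> wp c (progress (D \<union> E k)) s'"
  shows "wp (For x Size c) (progress (D \<union> (\<Union>k<n. E k))) s"
proof (rule wp_For[where m = n and I = "\<lambda>k. progress (D \<union> (\<Union>j<k. E j))"])
  fix k and s' :: state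
  assume k: "k < n" "progress (D \<union> (\<Union>j<k. E j)) s'" "var s' x = of_nat k"
    and same: "same_except (insert x (written_vars c)) (written_arrs c) s s'"
  have "wp c (progress (D \<union> (\<Union>j<k. E j) \<union> E k)) s'" by (rule step) (use k same in auto)
  moreover have "D \<union> (\<Union>j<k. E j) \<union> E k = D \<union> (\<Union>j<Suc k. E j)" by (auto simp: less_Suc_eq)
  ultimately show "wp c (\<lambda>s''. progress (D \<union> (\<Union>j<Suc k. E j)) (set_var x (of_nat (Suc k)) s'')) s'"
    using x by simp
qed (use x n prog L_ge(3) in \<open>auto dest: same_exceptD(1)\<close>)

lemma wp_minimize_outside:
  assumes s: "var s ''n'' = of_nat n" "var s ''found'' = 0"
  shows "wp minimize_outside (progress ({..<n} \<times> {..<n} \<times> {..<n} \<times> {..<n})) s"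
proof -
  let ?all = "{..<n} \<times> {..<n} \<times> {..<n} \<times> {..<n}"
  let ?loop4 = "For ''s2'' Size try_constraint"
  let ?loop3 = "For ''s'' Size ?loop4"
  let ?loop2 = "For ''r2'' Size ?loop3"
  let ?loop1 = "For ''r'' Size ?loop2"
  let ?nN = "\<lambda>s. var s ''n'' = of_nat n \<and> var s ''N'' = of_nat (6 * n ^ 3 + 1)"
  have loop4: "wp ?loop4 (progress (D \<union> (\<Union>y<n. {(r, x, t, y)}))) s"
    if "?nN s" "progress D s" "var s ''r'' = of_nat r" "var s ''r2'' = of_nat x" "var s ''s'' = of_nat t" "r < n" "x < n" "t < n"
    for s D r x t
  proof (rule wp_For_progress)
    fix k D' and s' :: state
    assume k: "k < n" "var s' ''s2'' = of_nat k" "progress D' s'"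
      and same: "same_except (insert ''s2'' (written_vars try_constraint)) (written_arrs try_constraint) s s'"
    show "wp try_constraint (progress (D' \<union> {(r, x, t, k)})) s'"
      by (rule wp_try_constraint) (use that k same_exceptD(1)[OF same] in simp_all)
  qed (use that in simp_all)
  have loop3: "wp ?loop3 (progress (D \<union> (\<Union>t<n. \<Union>y<n. {(r, x, t, y)}))) s"
    if "?nN s" "progress D s" "var s ''r'' = of_nat r" "var s ''r2'' = of_nat x" "r < n" "x < n" for s D r x
  proof (rule wp_For_progress)
    fix k D' and s' :: state
    assume k: "k < n" "var s' ''s'' = of_nat k" "progress D' s'"
      and same: "same_except (insert ''s'' (written_vars ?loop4)) (written_arrs ?loop4) s s'"
    show "wp ?loop4 (progress (D' \<union> (\<Union>y<n. {(r, x, k, y)}))) s'"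
      by (rule loop4) (use that k same_exceptD(1)[OF same] in simp_all)
  qed (use that in simp_all)
  have loop2: "wp ?loop2 (progress (D \<union> (\<Union>x<n. \<Union>t<n. \<Union>y<n. {(r, x, t, y)}))) s"
    if "?nN s" "progress D s" "var s ''r'' = of_nat r" "r < n" for s D r
  proof (rule wp_For_progress)
    fix k D' and s' :: state
    assume k: "k < n" "var s' ''r2'' = of_nat k" "progress D' s'"
      and same: "same_except (insert ''r2'' (written_vars ?loop3)) (written_arrs ?loop3) s s'"
    show "wp ?loop3 (progress (D' \<union> (\<Union>t<n. \<Union>y<n. {(r, k, t, y)}))) s'"
      by (rule loop3) (use that k same_exceptD(1)[OF same] in simp_all)
  qed (use that in simp_all)
  have loop1: "wp ?loop1 (progress ({} \<union> (\<Union>r<n. \<Union>x<n. \<Union>t<n. \<Union>y<n. {(r, x, t, y)}))) s"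
    if "?nN s" "progress {} s" for s
  proof (rule wp_For_progress)
    fix k D' and s' :: state
    assume k: "k < n" "var s' ''r'' = of_nat k" "progress D' s'"
      and same: "same_except (insert ''r'' (written_vars ?loop2)) (written_arrs ?loop2) s s'"
    show "wp ?loop2 (progress (D' \<union> (\<Union>x<n. \<Union>t<n. \<Union>y<n. {(k, x, t, y)}))) s'"
      by (rule loop2) (use that k same_exceptD(1)[OF same] in simp_all)
  qed (use that in simp_all)
  have all: "{} \<union> (\<Union>r<n. \<Union>x<n. \<Union>t<n. \<Union>y<n. {(r, x, t, y)}) = ?all" by auto
  let ?e = "Plus (Times (Const 6) (Times Size (Times Size Size))) (Const 1)"
  have "6 * n ^ 3 + 1 \<le> (6 * n ^ 3 + 1)\<^sup>2" by (intro self_le_power) auto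
  hence fits_N: "rat_size (of_nat (6 * n ^ 3 + 1)) \<le> W" using L_ge(1) by (intro fits_count) linarith
  let ?s0 = "set_var ''N'' (of_nat (6 * n ^ 3 + 1)) s"
  have e: "aval ?e s = of_nat (6 * n ^ 3 + 1)" using s by (simp add: power3_eq_cube)
  have rec0: "recorded {} ?s0" using s by (simp add: recorded_def)
  have offer_set: "wp (Seq (set_flags ''O'' b) offer) (\<lambda>s''. ?nN s'' \<and> recorded (insert X T) s'') s'"
    if "?nN s'" "recorded T s'" "X \<subseteq> {..<n}" "\<And>s k. k < n \<Longrightarrow> bval b s \<longleftrightarrow> k \<in> X" for b X T s'
  proof -
    have "wp (set_flags ''O'' b) (\<lambda>s''. flagged n ''O'' s'' = X) s'"
      using that by (intro wp_set_flags) auto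
    hence "wp (Seq (set_flags ''O'' b) offer) (recorded (insert X T)) s'"
    proof (rule wp_Seq[OF wp_use])
      fix s'' assume O: "flagged n ''O'' s'' = X" and same: "same_except (written_vars (set_flags ''O'' b)) (written_arrs (set_flags ''O'' b)) s' s''"
      have "var s'' ''n'' = of_nat n" "recorded T s''"
        using same_exceptD(1)[OF same, of "''n''"] recorded_same[OF same _ _ that(2)] that(1) by simp_all
      from wp_offer[OF this] show "wp offer (recorded (insert X T)) s''" by (simp add: O)
    qed
    thus ?thesis
    proof (rule wp_use)
      fix s'' assume "recorded (insert X T) s''"
        and same: "same_except (written_vars (Seq (set_flags ''O'' b) offer)) (written_arrs (Seq (set_flags ''O'' b) offer)) s' s''"
      thus "?nN s'' \<and> recorded (insert X T) s''"
        using same_exceptD(1)[OF same, of "''n''"] same_exceptD(1)[OF same, of "''N''"] that(1) by simp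
    qed
  qed
  have empty: "wp (Seq (set_flags ''O'' Never) offer) (\<lambda>s'. ?nN s' \<and> recorded (insert {} {}) s') ?s0"
    by (rule offer_set) (use s rec0 in auto)
  have full: "wp (Seq (set_flags ''O'' (Less (Const 0) (Const 1))) offer)
      (\<lambda>s'. ?nN s' \<and> recorded (insert {..<n} {{}}) s') s1" if "?nN s1 \<and> recorded (insert {} {}) s1" for s1
    by (rule offer_set) (use that in auto)
  have loops: "wp ?loop1 (progress ?all) s2" if "?nN s2 \<and> recorded (insert {..<n} {{}}) s2" for s2
  proof -
    have "progress {} s2" unfolding progress_def using that by (intro exI[of _ "{{..<n}, {}}"]) auto
    thus ?thesis using loop1[of s2] that unfolding all by blast
  qed
  have "wp (Seq (Seq (set_flags ''O'' Never) offer)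
     (Seq (Seq (set_flags ''O'' (Less (Const 0) (Const 1))) offer) ?loop1)) (progress ?all) ?s0"
    by (rule wp_Seq, rule wp_use[OF empty], rule wp_Seq, rule wp_use[OF full], assumption, rule loops)
  thus ?thesis unfolding minimize_outside_def
    using fits_N by (intro wp_Seq[of "Assign _ _"] wp_Assign) (simp_all only: e)
qed

end

text \<open>Fix \<open>r \<in> X\<close> and \<open>t \<in> V - X\<close>. Any two members of
  \<open>\<F>\<close> that contain \<open>r\<close> and avoid \<open>t\<close> meet and do not cover
  \<open>V\<close>, so they form a lattice. If such a member \<open>Z x y\<close> separated every
  \<open>x \<in> X\<close> from every \<open>y \<in> V - X\<close>, then \<open>X\<close>, the union
  over \<open>x\<close> of the intersections over \<open>y\<close>, would be in
  \<open>\<F>\<close>.\<close>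

lemma separating_interval:
  assumes fin: "finite V" and cross: "crossing_family V \<F>" and X: "X \<subseteq> V" "X \<noteq> {}" "X \<noteq> V" "X \<notin> \<F>"
  obtains r x t y where "r \<in> X" "x \<in> X" "t \<in> V - X" "y \<in> V - X"
    "\<And>Z. r \<in> Z \<Longrightarrow> x \<in> Z \<Longrightarrow> t \<notin> Z \<Longrightarrow> y \<notin> Z \<Longrightarrow> Z \<notin> \<F>"
proof -
  obtain r t where rt: "r \<in> X" "t \<in> V - X" using X by blast
  define \<L> where "\<L> = {Z \<in> \<F>. r \<in> Z \<and> t \<notin> Z}"
  have lattice: "A \<union> B \<in> \<L> \<and> A \<inter> B \<in> \<L>" if "A \<in> \<L>" "B \<in> \<L>" for A B
  proof -
    have "A \<inter> B \<noteq> {}" "A \<union> B \<noteq> V" using that rt unfolding \<L>_def by blast+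
    thus ?thesis using cross that unfolding crossing_family_def \<L>_def by blast
  qed
  have Inter: "\<Inter>S \<in> \<L>" if "finite S" "S \<noteq> {}" "S \<subseteq> \<L>" for S
    using that by (induction S rule: finite_ne_induct) (use lattice in auto)
  have Union: "\<Union>S \<in> \<L>" if "finite S" "S \<noteq> {}" "S \<subseteq> \<L>" for S
    using that by (induction S rule: finite_ne_induct) (use lattice in auto)
  have "\<exists>x\<in>X. \<exists>y\<in>V - X. \<forall>Z\<in>\<L>. x \<in> Z \<longrightarrow> y \<in> Z"
  proof (rule ccontr)
    assume "\<not> ?thesis"
    hence "\<forall>x\<in>X. \<forall>y\<in>V - X. \<exists>Z\<in>\<L>. x \<in> Z \<and> y \<notin> Z" by blast
    then obtain Z where Z: "\<And>x y. x \<in> X \<Longrightarrow> y \<in> V - X \<Longrightarrow> Z x y \<in> \<L> \<and> x \<in> Z x y \<and> y \<notin> Z x y"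
      by metis
    have M: "\<Inter>(Z x ` (V - X)) \<in> \<L>" if "x \<in> X" for x
      using Z that fin rt by (intro Inter) auto
    have "(\<Union>x\<in>X. \<Inter>(Z x ` (V - X))) \<in> \<L>"
      using M X fin by (intro Union) (auto intro: finite_subset)
    moreover have "(\<Union>x\<in>X. \<Inter>(Z x ` (V - X))) = X"
    proof
      show "X \<subseteq> (\<Union>x\<in>X. \<Inter>(Z x ` (V - X)))" using Z by blast
      show "(\<Union>x\<in>X. \<Inter>(Z x ` (V - X))) \<subseteq> X"
      proof
        fix v assume "v \<in> (\<Union>x\<in>X. \<Inter>(Z x ` (V - X)))"
        then obtain x where x: "x \<in> X" "v \<in> \<Inter>(Z x ` (V - X))" by blast
        moreover have "\<Inter>(Z x ` (V - X)) \<subseteq> V"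
          using M[OF x(1)] cross unfolding \<L>_def crossing_family_def by blast
        ultimately show "v \<in> X" using Z[OF x(1), of v] by blast
      qed
    qed
    ultimately show False using X(4) by (simp add: \<L>_def)
  qed
  then obtain x y where "x \<in> X" "y \<in> V - X" "\<forall>Z\<in>\<L>. x \<in> Z \<longrightarrow> y \<in> Z" by blast
  with rt show thesis by (intro that[of r x t y]) (auto simp: \<L>_def)
qed

lemma intersecting_imp_crossing: "intersecting_family V \<F> \<Longrightarrow> crossing_family V \<F>"
  by (auto simp: intersecting_family_def crossing_family_def)

text \<open>A nonempty proper set outside the family lies in an interval that misses the family. The
  minimizer offered for this interval is then outside the family too, and at least as good.\<close>

lemma (in submodular_machine) progress_minimizer:
  assumes prog: "progress ({..<n} \<times> {..<n} \<times> {..<n} \<times> {..<n}) s"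
    and cross: "crossing_family {..<n} {X. X \<subseteq> {..<n} \<and> mem X}"
    and ne: "\<exists>X\<subseteq>{..<n}. \<not> mem X"
  shows "minimizer val {X. X \<subseteq> {..<n} \<and> \<not> mem X} (flagged n ''out'' s)"
proof -
  let ?G = "{X. X \<subseteq> {..<n} \<and> \<not> mem X}"
  obtain T where T: "recorded T s" "{} \<in> T" "{..<n} \<in> T" "T \<subseteq> Pow {..<n}"
    "\<And>r x t y. r < n \<Longrightarrow> x < n \<Longrightarrow> t < n \<Longrightarrow> y < n \<Longrightarrow> {r, x} \<inter> {t, y} = {} \<Longrightarrow>
       \<exists>X\<in>T. minimizer val (separating n r x t y) X"
    using prog unfolding progress_def by fastforce
  have better: "\<exists>Z\<in>T. \<not> mem Z \<and> val Z \<le> val X" if X: "X \<in> ?G" for X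
  proof (cases "X = {} \<or> X = {..<n}")
    case True
    thus ?thesis using X T(2,3) by auto
  next
    case False
    obtain r x t y where rxty: "r \<in> X" "x \<in> X" "t \<in> {..<n} - X" "y \<in> {..<n} - X"
      "\<And>Z. r \<in> Z \<Longrightarrow> x \<in> Z \<Longrightarrow> t \<notin> Z \<Longrightarrow> y \<notin> Z \<Longrightarrow> Z \<notin> {X. X \<subseteq> {..<n} \<and> mem X}"
      by (rule separating_interval[OF _ cross, of X]) (use X False in auto)
    moreover have "r < n" "x < n" using rxty X by auto
    ultimately obtain Z where Z: "Z \<in> T" "minimizer val (separating n r x t y) Z"
      using T(5)[of r x t y] by auto
    have "X \<in> separating n r x t y" using X rxty by (auto simp: separating_def)
    hence "val Z \<le> val X" using Z(2) by (simp add: minimizer_def)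
    moreover have "\<not> mem Z" using Z(2) rxty(5)[of Z] by (auto simp: minimizer_def separating_def)
    ultimately show ?thesis using Z(1) by blast
  qed
  have "\<not> (\<forall>X\<in>T. mem X)" using ne better by blast
  hence "minimizer val {X \<in> T. \<not> mem X} (flagged n ''out'' s)" using T(1) by (auto simp: recorded_def)
  moreover from this have "val (flagged n ''out'' s) \<le> val X" if "X \<in> ?G" for X
    using better[OF that] by (force simp: minimizer_def)
  ultimately show ?thesis using T(4) unfolding minimizer_def by blast
qed

text \<open>The extra digit is that of the denominator 1.\<close>

lemma rat_size_of_int_le:
  assumes "\<bar>z\<bar> < 2 ^ k"
  shows "rat_size (of_int z) \<le> k + 1"
proof -
  have "nat \<bar>z\<bar> < 2 ^ k" using assms by (simp add: nat_less_iff)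
  hence "floorlog 2 (nat \<bar>z\<bar>) \<le> k" by (intro floorlog_leI) auto
  moreover have "floorlog 2 (nat 1) \<le> 1" by (intro floorlog_leI) auto
  ultimately show ?thesis by (simp add: rat_size_def)
qed

text \<open>Crude estimates by powers of two, based on \<open>n + 1 \<le> 2 ^ n\<close>, suffice
  because only the number of digits must be polynomial; here it is even linear in
  \<open>n + l\<close>.\<close>

lemma capacity_less:
  "20 * (int n + 1) * (6 * int n ^ 3 + 3)\<^sup>2 * (2 ^ l + 1) < 2 ^ (7 * (n + l) + 14)"
proof -
  have n: "int n + 1 \<le> 2 ^ n" using of_nat_mono[OF Suc_leI[OF less_exp[of n]], where 'a = int] by simp
  hence cube: "int n ^ 3 \<le> (2 ^ n) ^ 3" by (intro power_mono) auto
  have "1 \<le> ((2::int) ^ n) ^ 3" by (intro one_le_power) simp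
  with cube have "6 * int n ^ 3 + 3 \<le> 16 * (2 ^ n) ^ 3" by linarith
  also have "\<dots> = 2 ^ (3 * n + 4)" by (simp add: power_add mult.commute flip: power_mult)
  finally have "(6 * int n ^ 3 + 3)\<^sup>2 \<le> (2 ^ (3 * n + 4))\<^sup>2" by (intro power_mono) auto
  hence "20 * (int n + 1) * (6 * int n ^ 3 + 3)\<^sup>2 * (2 ^ l + 1) \<le> 20 * 2 ^ n * (2 ^ (3 * n + 4))\<^sup>2 * 2 ^ (l + 1)"
    using n by (intro mult_mono) auto
  also have "\<dots> < 2 ^ 5 * 2 ^ n * (2 ^ (3 * n + 4))\<^sup>2 * 2 ^ (l + 1)" by simp
  also have "\<dots> = 2 ^ (5 + n + (3 * n + 4) * 2 + (l + 1))" by (simp only: power_add power_mult)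
  also have "\<dots> \<le> 2 ^ (7 * (n + l) + 14)" by (intro power_increasing) auto
  finally show ?thesis .
qed

theorem corollary4p1:
  "\<exists>(c :: com) (p :: nat poly) (q :: nat poly).
     \<forall>(V :: 'a set) (v :: nat \<Rightarrow> 'a) (f :: 'a set \<Rightarrow> int) (\<F> :: 'a set set).
       finite V \<longrightarrow> bij_betw v {..<card V} V \<longrightarrow> submodular_on V f \<longrightarrow>
       intersecting_family V \<F> \<or> crossing_family V \<F> \<longrightarrow>
       minimizes_outside c p q V v f \<F>"
proof -
  \<comment> \<open>The polynomial \<open>?l\<close> takes the value
    \<open>(6 * n ^ 3 + 3)\<^sup>2\<close>, the bound on iterations. The constant 15 in
    \<open>?q\<close> is the 14 of \<open>capacity_less\<close> and one digit for the
    denominator.\<close>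
  let ?l = "[:3, 0, 0, 6:]\<^sup>2 :: nat poly" and ?q = "[:15, 7:] :: nat poly"
  obtain p where p: "\<And>n. time_bound (poly ?l n) minimize_outside = poly p n"
    using time_bound_poly by blast
  have "minimizes_outside minimize_outside p ?q V v f \<F>"
    if V: "finite V" "bij_betw v {..<card V} V" and sub: "submodular_on V f"
      and fam: "intersecting_family V \<F> \<or> crossing_family V \<F>"
    for V and v :: "nat \<Rightarrow> 'a" and f \<F>
  proof -
    let ?n = "card V" and ?val = "\<lambda>I. f (v ` I)" and ?mem = "\<lambda>I. v ` I \<in> \<F>"
    let ?W = "poly ?q (card V + value_size V f)"
    have inj: "inj_on v {..<?n}" and im: "v ` {..<?n} = V" using V(2) by (auto simp: bij_betw_def)
    have vV: "v ` I \<subseteq> V" if "I \<subseteq> {..<?n}" for I using that im by auto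
    have Int: "v ` (I \<inter> J) = v ` I \<inter> v ` J" if "I \<subseteq> {..<?n}" "J \<subseteq> {..<?n}" for I J
      using inj_on_image_Int[OF inj that] .
    \<comment> \<open>The bound \<open>F\<close> on the values is the power of two given by their
      number of digits; it enters only the analysis, not the program.\<close>
    interpret submodular_machine ?n ?val ?mem ?W "poly ?l ?n" "2 ^ value_size V f"
    proof
      fix X assume "X \<subseteq> {..<?n}"
      hence "floorlog 2 (nat \<bar>f (v ` X)\<bar>) \<le> value_size V f"
        unfolding value_size_def using V(1) vV by (intro Max_ge) auto
      hence "nat \<bar>f (v ` X)\<bar> < 2 ^ value_size V f" by (intro floorlog_leD) auto
      thus "\<bar>f (v ` X)\<bar> \<le> 2 ^ value_size V f" by (simp add: nat_less_iff)
    next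
      fix z :: int assume "\<bar>z\<bar> \<le> 20 * (int ?n + 1) * (6 * int ?n ^ 3 + 3)\<^sup>2 * (2 ^ value_size V f + 1)"
      hence "\<bar>z\<bar> < 2 ^ (7 * (?n + value_size V f) + 14)" using capacity_less by (rule le_less_trans)
      from rat_size_of_int_le[OF this] show "rat_size (of_int z) \<le> ?W" by (simp add: algebra_simps)
    next
      show "poly ?l ?n = (6 * ?n ^ 3 + 3)\<^sup>2" by (simp add: power3_eq_cube algebra_simps)
      show "submodular_on {..<?n} ?val" unfolding submodular_on_def
        using sub vV Int by (auto simp: submodular_on_def image_Un)
    qed
    have cross: "crossing_family V \<F>" using fam intersecting_imp_crossing by blast
    have "wp minimize_outside (progress ({..<?n} \<times> {..<?n} \<times> {..<?n} \<times> {..<?n})) (input_state ?n)"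
      by (rule wp_minimize_outside) (simp_all add: input_state_def)
    then obtain t s where run: "run ?n ?val ?mem ?W minimize_outside (input_state ?n) t s" "t \<le> poly p ?n"
      and prog: "progress ({..<?n} \<times> {..<?n} \<times> {..<?n} \<times> {..<?n}) s"
      unfolding wp_def p by blast
    have "minimizer f (Pow V - \<F>) (v ` flagged ?n ''out'' s)" if ne: "Pow V - \<F> \<noteq> {}"
    proof -
      have cover: "\<exists>I\<subseteq>{..<?n}. X = v ` I" if "X \<subseteq> V" for X
        using that subset_image_iff[of X v "{..<?n}"] by (simp only: im)
      \<comment> \<open>The crossing property passes to index sets because \<open>v\<close> is a
        bijection: disjointness, covering the ground set and intersections are the same for index
        sets and their images.\<close>
      have "crossing_family {..<?n} {I. I \<subseteq> {..<?n} \<and> ?mem I}"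
        unfolding crossing_family_def
      proof (intro conjI ballI impI)
        fix I J assume I: "I \<in> {I. I \<subseteq> {..<?n} \<and> ?mem I}" and J: "J \<in> {I. I \<subseteq> {..<?n} \<and> ?mem I}"
          and IJ: "I \<inter> J \<noteq> {} \<and> I \<union> J \<noteq> {..<?n}"
        have "v ` (I \<union> J) \<noteq> v ` {..<?n}"
          using inj_on_image_eq_iff[OF inj, of "I \<union> J" "{..<?n}"] I J IJ by simp
        hence "v ` I \<union> v ` J \<noteq> V" by (simp only: im image_Un not_False_eq_True)
        moreover have "v ` I \<inter> v ` J \<noteq> {}" using IJ by blast
        moreover have "v ` I \<in> \<F>" "v ` J \<in> \<F>" using I J by auto
        ultimately have "v ` I \<union> v ` J \<in> \<F> \<and> v ` I \<inter> v ` J \<in> \<F>"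
          using cross by (simp add: crossing_family_def)
        moreover have "v ` (I \<inter> J) = v ` I \<inter> v ` J" by (rule Int) (use I J in auto)
        moreover have "I \<subseteq> {..<?n}" "J \<subseteq> {..<?n}" using I J by auto
        ultimately show "I \<union> J \<in> {I. I \<subseteq> {..<?n} \<and> ?mem I}" "I \<inter> J \<in> {I. I \<subseteq> {..<?n} \<and> ?mem I}"
          by (simp_all add: image_Un le_infI1)
      qed auto
      moreover have "\<exists>I\<subseteq>{..<?n}. \<not> ?mem I"
      proof -
        obtain X where X: "X \<subseteq> V" "X \<notin> \<F>" using ne by auto
        with cover[OF X(1)] show ?thesis by auto
      qed
      ultimately have min: "minimizer ?val {I. I \<subseteq> {..<?n} \<and> \<not> ?mem I} (flagged ?n ''out'' s)"
        using prog by (intro progress_minimizer)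
      show ?thesis unfolding minimizer_def
      proof (intro conjI ballI)
        show "v ` flagged ?n ''out'' s \<in> Pow V - \<F>" using min vV by (auto simp: minimizer_def)
        fix Y assume Y: "Y \<in> Pow V - \<F>"
        with cover[of Y] obtain I where "I \<subseteq> {..<?n}" "Y = v ` I" by auto
        moreover from this Y have "\<not> ?mem I" by auto
        ultimately show "f (v ` flagged ?n ''out'' s) \<le> f Y" using min by (simp add: minimizer_def)
      qed
    qed
    thus ?thesis using run unfolding minimizes_outside_def by blast
  qed
  thus ?thesis by blast
qed

end
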